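(* Let $G$ be a finite group and let $k$ be an algebraically closed field of characteristic $r>0$. Suppose $H \leq G$ is a subgroup such that $O_{r'}(H) = O^r(H)$, and let $\mathcal{L} = \operatorname{Ind}_H^G k$ be the permutation module of $G$ acting on the cosets of $H$. Let $V$ be a (finite-dimensional) $kG$-module with $V^H = 0$. Then for every $n \geq 1$, $$\operatorname{H}^n(G,V) \cong \operatorname{Ext}_{G}^{n-1}(V^*, \mathcal{L}/\mathcal{L}^G).$$
   Context: For a finite group $H$ and a prime $r$, $O_{r'}(H)$ is the largest normal subgroup of $H$ of order not divisible by $r$, and $O^r(H)$ is the smallest normal subgroup of $H$ such that $H/O^r(H)$ is an $r$-group. $V^H$ denotes the $H$-fixed points of $V$, $V^*$ the dual module, and $\operatorname{Ext}_G$ means $\operatorname{Ext}_{kG}$. $\mathcal{L}^G$ is the submodule of $G$-fixed points of $\mathcal{L}$, which is isomorphic to the trivial module $k$. All modules are finite-dimensional. *)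

theory Defs
  imports "HOL-Algebra.Algebra" "HOL-Algebra.Left_Coset"
begin

definition ring_char :: "('k, 'm) ring_scheme \<Rightarrow> nat" where
  "ring_char K = group.ord (add_monoid K) \<one>\<^bsub>K\<^esub>"

text \<open>
  \<open>O\<^sub>r\<^sub>'(H)\<close> and \<open>O\<^sup>r(H)\<close>; largest and smallest are meant with respect to inclusion.
\<close>

definition O_prime_core :: "nat \<Rightarrow> ('g, 'm) monoid_scheme \<Rightarrow> 'g set" where
  "O_prime_core r H = (GREATEST N. N \<lhd> H \<and> \<not> r dvd card N)"

definition O_residual :: "nat \<Rightarrow> ('g, 'm) monoid_scheme \<Rightarrow> 'g set" where
  "O_residual r H = (LEAST N. N \<lhd> H \<and> (\<exists>m. order (H Mod N) = r ^ m))"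


section \<open>Modules over a group algebra\<close>

text \<open>
  A \<open>kG\<close>-module is a \<open>k\<close>-vector space with a linear action of \<open>G\<close>.  The record type of modules
  extends that of rings, so the modules constructed below have fields \<^const>\<open>monoid.mult\<close> and
  \<^const>\<open>one\<close>; these carry no meaning.
\<close>

record ('k, 'v, 'g) gmodule = "('k, 'v) module" +
  act :: "'g \<Rightarrow> 'v \<Rightarrow> 'v"

locale kG_module = G: group G + K: field K + V: module K V
  for G :: "('g, 'm) monoid_scheme" and K :: "('k, 'n) ring_scheme"
    and V :: "('k, 'v, 'g) gmodule" +
  assumes act_closed: "\<lbrakk>g \<in> carrier G; v \<in> carrier V\<rbrakk> \<Longrightarrow> act V g v \<in> carrier V"
    and act_add: "\<lbrakk>g \<in> carrier G; v \<in> carrier V; w \<in> carrier V\<rbrakk> \<Longrightarrow>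
      act V g (v \<oplus>\<^bsub>V\<^esub> w) = act V g v \<oplus>\<^bsub>V\<^esub> act V g w"
    and act_smult: "\<lbrakk>g \<in> carrier G; a \<in> carrier K; v \<in> carrier V\<rbrakk> \<Longrightarrow>
      act V g (a \<odot>\<^bsub>V\<^esub> v) = a \<odot>\<^bsub>V\<^esub> act V g v"
    and act_one: "v \<in> carrier V \<Longrightarrow> act V \<one>\<^bsub>G\<^esub> v = v"
    and act_mult: "\<lbrakk>g \<in> carrier G; h \<in> carrier G; v \<in> carrier V\<rbrakk> \<Longrightarrow>
      act V (g \<otimes>\<^bsub>G\<^esub> h) v = act V g (act V h v)"

definition finite_dimensional ::
    "('k, 'n) ring_scheme \<Rightarrow> ('k, 'v, 'z) module_scheme \<Rightarrow> bool" where
  "finite_dimensional K V \<longleftrightarrow> (\<exists>B. finite B \<and> B \<subseteq> carrier V \<and>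
     (\<forall>v \<in> carrier V. \<exists>c \<in> B \<rightarrow> carrier K. v = (\<Oplus>\<^bsub>V\<^esub>b \<in> B. c b \<odot>\<^bsub>V\<^esub> b)))"

definition fixed_points :: "('k, 'v, 'g) gmodule \<Rightarrow> 'g set \<Rightarrow> 'v set" where
  "fixed_points V H = {v \<in> carrier V. \<forall>h \<in> H. act V h v = v}"

definition linear_hom :: "('k, 'n) ring_scheme \<Rightarrow> ('k, 'v, 'y) module_scheme \<Rightarrow>
    ('k, 'w, 'z) module_scheme \<Rightarrow> ('v \<Rightarrow> 'w) set" where
  "linear_hom K M N = {f \<in> carrier M \<rightarrow> carrier N.
     (\<forall>x \<in> carrier M. \<forall>y \<in> carrier M. f (x \<oplus>\<^bsub>M\<^esub> y) = f x \<oplus>\<^bsub>N\<^esub> f y) \<and>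
     (\<forall>a \<in> carrier K. \<forall>x \<in> carrier M. f (a \<odot>\<^bsub>M\<^esub> x) = a \<odot>\<^bsub>N\<^esub> f x)}"

definition linear_iso :: "('k, 'n) ring_scheme \<Rightarrow> ('k, 'v, 'y) module_scheme \<Rightarrow>
    ('k, 'w, 'z) module_scheme \<Rightarrow> bool" where
  "linear_iso K M N \<longleftrightarrow> (\<exists>f \<in> linear_hom K M N. bij_betw f (carrier M) (carrier N))"

definition kG_hom :: "('g, 'm) monoid_scheme \<Rightarrow> ('k, 'n) ring_scheme \<Rightarrow>
    ('k, 'v, 'g) gmodule \<Rightarrow> ('k, 'w, 'g) gmodule \<Rightarrow> ('v \<Rightarrow> 'w) set" where
  "kG_hom G K M N = {f \<in> linear_hom K M N.
     \<forall>g \<in> carrier G. \<forall>x \<in> carrier M. f (act M g x) = act N g (f x)}"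


section \<open>Constructions\<close>

definition with_action :: "('k, 'v) module \<Rightarrow> ('g \<Rightarrow> 'v \<Rightarrow> 'v) \<Rightarrow> ('k, 'v, 'g) gmodule" where
  "with_action M \<rho> = module.extend M (gmodule.fields \<rho>)"

definition regular_module :: "('k, 'n) ring_scheme \<Rightarrow> ('k, 'k) module" where
  "regular_module K = \<lparr>carrier = carrier K, monoid.mult = monoid.mult K, one = \<one>\<^bsub>K\<^esub>, ring.zero = \<zero>\<^bsub>K\<^esub>,
     ring.add = ring.add K, smult = monoid.mult K\<rparr>"

text \<open>
  A set \<open>C\<close> of functions from \<open>A\<close> to a module, with pointwise operations.  As in
  \<^const>\<open>PiE\<close>, functions are normalised to be \<^const>\<open>undefined\<close> outside \<open>A\<close>.
\<close>

definition pointwise_module ::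
    "('a \<Rightarrow> 'v) set \<Rightarrow> 'a set \<Rightarrow> ('k, 'v, 'z) module_scheme \<Rightarrow> ('k, 'a \<Rightarrow> 'v) module" where
  "pointwise_module C A M = \<lparr>carrier = C, monoid.mult = undefined, one = undefined,
     ring.zero = (\<lambda>x \<in> A. \<zero>\<^bsub>M\<^esub>), ring.add = (\<lambda>f f'. \<lambda>x \<in> A. f x \<oplus>\<^bsub>M\<^esub> f' x),
     smult = (\<lambda>a f. \<lambda>x \<in> A. a \<odot>\<^bsub>M\<^esub> f x)\<rparr>"

definition quot_module :: "('k, 'v, 'z) module_scheme \<Rightarrow> 'v set \<Rightarrow> ('k, 'v set) module" where
  "quot_module M S = \<lparr>carrier = a_rcosets\<^bsub>M\<^esub> S, monoid.mult = undefined, one = undefined,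
     ring.zero = S, ring.add = set_add M, smult = (\<lambda>a A. \<Union>x \<in> A. S +>\<^bsub>M\<^esub> (a \<odot>\<^bsub>M\<^esub> x))\<rparr>"

definition quot_gmodule :: "('k, 'v, 'g) gmodule \<Rightarrow> 'v set \<Rightarrow> ('k, 'v set, 'g) gmodule" where
  "quot_gmodule M S = with_action (quot_module M S) (\<lambda>g A. \<Union>x \<in> A. S +>\<^bsub>M\<^esub> (act M g x))"

definition dual_gmodule :: "('g, 'm) monoid_scheme \<Rightarrow> ('k, 'n) ring_scheme \<Rightarrow>
    ('k, 'v, 'g) gmodule \<Rightarrow> ('k, 'v \<Rightarrow> 'k, 'g) gmodule" where
  "dual_gmodule G K V = with_action
     (pointwise_module (linear_hom K V (regular_module K) \<inter> extensional (carrier V))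
        (carrier V) (regular_module K))
     (\<lambda>g f. \<lambda>v \<in> carrier V. f (act V (inv\<^bsub>G\<^esub> g) v))"

text \<open>
  The permutation module on the left cosets of \<open>H\<close>: the function \<open>f\<close> stands for the formal
  sum of the cosets \<open>C\<close> with coefficients \<open>f C\<close> (\<open>G\<close> is finite).
\<close>

definition perm_gmodule :: "('g, 'm) monoid_scheme \<Rightarrow> ('k, 'n) ring_scheme \<Rightarrow> 'g set \<Rightarrow>
    ('k, 'g set \<Rightarrow> 'k, 'g) gmodule" where
  "perm_gmodule G K H = with_action
     (pointwise_module (lcosets\<^bsub>G\<^esub> H \<rightarrow>\<^sub>E carrier K) (lcosets\<^bsub>G\<^esub> H) (regular_module K))
     (\<lambda>g f. \<lambda>C \<in> lcosets\<^bsub>G\<^esub> H. f (inv\<^bsub>G\<^esub> g <#\<^bsub>G\<^esub> C))"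

text \<open>
  The free \<open>kG\<close>-module on \<open>B\<close>: \<open>f\<close> stands for the formal sum of the \<open>h x\<close> with
  coefficients \<open>f (x, h)\<close>.
\<close>

definition free_gmodule :: "('g, 'm) monoid_scheme \<Rightarrow> ('k, 'n) ring_scheme \<Rightarrow> 'x set \<Rightarrow>
    ('k, 'x \<times> 'g \<Rightarrow> 'k, 'g) gmodule" where
  "free_gmodule G K B = with_action
     (pointwise_module
        {f \<in> B \<times> carrier G \<rightarrow>\<^sub>E carrier K. finite {p \<in> B \<times> carrier G. f p \<noteq> \<zero>\<^bsub>K\<^esub>}}
        (B \<times> carrier G) (regular_module K))
     (\<lambda>g f. \<lambda>p \<in> B \<times> carrier G. f (fst p, inv\<^bsub>G\<^esub> g \<otimes>\<^bsub>G\<^esub> snd p))"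


section \<open>Cohomology of a cochain complex\<close>

fun coboundaries :: "(nat \<Rightarrow> ('k, 'c, 'z) module_scheme) \<Rightarrow> (nat \<Rightarrow> 'c \<Rightarrow> 'c) \<Rightarrow> nat \<Rightarrow> 'c set" where
  "coboundaries C \<delta> 0 = {\<zero>\<^bsub>C 0\<^esub>}"
| "coboundaries C \<delta> (Suc n) = \<delta> n ` carrier (C n)"

definition cocycles ::
    "(nat \<Rightarrow> ('k, 'c, 'z) module_scheme) \<Rightarrow> (nat \<Rightarrow> 'c \<Rightarrow> 'c) \<Rightarrow> nat \<Rightarrow> 'c set" where
  "cocycles C \<delta> n = {x \<in> carrier (C n). \<delta> n x = \<zero>\<^bsub>C (Suc n)\<^esub>}"

definition cohomology :: "(nat \<Rightarrow> ('k, 'c, 'z) module_scheme) \<Rightarrow> (nat \<Rightarrow> 'c \<Rightarrow> 'c) \<Rightarrow> nat \<Rightarrow>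
    ('k, 'c set) module" where
  "cohomology C \<delta> n = quot_module (C n\<lparr>carrier := cocycles C \<delta> n\<rparr>) (coboundaries C \<delta> n)"


section \<open>Group cohomology\<close>

text \<open>
  \<open>H\<^sup>n(G, V)\<close> is the cohomology of inhomogeneous cochains, with coboundary
  \<open>(\<delta>f)(g\<^sub>1,\<dots>,g\<^sub>n\<^sub>+\<^sub>1) = g\<^sub>1 f(g\<^sub>2,\<dots>,g\<^sub>n\<^sub>+\<^sub>1)
     + (\<Sum>i=1..n. (-1)\<^sup>i f(g\<^sub>1,\<dots>,g\<^sub>i g\<^sub>i\<^sub>+\<^sub>1,\<dots>,g\<^sub>n\<^sub>+\<^sub>1))
     + (-1)\<^sup>n\<^sup>+\<^sup>1 f(g\<^sub>1,\<dots>,g\<^sub>n)\<close>.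
  List indices start at 0, so \<open>g\<^sub>i\<close> is \<open>gs ! (i - 1)\<close>.
\<close>

definition tuples :: "('g, 'm) monoid_scheme \<Rightarrow> nat \<Rightarrow> 'g list set" where
  "tuples G n = {gs. set gs \<subseteq> carrier G \<and> length gs = n}"

definition cochains ::
    "('g, 'm) monoid_scheme \<Rightarrow> ('k, 'v, 'g) gmodule \<Rightarrow> nat \<Rightarrow> ('k, 'g list \<Rightarrow> 'v) module" where
  "cochains G V n = pointwise_module (tuples G n \<rightarrow>\<^sub>E carrier V) (tuples G n) V"

definition alternate :: "('k, 'v, 'z) module_scheme \<Rightarrow> nat \<Rightarrow> 'v \<Rightarrow> 'v" where
  "alternate V i v = (if even i then v else \<ominus>\<^bsub>V\<^esub> v)"

definition cochain_diff :: "('g, 'm) monoid_scheme \<Rightarrow> ('k, 'v, 'g) gmodule \<Rightarrow> nat \<Rightarrow>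
    ('g list \<Rightarrow> 'v) \<Rightarrow> ('g list \<Rightarrow> 'v)" where
  "cochain_diff G V n f = (\<lambda>gs \<in> tuples G (Suc n).
     act V (hd gs) (f (tl gs)) \<oplus>\<^bsub>V\<^esub>
     (\<Oplus>\<^bsub>V\<^esub>i \<in> {1..n}. alternate V i
        (f (take (i - 1) gs @ [gs ! (i - 1) \<otimes>\<^bsub>G\<^esub> gs ! i] @ drop (i + 1) gs))) \<oplus>\<^bsub>V\<^esub>
     alternate V (Suc n) (f (butlast gs)))"

definition group_cohomology :: "('g, 'm) monoid_scheme \<Rightarrow> ('k, 'v, 'g) gmodule \<Rightarrow> nat \<Rightarrow>
    ('k, ('g list \<Rightarrow> 'v) set) module" where
  "group_cohomology G V n = cohomology (cochains G V) (cochain_diff G V) n"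


section \<open>Projective resolutions and Ext\<close>

text \<open>
  Projective means being a direct summand of a free module.  Taking the basis \<open>B\<close> in the type of
  elements of \<open>P\<close> is no restriction: if \<open>P\<close> is a summand of any free module, it is a summand of
  the free module on the set \<open>carrier P\<close>.
\<close>

definition projective_gmodule :: "('g, 'm) monoid_scheme \<Rightarrow> ('k, 'n) ring_scheme \<Rightarrow>
    ('k, 'p, 'g) gmodule \<Rightarrow> bool" where
  "projective_gmodule G K P \<longleftrightarrow> kG_module G K P \<and>
     (\<exists>B :: 'p set. \<exists>s \<in> kG_hom G K P (free_gmodule G K B).
        \<exists>p \<in> kG_hom G K (free_gmodule G K B) P. \<forall>x \<in> carrier P. p (s x) = x)"

text \<open>
  \<open>\<dots> \<rightarrow> P 2 \<rightarrow> P 1 \<rightarrow> P 0 \<rightarrow> M \<rightarrow> 0\<close> is exact, with maps \<open>d n : P (n + 1) \<rightarrow> P n\<close> and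
  augmentation \<open>\<epsilon> : P 0 \<rightarrow> M\<close>.
\<close>

definition projective_resolution :: "('g, 'm) monoid_scheme \<Rightarrow> ('k, 'n) ring_scheme \<Rightarrow>
    (nat \<Rightarrow> ('k, 'p, 'g) gmodule) \<Rightarrow> (nat \<Rightarrow> 'p \<Rightarrow> 'p) \<Rightarrow> ('p \<Rightarrow> 'v) \<Rightarrow>
    ('k, 'v, 'g) gmodule \<Rightarrow> bool" where
  "projective_resolution G K P d \<epsilon> M \<longleftrightarrow>
     (\<forall>n. projective_gmodule G K (P n)) \<and>
     (\<forall>n. d n \<in> kG_hom G K (P (Suc n)) (P n)) \<and>
     \<epsilon> \<in> kG_hom G K (P 0) M \<and>
     \<epsilon> ` carrier (P 0) = carrier M \<and>
     d 0 ` carrier (P 1) = {x \<in> carrier (P 0). \<epsilon> x = \<zero>\<^bsub>M\<^esub>} \<and>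
     (\<forall>n. d (Suc n) ` carrier (P (Suc (Suc n))) =
        {x \<in> carrier (P (Suc n)). d n x = \<zero>\<^bsub>P n\<^esub>})"

definition Hom_module :: "('g, 'm) monoid_scheme \<Rightarrow> ('k, 'n) ring_scheme \<Rightarrow>
    ('k, 'v, 'g) gmodule \<Rightarrow> ('k, 'w, 'g) gmodule \<Rightarrow> ('k, 'v \<Rightarrow> 'w) module" where
  "Hom_module G K M N =
     pointwise_module (kG_hom G K M N \<inter> extensional (carrier M)) (carrier M) N"

text \<open>
  \<open>Ext\<^sup>n(M, N)\<close> as computed from a projective resolution \<open>(P, d)\<close> of \<open>M\<close>, namely
  \<open>H\<^sup>n(Hom\<^sub>k\<^sub>G(P, N))\<close>.
  Every module has such a resolution, for instance the bar resolution, whose terms all live on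
  finitely supported functions of one type; no resolution is singled out here.
\<close>

definition Ext_module :: "('g, 'm) monoid_scheme \<Rightarrow> ('k, 'n) ring_scheme \<Rightarrow>
    (nat \<Rightarrow> ('k, 'p, 'g) gmodule) \<Rightarrow> (nat \<Rightarrow> 'p \<Rightarrow> 'p) \<Rightarrow> ('k, 'w, 'g) gmodule \<Rightarrow> nat \<Rightarrow>
    ('k, ('p \<Rightarrow> 'w) set) module" where
  "Ext_module G K P d N n = cohomology (\<lambda>i. Hom_module G K (P i) N)
     (\<lambda>i f. compose (carrier (P (Suc i))) f (d i)) n"

end

(*
  Let N = O_{r'}(H) = O^r(H).  An r-group acting on a non-zero vector space of characteristic r
  fixes a non-zero vector, so V^H = 0 forces V^N = 0.  Given a projective resolution P of V^*, averaging
  over N (|N| is invertible in k) is an H-equivariant chain map of P which lifts the zero map of V^* and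
  is therefore null-homotopic; as it does not change H-invariant functionals, Hom_H(P, k) = Hom_G(P, L)
  is exact.  The connecting map of 0 -> k -> L -> L/L^G -> 0 then identifies Ext^(n-1)(V^*, L/L^G) with
  the cohomology of Hom_G(P, k) in degree n.  The latter is H^n(G, V) by dimension shifting along
  0 -> V -> P_0^* -> P_1^* -> ..., whose terms P_j^* are acyclic by Higman's trace criterion.
  Each isomorphism of cohomology is induced by a linear relation between cocycles (quot_corr), and
  relations compose.
*)

theory Submission
  imports Defs
begin

section \<open>Linear maps\<close>

text \<open>The two descriptions of N serve opposite purposes: as O^r(H) it has r-power index, which
  carries V^H = 0 over to V^N, and as O_{r'}(H) it has order prime to r, which makes averaging
  possible. The resolution is arbitrary: its terms may be infinite-dimensional, and it is never
  compared with the bar resolution, so both sides are reached from the given P. Two devices carry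
  the weight. \<open>linear_selection\<close> yields, without bases, both linear lifts (R cut out by
  an equation, S zero) and extensions of functionals (R everything, S the data on a subspace).
  \<open>has_trace\<close> stands in for projectivity: it holds over G and over H, passes to duals,
  and gives both equivariant lifting and vanishing of cohomology. Finite dimension enters where V is
  recovered from its double dual as the kernel of P_0^* -> P_1^*. The kernels and images inside
  P_j^* remain subsets of an ambient module instead of becoming modules of their own; hence the
  cochains with values in a subset.\<close>

lemma linear_homI:
  assumes "\<And>x. x \<in> carrier M \<Longrightarrow> f x \<in> carrier N"
    and "\<And>x y. \<lbrakk>x \<in> carrier M; y \<in> carrier M\<rbrakk> \<Longrightarrow> f (x \<oplus>\<^bsub>M\<^esub> y) = f x \<oplus>\<^bsub>N\<^esub> f y"
    and "\<And>a x. \<lbrakk>a \<in> carrier K; x \<in> carrier M\<rbrakk> \<Longrightarrow> f (a \<odot>\<^bsub>M\<^esub> x) = a \<odot>\<^bsub>N\<^esub> f x"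
  shows "f \<in> linear_hom K M N"
  using assms by (auto simp: linear_hom_def)

lemma linear_hom_closed: "\<lbrakk>f \<in> linear_hom K M N; x \<in> carrier M\<rbrakk> \<Longrightarrow> f x \<in> carrier N"
  by (auto simp: linear_hom_def)

lemma linear_hom_add:
  "\<lbrakk>f \<in> linear_hom K M N; x \<in> carrier M; y \<in> carrier M\<rbrakk> \<Longrightarrow> f (x \<oplus>\<^bsub>M\<^esub> y) = f x \<oplus>\<^bsub>N\<^esub> f y"
  by (auto simp: linear_hom_def)

lemma linear_hom_smult:
  "\<lbrakk>f \<in> linear_hom K M N; a \<in> carrier K; x \<in> carrier M\<rbrakk> \<Longrightarrow> f (a \<odot>\<^bsub>M\<^esub> x) = a \<odot>\<^bsub>N\<^esub> f x"
  by (auto simp: linear_hom_def)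

text \<open>\<open>linear_hom\<close> constrains values on the carrier only, whereas duals and Hom
  modules store functions normalised outside it. This passes between a function and its
  restriction.\<close>

lemma linear_hom_cong:
  "\<lbrakk>\<And>x. x \<in> carrier M \<Longrightarrow> f x = g x; module K M\<rbrakk> \<Longrightarrow> f \<in> linear_hom K M N \<longleftrightarrow> g \<in> linear_hom K M N"
  by (auto simp: linear_hom_def Pi_iff module.smult_closed abelian_monoid.a_closed
      abelian_group.axioms(1) module.axioms(2))

lemma linear_hom_comp:
  "\<lbrakk>f \<in> linear_hom K M N; g \<in> linear_hom K N Q\<rbrakk> \<Longrightarrow> (\<lambda>x. g (f x)) \<in> linear_hom K M Q"
  by (auto simp: linear_hom_def Pi_def)

context
  fixes K :: "('k, 'n) ring_scheme" and M :: "('k, 'v, 'y) module_scheme"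
    and N :: "('k, 'w, 'z) module_scheme"
  assumes M: "module K M" and N: "module K N"
begin

interpretation M: module K M by (rule M)
interpretation N: module K N by (rule N)

lemma linear_hom_zero: "f \<in> linear_hom K M N \<Longrightarrow> f \<zero>\<^bsub>M\<^esub> = \<zero>\<^bsub>N\<^esub>"
  using linear_hom_smult[of f K M N "\<zero>\<^bsub>K\<^esub>" "\<zero>\<^bsub>M\<^esub>"] linear_hom_closed[of f K M N "\<zero>\<^bsub>M\<^esub>"] by simp

lemma linear_hom_a_inv:
  "\<lbrakk>f \<in> linear_hom K M N; x \<in> carrier M\<rbrakk> \<Longrightarrow> f (\<ominus>\<^bsub>M\<^esub> x) = \<ominus>\<^bsub>N\<^esub> f x"
  using linear_hom_smult[of f K M N "\<ominus>\<^bsub>K\<^esub> \<one>\<^bsub>K\<^esub>" x] linear_hom_closed[of f K M N x]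
  by (simp add: M.smult_l_minus N.smult_l_minus)

lemma linear_hom_minus:
  "\<lbrakk>f \<in> linear_hom K M N; x \<in> carrier M; y \<in> carrier M\<rbrakk> \<Longrightarrow> f (x \<ominus>\<^bsub>M\<^esub> y) = f x \<ominus>\<^bsub>N\<^esub> f y"
  by (simp add: a_minus_def linear_hom_add linear_hom_a_inv)

lemma linear_hom_finsum:
  assumes "f \<in> linear_hom K M N" and "\<And>i. i \<in> A \<Longrightarrow> g i \<in> carrier M"
  shows "f (\<Oplus>\<^bsub>M\<^esub>i \<in> A. g i) = (\<Oplus>\<^bsub>N\<^esub>i \<in> A. f (g i))"
proof (cases "finite A")
  case True
  then show ?thesis using assms(2)
  proof (induction A)
    case empty
    then show ?case by (simp add: linear_hom_zero assms(1))
  next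
    case (insert i A)
    then have *: "g \<in> A \<rightarrow> carrier M" "(\<lambda>i. f (g i)) \<in> A \<rightarrow> carrier N"
        "g i \<in> carrier M" "f (g i) \<in> carrier N"
      using linear_hom_closed[OF assms(1)] by auto
    then show ?case
      using insert by (simp add: linear_hom_add[OF assms(1)])
  qed
next
  case False
  then show ?thesis by (simp add: M.finsum_infinite N.finsum_infinite linear_hom_zero assms(1))
qed

lemma linear_hom_zero_fun: "(\<lambda>x. \<zero>\<^bsub>N\<^esub>) \<in> linear_hom K M N"
  by (auto simp: linear_hom_def)

lemma linear_hom_add_fun:
  "\<lbrakk>f \<in> linear_hom K M N; g \<in> linear_hom K M N\<rbrakk> \<Longrightarrow> (\<lambda>x. f x \<oplus>\<^bsub>N\<^esub> g x) \<in> linear_hom K M N"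
  by (intro linear_homI)
    (simp_all add: linear_hom_closed linear_hom_add linear_hom_smult N.a_ac N.smult_r_distr)

lemma linear_hom_smult_fun:
  "\<lbrakk>f \<in> linear_hom K M N; a \<in> carrier K\<rbrakk> \<Longrightarrow> (\<lambda>x. a \<odot>\<^bsub>N\<^esub> f x) \<in> linear_hom K M N"
  by (intro linear_homI)
    (simp_all add: linear_hom_closed linear_hom_add linear_hom_smult N.smult_r_distr
      N.smult_assoc1[symmetric] M.m_comm)

lemma linear_hom_minus_fun:
  assumes "f \<in> linear_hom K M N" "g \<in> linear_hom K M N"
  shows "(\<lambda>x. f x \<ominus>\<^bsub>N\<^esub> g x) \<in> linear_hom K M N"
proof -
  have "(\<lambda>x. f x \<oplus>\<^bsub>N\<^esub> (\<ominus>\<^bsub>K\<^esub> \<one>\<^bsub>K\<^esub>) \<odot>\<^bsub>N\<^esub> g x) \<in> linear_hom K M N"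
    by (intro linear_hom_add_fun linear_hom_smult_fun assms) simp
  then show ?thesis
    by (subst linear_hom_cong[OF _ M])
      (auto simp: a_minus_def N.smult_l_minus linear_hom_closed[OF assms(2)])
qed

lemma linear_hom_finsum_fun:
  assumes "\<And>i. i \<in> A \<Longrightarrow> f i \<in> linear_hom K M N"
  shows "(\<lambda>x. \<Oplus>\<^bsub>N\<^esub>i \<in> A. f i x) \<in> linear_hom K M N"
proof (cases "finite A")
  case True
  then show ?thesis using assms
  proof (induction A)
    case empty
    then show ?case by (simp add: linear_hom_zero_fun)
  next
    case (insert i A)
    have "(\<lambda>x. f i x \<oplus>\<^bsub>N\<^esub> (\<Oplus>\<^bsub>N\<^esub>i \<in> A. f i x)) \<in> linear_hom K M N"
      using insert by (intro linear_hom_add_fun) auto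
    moreover have "(\<Oplus>\<^bsub>N\<^esub>i \<in> insert i A. f i x) = f i x \<oplus>\<^bsub>N\<^esub> (\<Oplus>\<^bsub>N\<^esub>i \<in> A. f i x)"
      if "x \<in> carrier M" for x
      using insert that by (intro N.finsum_insert) (auto intro: linear_hom_closed)
    ultimately show ?case
      by (subst linear_hom_cong[OF _ M]) auto
  qed
next
  case False
  then show ?thesis by (simp add: N.finsum_infinite linear_hom_zero_fun)
qed

end

section \<open>Submodule criterion, and modules built from records and pointwise operations\<close>

lemma (in abelian_group) diff_zero [simp]: "x \<in> carrier G \<Longrightarrow> x \<ominus> \<zero> = x"
  using minus_equality[of \<zero> \<zero>] by (simp add: a_minus_def)

lemma (in module) submoduleI':
  assumes "S \<subseteq> carrier M" "\<zero>\<^bsub>M\<^esub> \<in> S"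
    and "\<And>x y. \<lbrakk>x \<in> S; y \<in> S\<rbrakk> \<Longrightarrow> x \<oplus>\<^bsub>M\<^esub> y \<in> S"
    and "\<And>a x. \<lbrakk>a \<in> carrier R; x \<in> S\<rbrakk> \<Longrightarrow> a \<odot>\<^bsub>M\<^esub> x \<in> S"
  shows "submodule S R M"
proof (rule submoduleI)
  show "\<ominus>\<^bsub>M\<^esub> x \<in> S" if "x \<in> S" for x
    using assms(4)[of "\<ominus> \<one>" x] that assms(1) by (auto simp: smult_l_minus)
qed (use assms in auto)

text \<open>The fields for ring multiplication, unit and action carry no meaning for the linear
  structure, so records that differ only there have to be interchangeable.
  \<open>module_cong\<close> extends this to scalars.\<close>

lemma abelian_group_cong:
  assumes "abelian_group M" "carrier N = carrier M" "ring.add N = ring.add M" "ring.zero N = ring.zero M"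
  shows "abelian_group N"
proof -
  interpret abelian_group M by (rule assms)
  show ?thesis
    by (rule abelian_groupI) (auto simp: assms(2-) a_ac intro: l_neg)
qed

lemma module_cong:
  assumes "module K M" "carrier N = carrier M" "ring.add N = ring.add M" "ring.zero N = ring.zero M" "smult N = smult M"
  shows "module K N"
proof -
  interpret module K M by (rule assms)
  show ?thesis
    by (rule moduleI)
      (auto simp: assms(2-) smult_l_distr smult_r_distr smult_assoc1
        intro: abelian_group_cong[OF M.abelian_group_axioms] is_cring)
qed

lemma with_action_simps [simp]:
  "carrier (with_action M \<rho>) = carrier M" "ring.add (with_action M \<rho>) = ring.add M"
  "ring.zero (with_action M \<rho>) = ring.zero M" "smult (with_action M \<rho>) = smult M"
  "act (with_action M \<rho>) = \<rho>"
  by (simp_all add: with_action_def module.extend_def gmodule.fields_def)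

lemma module_with_action: "module K M \<Longrightarrow> module K (with_action M \<rho>)"
  by (erule module_cong) simp_all

lemma regular_module_simps [simp]:
  "carrier (regular_module K) = carrier K" "ring.add (regular_module K) = ring.add K"
  "ring.zero (regular_module K) = ring.zero K" "smult (regular_module K) = monoid.mult K"
  by (simp_all add: regular_module_def)

lemma module_regular_module: "cring K \<Longrightarrow> module K (regular_module K)"
proof -
  assume "cring K"
  then interpret cring K .
  show ?thesis
    by (rule moduleI)
      (auto simp: l_distr r_distr m_assoc is_cring intro: abelian_group_cong[OF abelian_group_axioms])
qed

lemma a_inv_regular_module [simp]: "a_inv (regular_module K) = a_inv K"
  by (simp add: a_inv_def regular_module_def m_inv_def fun_eq_iff)

lemma a_minus_regular_module [simp]: "a_minus (regular_module K) = a_minus K"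
  by (simp add: a_minus_def fun_eq_iff)

text \<open>Both structures have the same additive monoid, on which \<open>finsum\<close> is
  defined. Sums of functionals can thus be taken in \<open>regular_module K\<close>, where the
  linear-map lemmas apply, and read off in \<open>K\<close>.\<close>

lemma finsum_regular_module [simp]: "finsum (regular_module K) = finsum K"
  by (simp add: finsum_def finprod_def regular_module_def fun_eq_iff)

lemma pointwise_module_simps [simp]:
  "carrier (pointwise_module C A M) = C"
  "ring.add (pointwise_module C A M) f g = (\<lambda>x \<in> A. f x \<oplus>\<^bsub>M\<^esub> g x)"
  "ring.zero (pointwise_module C A M) = (\<lambda>x \<in> A. \<zero>\<^bsub>M\<^esub>)"
  "smult (pointwise_module C A M) a f = (\<lambda>x \<in> A. a \<odot>\<^bsub>M\<^esub> f x)"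
  by (simp_all add: pointwise_module_def)

text \<open>Negatives are multiples by minus one, so closure under zero, sums and scalars is enough.
  Duals, free modules, permutation modules, cochains and Hom modules are all instances.\<close>

lemma module_pointwise_module:
  assumes "module K M" and C: "C \<subseteq> A \<rightarrow>\<^sub>E carrier M" and "(\<lambda>x \<in> A. \<zero>\<^bsub>M\<^esub>) \<in> C"
    and add: "\<And>f g. \<lbrakk>f \<in> C; g \<in> C\<rbrakk> \<Longrightarrow> (\<lambda>x \<in> A. f x \<oplus>\<^bsub>M\<^esub> g x) \<in> C"
    and sm: "\<And>a f. \<lbrakk>a \<in> carrier K; f \<in> C\<rbrakk> \<Longrightarrow> (\<lambda>x \<in> A. a \<odot>\<^bsub>M\<^esub> f x) \<in> C"
  shows "module K (pointwise_module C A M)"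
proof -
  interpret module K M by (rule assms)
  have cl: "f x \<in> carrier M" if "f \<in> C" "x \<in> A" for f x
    using that C by auto
  have ext: "(\<lambda>x \<in> A. f x) = f" if "f \<in> C" for f
    using that C by (auto simp: PiE_def extensional_restrict)
  show ?thesis
  proof (rule moduleI)
    show "abelian_group (pointwise_module C A M)"
    proof (rule abelian_groupI)
      fix f assume "f \<in> carrier (pointwise_module C A M)"
      then have f: "f \<in> C" by simp
      show "\<zero>\<^bsub>pointwise_module C A M\<^esub> \<oplus>\<^bsub>pointwise_module C A M\<^esub> f = f"
        using f cl ext[OF f] by (simp cong: restrict_cong)
      have "(\<lambda>x\<in>A. (\<ominus>\<^bsub>K\<^esub> \<one>\<^bsub>K\<^esub>) \<odot>\<^bsub>M\<^esub> f x) \<in> C"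
        using sm[OF _ f] by simp
      then show "\<exists>g \<in> carrier (pointwise_module C A M).
          g \<oplus>\<^bsub>pointwise_module C A M\<^esub> f = \<zero>\<^bsub>pointwise_module C A M\<^esub>"
        by (intro bexI[of _ "\<lambda>x\<in>A. (\<ominus>\<^bsub>K\<^esub> \<one>\<^bsub>K\<^esub>) \<odot>\<^bsub>M\<^esub> f x"])
          (simp_all add: cl[OF f] smult_l_minus M.l_neg cong: restrict_cong)
    qed (auto simp: assms(3) add cl M.a_ac cong: restrict_cong)
  next
    fix f assume f: "f \<in> carrier (pointwise_module C A M)"
    then show "\<one>\<^bsub>K\<^esub> \<odot>\<^bsub>pointwise_module C A M\<^esub> f = f"
      using cl[of f] ext[of f] by (simp cong: restrict_cong)
  qed (auto simp: sm is_cring smult_l_distr smult_r_distr smult_assoc1 cl cong: restrict_cong)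
qed


section \<open>Linear relations\<close>

text \<open>A subspace of the product of \<open>M\<close> and \<open>N\<close>, written as a
  relation so that no product module has to be built. It serves as the graph of a partial linear map
  and as a correspondence between cocycles.\<close>

definition linear_rel :: "('k, 'n) ring_scheme \<Rightarrow> ('k, 'v, 'y) module_scheme \<Rightarrow>
    ('k, 'w, 'z) module_scheme \<Rightarrow> ('v \<times> 'w) set \<Rightarrow> bool" where
  "linear_rel K M N R \<longleftrightarrow> R \<subseteq> carrier M \<times> carrier N \<and> (\<zero>\<^bsub>M\<^esub>, \<zero>\<^bsub>N\<^esub>) \<in> R \<and>
     (\<forall>(x, y) \<in> R. \<forall>(x', y') \<in> R. (x \<oplus>\<^bsub>M\<^esub> x', y \<oplus>\<^bsub>N\<^esub> y') \<in> R) \<and>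
     (\<forall>a \<in> carrier K. \<forall>(x, y) \<in> R. (a \<odot>\<^bsub>M\<^esub> x, a \<odot>\<^bsub>N\<^esub> y) \<in> R)"

lemma linear_relI:
  assumes "\<And>x y. (x, y) \<in> R \<Longrightarrow> x \<in> carrier M" "\<And>x y. (x, y) \<in> R \<Longrightarrow> y \<in> carrier N"
    and "(\<zero>\<^bsub>M\<^esub>, \<zero>\<^bsub>N\<^esub>) \<in> R"
    and "\<And>x y x' y'. \<lbrakk>(x, y) \<in> R; (x', y') \<in> R\<rbrakk> \<Longrightarrow> (x \<oplus>\<^bsub>M\<^esub> x', y \<oplus>\<^bsub>N\<^esub> y') \<in> R"
    and "\<And>a x y. \<lbrakk>a \<in> carrier K; (x, y) \<in> R\<rbrakk> \<Longrightarrow> (a \<odot>\<^bsub>M\<^esub> x, a \<odot>\<^bsub>N\<^esub> y) \<in> R"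
  shows "linear_rel K M N R"
  unfolding linear_rel_def
proof (intro conjI ballI subsetI; clarify?)
  show "(\<zero>\<^bsub>M\<^esub>, \<zero>\<^bsub>N\<^esub>) \<in> R" by (rule assms(3))
qed (use assms(1,2,4,5) in simp_all)

lemma linear_relD:
  assumes "linear_rel K M N R"
  shows "(x, y) \<in> R \<Longrightarrow> x \<in> carrier M" "(x, y) \<in> R \<Longrightarrow> y \<in> carrier N"
    and "(\<zero>\<^bsub>M\<^esub>, \<zero>\<^bsub>N\<^esub>) \<in> R"
    and "\<lbrakk>(x, y) \<in> R; (x', y') \<in> R\<rbrakk> \<Longrightarrow> (x \<oplus>\<^bsub>M\<^esub> x', y \<oplus>\<^bsub>N\<^esub> y') \<in> R"
    and "\<lbrakk>a \<in> carrier K; (x, y) \<in> R\<rbrakk> \<Longrightarrow> (a \<odot>\<^bsub>M\<^esub> x, a \<odot>\<^bsub>N\<^esub> y) \<in> R"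
  using assms by (auto simp: linear_rel_def)

lemma linear_rel_minus:
  assumes "module K M" "module K N" "linear_rel K M N R" "(x, y) \<in> R" "(x', y') \<in> R"
  shows "(x \<ominus>\<^bsub>M\<^esub> x', y \<ominus>\<^bsub>N\<^esub> y') \<in> R"
proof -
  interpret M: module K M by (rule assms)
  interpret N: module K N by (rule assms)
  have "((\<ominus>\<^bsub>K\<^esub> \<one>\<^bsub>K\<^esub>) \<odot>\<^bsub>M\<^esub> x', (\<ominus>\<^bsub>K\<^esub> \<one>\<^bsub>K\<^esub>) \<odot>\<^bsub>N\<^esub> y') \<in> R"
    using assms by (intro linear_relD(5)[OF assms(3)]) auto
  then show ?thesis
    using linear_relD(1,2)[OF assms(3,5)] linear_relD(4)[OF assms(3,4)]
    by (auto simp: M.smult_l_minus N.smult_l_minus a_minus_def)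
qed

text \<open>Zorn's lemma on the partial linear functions contained in \<open>R\<close> and extending \<open>S\<close>.\<close>

lemma linear_selection:
  assumes K: "field K" and M: "module K M" and N: "module K N"
    and R: "linear_rel K M N R" and S: "linear_rel K M N S" "S \<subseteq> R"
    and S0: "\<And>y. (\<zero>\<^bsub>M\<^esub>, y) \<in> S \<Longrightarrow> y = \<zero>\<^bsub>N\<^esub>"
    and total: "\<And>x. x \<in> carrier M \<Longrightarrow> \<exists>y. (x, y) \<in> R"
  obtains f where "f \<in> linear_hom K M N" "\<And>x. x \<in> carrier M \<Longrightarrow> (x, f x) \<in> R"
    "\<And>x y. (x, y) \<in> S \<Longrightarrow> f x = y"
proof -
  interpret K: field K by (rule K)
  interpret M: module K M by (rule M)
  interpret N: module K N by (rule N)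
  define Z where "Z = {T. linear_rel K M N T \<and> S \<subseteq> T \<and> T \<subseteq> R \<and> (\<forall>y. (\<zero>\<^bsub>M\<^esub>, y) \<in> T \<longrightarrow> y = \<zero>\<^bsub>N\<^esub>)}"
  have "\<exists>T\<in>Z. \<forall>Q'\<in>Z. T \<subseteq> Q' \<longrightarrow> Q' = T"
  proof (rule subset_Zorn_nonempty)
    show "Z \<noteq> {}" using S S0 by (auto simp: Z_def)
  next
    fix C assume C: "C \<noteq> {}" "subset.chain Z C"
    have CZ: "T \<in> Z" if "T \<in> C" for T
      using that C(2) by (auto simp: subset.chain_def)
    then have lin: "linear_rel K M N T" if "T \<in> C" for T
      using that by (auto simp: Z_def)
    have "linear_rel K M N (\<Union>C)"
    proof (rule linear_relI)
      fix x y x' y' assume *: "(x, y) \<in> \<Union>C" "(x', y') \<in> \<Union>C"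
      then obtain T T' where T: "T \<in> C" "T' \<in> C" "(x, y) \<in> T" "(x', y') \<in> T'" by auto
      then have "T \<subseteq> T' \<or> T' \<subseteq> T" using C(2) by (auto simp: subset.chain_def)
      then obtain U where "U \<in> C" "(x, y) \<in> U" "(x', y') \<in> U" using T by blast
      then show "(x \<oplus>\<^bsub>M\<^esub> x', y \<oplus>\<^bsub>N\<^esub> y') \<in> \<Union>C" using linear_relD(4)[OF lin] by blast
    next
      obtain T where "T \<in> C" using C(1) by blast
      then show "(\<zero>\<^bsub>M\<^esub>, \<zero>\<^bsub>N\<^esub>) \<in> \<Union>C" using linear_relD(3)[OF lin] by blast
    next
      fix a x y assume "a \<in> carrier K" "(x, y) \<in> \<Union>C"
      then show "(a \<odot>\<^bsub>M\<^esub> x, a \<odot>\<^bsub>N\<^esub> y) \<in> \<Union>C" using linear_relD(5)[OF lin] by blast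
    next
      fix x y assume "(x, y) \<in> \<Union>C"
      then show "x \<in> carrier M" "y \<in> carrier N" using linear_relD(1,2)[OF lin] by blast+
    qed
    moreover have "S \<subseteq> \<Union>C" using C(1) CZ by (fastforce simp: Z_def)
    ultimately show "\<Union>C \<in> Z" using CZ by (auto simp: Z_def)
  qed
  then obtain T where "T \<in> Z" and max: "\<And>Q'. Q' \<in> Z \<Longrightarrow> T \<subseteq> Q' \<Longrightarrow> Q' = T" by blast
  then have T: "linear_rel K M N T" "S \<subseteq> T" "T \<subseteq> R" "\<And>y. (\<zero>\<^bsub>M\<^esub>, y) \<in> T \<Longrightarrow> y = \<zero>\<^bsub>N\<^esub>"
    by (auto simp: Z_def)
  note TD = linear_relD[OF T(1)]
  have dom: "\<exists>y. (x, y) \<in> T" if x: "x \<in> carrier M" for x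
  proof (rule ccontr)
    assume nx: "\<nexists>y. (x, y) \<in> T"
    obtain y where xy: "(x, y) \<in> R" using total[OF x] by blast
    have y: "y \<in> carrier N" using linear_relD(2)[OF R xy] .
    \<comment> \<open>The extension of \<open>T\<close> by the line through \<open>(x, y)\<close>;
      once it is shown to be in \<open>Z\<close>, maximality forces it to be \<open>T\<close>,
      although \<open>x\<close> is not in the domain of \<open>T\<close>.\<close>
    define U where "U = {(w \<oplus>\<^bsub>M\<^esub> a \<odot>\<^bsub>M\<^esub> x, z \<oplus>\<^bsub>N\<^esub> a \<odot>\<^bsub>N\<^esub> y) | w z a. (w, z) \<in> T \<and> a \<in> carrier K}"
    have UI: "(w \<oplus>\<^bsub>M\<^esub> a \<odot>\<^bsub>M\<^esub> x, z \<oplus>\<^bsub>N\<^esub> a \<odot>\<^bsub>N\<^esub> y) \<in> U" if "(w, z) \<in> T" "a \<in> carrier K" for w z a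
      using that by (auto simp: U_def)
    have TU: "T \<subseteq> U"
    proof clarify
      fix w z assume "(w, z) \<in> T"
      from UI[OF this, of "\<zero>\<^bsub>K\<^esub>"] show "(w, z) \<in> U" using x y TD(1,2)[OF \<open>(w, z) \<in> T\<close>] by simp
    qed
    have "linear_rel K M N U"
    proof (rule linear_relI)
      show "(\<zero>\<^bsub>M\<^esub>, \<zero>\<^bsub>N\<^esub>) \<in> U" using TU TD(3) by auto
    next
      fix p q p' q' assume "(p, q) \<in> U" "(p', q') \<in> U"
      then obtain w z a w' z' a' where *: "(w, z) \<in> T" "a \<in> carrier K" "(w', z') \<in> T" "a' \<in> carrier K"
          "p = w \<oplus>\<^bsub>M\<^esub> a \<odot>\<^bsub>M\<^esub> x" "q = z \<oplus>\<^bsub>N\<^esub> a \<odot>\<^bsub>N\<^esub> y" "p' = w' \<oplus>\<^bsub>M\<^esub> a' \<odot>\<^bsub>M\<^esub> x" "q' = z' \<oplus>\<^bsub>N\<^esub> a' \<odot>\<^bsub>N\<^esub> y"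
        by (auto simp: U_def)
      note c = TD(1,2)[OF *(1)] TD(1,2)[OF *(3)]
      have "p \<oplus>\<^bsub>M\<^esub> p' = (w \<oplus>\<^bsub>M\<^esub> w') \<oplus>\<^bsub>M\<^esub> (a \<oplus>\<^bsub>K\<^esub> a') \<odot>\<^bsub>M\<^esub> x"
        using * c x by (simp add: M.smult_l_distr M.M.a_ac)
      moreover have "q \<oplus>\<^bsub>N\<^esub> q' = (z \<oplus>\<^bsub>N\<^esub> z') \<oplus>\<^bsub>N\<^esub> (a \<oplus>\<^bsub>K\<^esub> a') \<odot>\<^bsub>N\<^esub> y"
        using * c y by (simp add: N.smult_l_distr N.M.a_ac)
      ultimately show "(p \<oplus>\<^bsub>M\<^esub> p', q \<oplus>\<^bsub>N\<^esub> q') \<in> U"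
        using UI[OF TD(4)[OF *(1,3)], of "a \<oplus>\<^bsub>K\<^esub> a'"] * by simp
    next
      fix b p q assume b: "b \<in> carrier K" "(p, q) \<in> U"
      then obtain w z a where *: "(w, z) \<in> T" "a \<in> carrier K" 
          "p = w \<oplus>\<^bsub>M\<^esub> a \<odot>\<^bsub>M\<^esub> x" "q = z \<oplus>\<^bsub>N\<^esub> a \<odot>\<^bsub>N\<^esub> y"
        by (auto simp: U_def)
      note c = TD(1,2)[OF *(1)]
      show "(b \<odot>\<^bsub>M\<^esub> p, b \<odot>\<^bsub>N\<^esub> q) \<in> U"
        using UI[OF TD(5)[OF b(1) *(1)], of "b \<otimes>\<^bsub>K\<^esub> a"] * c b x y
        by (simp add: M.smult_r_distr N.smult_r_distr M.smult_assoc1 N.smult_assoc1)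
    qed (use x y TD(1,2) in \<open>auto simp: U_def\<close>)
    moreover have "U \<subseteq> R"
      using T(3) linear_relD(4)[OF R] linear_relD(5)[OF R _ xy] by (auto simp: U_def)
    moreover have "q = \<zero>\<^bsub>N\<^esub>" if q: "(\<zero>\<^bsub>M\<^esub>, q) \<in> U" for q
    proof -
      obtain w z a where *: "(w, z) \<in> T" "a \<in> carrier K" 
          "\<zero>\<^bsub>M\<^esub> = w \<oplus>\<^bsub>M\<^esub> a \<odot>\<^bsub>M\<^esub> x" "q = z \<oplus>\<^bsub>N\<^esub> a \<odot>\<^bsub>N\<^esub> y"
        using q by (auto simp: U_def)
      note c = TD(1,2)[OF *(1)]
      \<comment> \<open>If \<open>a\<close> were invertible, the equation would express
        \<open>x\<close> as a multiple of \<open>w\<close>, and \<open>x\<close> would already be in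
        the domain of \<open>T\<close>.\<close>
      have "a = \<zero>\<^bsub>K\<^esub>"
      proof (rule ccontr)
        assume "a \<noteq> \<zero>\<^bsub>K\<^esub>"
        then have a: "a \<in> Units K" using *(2) K.field_Units by auto
        then have ai: "inv\<^bsub>K\<^esub> a \<in> carrier K" by simp
        have "w = \<ominus>\<^bsub>M\<^esub> (a \<odot>\<^bsub>M\<^esub> x)" using *(2,3) c x by (metis M.M.minus_equality M.smult_closed)
        then have "(\<ominus>\<^bsub>K\<^esub> (inv\<^bsub>K\<^esub> a)) \<odot>\<^bsub>M\<^esub> w = inv\<^bsub>K\<^esub> a \<odot>\<^bsub>M\<^esub> (a \<odot>\<^bsub>M\<^esub> x)"
          using *(2) c x ai by (simp add: M.smult_l_minus M.smult_r_minus)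
        also have "\<dots> = x"
          using a *(2) ai x by (simp add: M.smult_assoc1[symmetric])
        finally show False using TD(5)[OF _ *(1), of "\<ominus>\<^bsub>K\<^esub> (inv\<^bsub>K\<^esub> a)"] ai nx by auto
      qed
      then show ?thesis using * c x y T(4) by simp
    qed
    ultimately have "U \<in> Z" using TU T(2) by (auto simp: Z_def)
    then have "U = T" using max TU by blast
    moreover have "(x, y) \<in> U"
      using UI[OF TD(3), of "\<one>\<^bsub>K\<^esub>"] x y by simp
    ultimately show False using nx by auto
  qed
  \<comment> \<open>Two values over one point differ by a value over zero, which vanishes by the
    last condition in \<open>Z\<close>.\<close>
  have uniq: "y = y'" if "(x, y) \<in> T" "(x, y') \<in> T" for x y y'
    using linear_rel_minus[OF M N T(1) that] T(4)[of "y \<ominus>\<^bsub>N\<^esub> y'"] TD(1,2)[OF that(1)] TD(2)[OF that(2)]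
    by (metis M.M.r_neg N.M.add.inv_solve_right N.M.l_zero a_minus_def N.M.zero_closed)
  define f where "f x = (THE y. (x, y) \<in> T)" for x
  have f: "(x, f x) \<in> T" if "x \<in> carrier M" for x
    unfolding f_def using dom[OF that] uniq by (metis theI)
  have fI: "f x = y" if "(x, y) \<in> T" for x y
    using uniq[OF that] f[OF TD(1)[OF that]] by auto
  have "f \<in> linear_hom K M N"
    using TD(2,4,5) f by (intro linear_homI fI) blast+
  then show thesis
    using that[of f] f fI T(2,3) by blast
qed


section \<open>Isomorphisms of quotients given by linear relations\<close>

text \<open>A correspondence that presents Z/B and Z'/B' as isomorphic. Keeping all related pairs,
  in place of a function, means that connecting maps need no choice of lifts and no proof that the
  choice is immaterial.\<close>

definition quot_corr :: "('k, 'n) ring_scheme \<Rightarrow> ('k, 'v, 'y) module_scheme \<Rightarrow> 'v set \<Rightarrow> 'v set \<Rightarrow>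
    ('k, 'w, 'z) module_scheme \<Rightarrow> 'w set \<Rightarrow> 'w set \<Rightarrow> bool" where
  "quot_corr K M Z B M' Z' B' \<longleftrightarrow> (\<exists>R. linear_rel K M M' R \<and> Domain R = Z \<and> Range R = Z' \<and>
     (\<forall>(x, y) \<in> R. x \<in> B \<longleftrightarrow> y \<in> B'))"

lemma quot_corrI:
  assumes "linear_rel K M M' R" "Domain R = Z" "Range R = Z'"
    and "\<And>x y. (x, y) \<in> R \<Longrightarrow> x \<in> B \<Longrightarrow> y \<in> B'" "\<And>x y. (x, y) \<in> R \<Longrightarrow> y \<in> B' \<Longrightarrow> x \<in> B"
  shows "quot_corr K M Z B M' Z' B'"
  using assms by (auto simp: quot_corr_def)

lemma quot_corr_trans:
  assumes "quot_corr K M Z B M' Z' B'" "quot_corr K M' Z' B' M'' Z'' B''"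
  shows "quot_corr K M Z B M'' Z'' B''"
proof -
  obtain R where R: "linear_rel K M M' R" "Domain R = Z" "Range R = Z'" "\<forall>(x, y) \<in> R. x \<in> B \<longleftrightarrow> y \<in> B'"
    using assms(1) by (auto simp: quot_corr_def)
  obtain S where S: "linear_rel K M' M'' S" "Domain S = Z'" "Range S = Z''" "\<forall>(x, y) \<in> S. x \<in> B' \<longleftrightarrow> y \<in> B''"
    using assms(2) by (auto simp: quot_corr_def)
  show ?thesis
  proof (rule quot_corrI[of _ _ _ "R O S"])
    show "linear_rel K M M'' (R O S)"
    proof (rule linear_relI)
      fix x y x' y' assume "(x, y) \<in> R O S" "(x', y') \<in> R O S"
      then obtain m m' where "(x, m) \<in> R" "(m, y) \<in> S" "(x', m') \<in> R" "(m', y') \<in> S" by blast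
      then show "(x \<oplus>\<^bsub>M\<^esub> x', y \<oplus>\<^bsub>M''\<^esub> y') \<in> R O S"
        using linear_relD(4)[OF R(1)] linear_relD(4)[OF S(1)] by (meson relcomp.relcompI)
    next
      fix a x y assume "a \<in> carrier K" "(x, y) \<in> R O S"
      then obtain m where "a \<in> carrier K" "(x, m) \<in> R" "(m, y) \<in> S" by blast
      then show "(a \<odot>\<^bsub>M\<^esub> x, a \<odot>\<^bsub>M''\<^esub> y) \<in> R O S"
        using linear_relD(5)[OF R(1)] linear_relD(5)[OF S(1)] by (meson relcomp.relcompI)
    qed (use linear_relD(1-3)[OF R(1)] linear_relD(1-3)[OF S(1)] in auto)
    show "Domain (R O S) = Z" "Range (R O S) = Z''"
      using R(2,3) S(2,3) by fast+
  qed (use R(4) S(4) in auto)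
qed

lemma quot_module_simps [simp]:
  "carrier (quot_module M S) = a_rcosets\<^bsub>M\<^esub> S" "ring.add (quot_module M S) = set_add M"
  "ring.zero (quot_module M S) = S"
  "smult (quot_module M S) a A = (\<Union>x \<in> A. S +>\<^bsub>M\<^esub> (a \<odot>\<^bsub>M\<^esub> x))"
  by (simp_all add: quot_module_def)

context
  fixes K :: "('k, 'n) ring_scheme" and M :: "('k, 'v, 'y) module_scheme" and S
  assumes M: "module K M" and S: "submodule S K M"
begin

interpretation M: module K M by (rule M)

lemma submodule_abelian_subgroup: "abelian_subgroup S M"
  using submodule.axioms(1)[OF S] M.abelian_group_axioms
  by (intro abelian_subgroupI3 additive_subgroup.intro)

interpretation S: abelian_subgroup S M by (rule submodule_abelian_subgroup)

lemma coset_eq_iff: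
  "\<lbrakk>x \<in> carrier M; y \<in> carrier M\<rbrakk> \<Longrightarrow> S +>\<^bsub>M\<^esub> x = S +>\<^bsub>M\<^esub> y \<longleftrightarrow> x \<ominus>\<^bsub>M\<^esub> y \<in> S"
  using S.a_rcos_module[of y x] S.a_repr_independence'[of x y] S.a_rcos_self[of x]
  by (auto simp: a_minus_def)

lemma quot_module_carrierE:
  assumes "Q' \<in> carrier (quot_module M S)"
  obtains x where "x \<in> carrier M" "Q' = S +>\<^bsub>M\<^esub> x"
  using assms by (auto simp: A_RCOSETS_def')

lemma quot_module_carrierI: "x \<in> carrier M \<Longrightarrow> S +>\<^bsub>M\<^esub> x \<in> carrier (quot_module M S)"
  by (auto simp: A_RCOSETS_def')

lemma coset_memD: "\<lbrakk>y \<in> S +>\<^bsub>M\<^esub> x; x \<in> carrier M\<rbrakk> \<Longrightarrow> y \<in> carrier M \<and> S +>\<^bsub>M\<^esub> y = S +>\<^bsub>M\<^esub> x"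
  by (metis S.a_elemrcos_carrier S.a_repr_independence')

lemma quot_module_add:
  "\<lbrakk>x \<in> carrier M; y \<in> carrier M\<rbrakk> \<Longrightarrow>
    (S +>\<^bsub>M\<^esub> x) \<oplus>\<^bsub>quot_module M S\<^esub> (S +>\<^bsub>M\<^esub> y) = S +>\<^bsub>M\<^esub> (x \<oplus>\<^bsub>M\<^esub> y)"
  by (simp add: S.a_rcos_sum)

text \<open>Scalars and group elements act on a coset by a union over its representatives; the union
  collapses to one coset because \<open>\<phi>\<close> respects congruence modulo
  \<open>S\<close>.\<close>

lemma quot_module_map:
  assumes x: "x \<in> carrier M" and \<phi>: "\<And>y. y \<in> carrier M \<Longrightarrow> \<phi> y \<in> carrier M"
    "\<And>y. y \<in> carrier M \<Longrightarrow> x \<ominus>\<^bsub>M\<^esub> y \<in> S \<Longrightarrow> \<phi> x \<ominus>\<^bsub>M\<^esub> \<phi> y \<in> S"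
  shows "(\<Union>y \<in> S +>\<^bsub>M\<^esub> x. S +>\<^bsub>M\<^esub> \<phi> y) = S +>\<^bsub>M\<^esub> \<phi> x"
proof -
  have "S +>\<^bsub>M\<^esub> \<phi> y = S +>\<^bsub>M\<^esub> \<phi> x" if "y \<in> S +>\<^bsub>M\<^esub> x" for y
    using coset_memD[OF that x] coset_eq_iff[OF x, of y] coset_eq_iff[of "\<phi> x" "\<phi> y"] \<phi> x by auto
  moreover have "x \<in> S +>\<^bsub>M\<^esub> x" using x by (rule S.a_rcos_self)
  ultimately show ?thesis by blast
qed

lemma quot_module_smult:
  assumes "a \<in> carrier K" "x \<in> carrier M"
  shows "a \<odot>\<^bsub>quot_module M S\<^esub> (S +>\<^bsub>M\<^esub> x) = S +>\<^bsub>M\<^esub> (a \<odot>\<^bsub>M\<^esub> x)"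
  unfolding quot_module_simps
proof (rule quot_module_map)
  fix y assume y: "y \<in> carrier M" "x \<ominus>\<^bsub>M\<^esub> y \<in> S"
  then have "a \<odot>\<^bsub>M\<^esub> (x \<ominus>\<^bsub>M\<^esub> y) \<in> S" using assms submodule.smult_closed[OF S] by blast
  then show "a \<odot>\<^bsub>M\<^esub> x \<ominus>\<^bsub>M\<^esub> a \<odot>\<^bsub>M\<^esub> y \<in> S"
    using assms y by (simp add: a_minus_def M.smult_r_distr M.smult_r_minus)
qed (use assms in auto)

lemma module_quot_module: "module K (quot_module M S)"
proof -
  have z: "S = S +>\<^bsub>M\<^esub> \<zero>\<^bsub>M\<^esub>" using S.a_rcos_const S.zero_closed by auto
  show ?thesis
  proof (rule moduleI)
    show "abelian_group (quot_module M S)"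
    proof (rule abelian_groupI)
      show "\<zero>\<^bsub>quot_module M S\<^esub> \<in> carrier (quot_module M S)"
        using quot_module_carrierI[of "\<zero>\<^bsub>M\<^esub>"] z by simp
    next
      fix Q' assume "Q' \<in> carrier (quot_module M S)"
      then obtain x where x: "x \<in> carrier M" "Q' = S +>\<^bsub>M\<^esub> x" by (rule quot_module_carrierE)
      then show "\<zero>\<^bsub>quot_module M S\<^esub> \<oplus>\<^bsub>quot_module M S\<^esub> Q' = Q'"
        using quot_module_add[of "\<zero>\<^bsub>M\<^esub>" x] z by simp
      show "\<exists>Y\<in>carrier (quot_module M S). Y \<oplus>\<^bsub>quot_module M S\<^esub> Q' = \<zero>\<^bsub>quot_module M S\<^esub>"
        using quot_module_add[of "\<ominus>\<^bsub>M\<^esub> x" x] quot_module_carrierI[of "\<ominus>\<^bsub>M\<^esub> x"] x z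
        by (auto simp: M.M.l_neg simp del: quot_module_simps(1,2) intro!: bexI[of _ "S +>\<^bsub>M\<^esub> (\<ominus>\<^bsub>M\<^esub> x)"])
    qed (auto elim!: quot_module_carrierE simp: quot_module_add quot_module_carrierI M.M.a_ac
        simp del: quot_module_simps)
  qed (auto elim!: quot_module_carrierE simp: quot_module_add quot_module_smult quot_module_carrierI
      M.smult_l_distr M.smult_r_distr M.smult_assoc1 M.is_cring
      simp del: quot_module_simps)
qed

end

text \<open>Differences of related pairs are related, so \<open>x - x'\<close> lies in
  \<open>B\<close> exactly when \<open>y - y'\<close> lies in \<open>B'\<close>. One direction makes
  the induced map on cosets well defined, the other makes it injective.\<close>

lemma linear_iso_quot_module:
  assumes M: "module K M" and M': "module K M'" and Z: "submodule Z K M" and Z': "submodule Z' K M'"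
    and B: "submodule B K M" "B \<subseteq> Z" and B': "submodule B' K M'" "B' \<subseteq> Z'"
    and "quot_corr K M Z B M' Z' B'"
  shows "linear_iso K (quot_module (M\<lparr>carrier := Z\<rparr>) B) (quot_module (M'\<lparr>carrier := Z'\<rparr>) B')"
proof -
  obtain R where R: "linear_rel K M M' R" "Domain R = Z" "Range R = Z'"
    and RB: "\<And>x y. (x, y) \<in> R \<Longrightarrow> x \<in> B \<longleftrightarrow> y \<in> B'"
    using assms(9) by (fastforce simp: quot_corr_def)
  interpret M: module K M by (rule M)
  interpret M': module K M' by (rule M')
  \<comment> \<open>Cosets and their sums do not look at the carrier, so cutting it down to
    \<open>W\<close>, as \<open>cohomology\<close> does, changes only the set of cosets. The coset
    calculus can be used in the ambient module.\<close>
  have car: "carrier (quot_module (L\<lparr>carrier := W\<rparr>) D) = (\<lambda>x. D +>\<^bsub>L\<^esub> x) ` W"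
    and add: "ring.add (quot_module (L\<lparr>carrier := W\<rparr>) D) = ring.add (quot_module L D)"
    and smult: "smult (quot_module (L\<lparr>carrier := W\<rparr>) D) = smult (quot_module L D)"
    for L :: "('k, 'u, 's) module_scheme" and W D
    by (auto simp: A_RCOSETS_def' a_r_coset_def' set_add_def' quot_module_def fun_eq_iff)
  have ZM: "x \<in> carrier M" if "x \<in> Z" for x using M.submoduleE(1)[OF Z] that by auto
  have ZM': "x \<in> carrier M'" if "x \<in> Z'" for x using M'.submoduleE(1)[OF Z'] that by auto
  \<comment> \<open>All cosets in this union coincide, so it is the coset of any partner
    \<open>y\<close> of any representative.\<close>
  define f where "f Q' = \<Union>{B' +>\<^bsub>M'\<^esub> y | x y. x \<in> Q' \<and> (x, y) \<in> R}" for Q'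
  have Ryz: "x \<in> Z" "y \<in> Z'" if "(x, y) \<in> R" for x y using that R by auto
  have RB': "B +>\<^bsub>M\<^esub> x = B +>\<^bsub>M\<^esub> x' \<longleftrightarrow> B' +>\<^bsub>M'\<^esub> y = B' +>\<^bsub>M'\<^esub> y'"
    if "(x, y) \<in> R" "(x', y') \<in> R" for x y x' y'
    using RB[OF linear_rel_minus[OF M M' R(1) that]] that[THEN Ryz(1)] that[THEN Ryz(2)]
    by (simp add: coset_eq_iff[OF M B(1)] coset_eq_iff[OF M' B'(1)] ZM ZM')
  have f: "f (B +>\<^bsub>M\<^esub> x) = B' +>\<^bsub>M'\<^esub> y" if xy: "(x, y) \<in> R" for x y
  proof -
    have "B' +>\<^bsub>M'\<^esub> y' = B' +>\<^bsub>M'\<^esub> y" if "x' \<in> B +>\<^bsub>M\<^esub> x" "(x', y') \<in> R" for x' y'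
      using RB'[OF that(2) xy] coset_memD[OF M B(1) that(1)] ZM Ryz[OF xy] by auto
    moreover have "x \<in> B +>\<^bsub>M\<^esub> x"
      using abelian_subgroup.a_rcos_self[OF submodule_abelian_subgroup[OF M B(1)]] ZM Ryz[OF xy] by auto
    ultimately show ?thesis using xy unfolding f_def by blast
  qed
  have ex: "\<exists>x y. Q' = B +>\<^bsub>M\<^esub> x \<and> (x, y) \<in> R" if "Q' \<in> (\<lambda>x. B +>\<^bsub>M\<^esub> x) ` Z" for Q'
    using that R(2) by auto
  show ?thesis unfolding linear_iso_def
  proof (rule bexI)
    show "bij_betw f (carrier (quot_module (M\<lparr>carrier := Z\<rparr>) B)) (carrier (quot_module (M'\<lparr>carrier := Z'\<rparr>) B'))"
      unfolding bij_betw_def car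
    proof
      show "inj_on f ((\<lambda>x. B +>\<^bsub>M\<^esub> x) ` Z)"
      proof (rule inj_onI)
        fix A A' assume A: "A \<in> (\<lambda>x. B +>\<^bsub>M\<^esub> x) ` Z" "A' \<in> (\<lambda>x. B +>\<^bsub>M\<^esub> x) ` Z" "f A = f A'"
        obtain x y x' y' where
          "A = B +>\<^bsub>M\<^esub> x" "(x, y) \<in> R" "A' = B +>\<^bsub>M\<^esub> x'" "(x', y') \<in> R"
          using ex[OF A(1)] ex[OF A(2)] by blast
        with A(3) show "A = A'" using f RB' by metis
      qed
      show "f ` (\<lambda>x. B +>\<^bsub>M\<^esub> x) ` Z = (\<lambda>x. B' +>\<^bsub>M'\<^esub> x) ` Z'"
        using f R(2,3) by (fastforce simp: image_iff)
    qed
    show "f \<in> linear_hom K (quot_module (M\<lparr>carrier := Z\<rparr>) B) (quot_module (M'\<lparr>carrier := Z'\<rparr>) B')"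
    proof (rule linear_homI; unfold car add smult)
      fix Q' assume "Q' \<in> (\<lambda>x. B +>\<^bsub>M\<^esub> x) ` Z"
      then show "f Q' \<in> (\<lambda>x. B' +>\<^bsub>M'\<^esub> x) ` Z'" using f Ryz by (fastforce dest!: ex)
    next
      fix Q' Y assume Q: "Q' \<in> (\<lambda>x. B +>\<^bsub>M\<^esub> x) ` Z" "Y \<in> (\<lambda>x. B +>\<^bsub>M\<^esub> x) ` Z"
      then obtain x y x' y' where *: "Q' = B +>\<^bsub>M\<^esub> x" "(x, y) \<in> R" "Y = B +>\<^bsub>M\<^esub> x'" "(x', y') \<in> R"
        using ex[OF Q(1)] ex[OF Q(2)] by blast
      show "f (Q' \<oplus>\<^bsub>quot_module M B\<^esub> Y) = f Q' \<oplus>\<^bsub>quot_module M' B'\<^esub> f Y"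
        using f[OF *(2)] f[OF *(4)] f[OF linear_relD(4)[OF R(1) *(2,4)]] Ryz[OF *(2)] Ryz[OF *(4)]
        by (simp add: * quot_module_add[OF M B(1)] quot_module_add[OF M' B'(1)] ZM ZM'
            del: quot_module_simps)
    next
      fix a Q' assume a: "a \<in> carrier K" and Q: "Q' \<in> (\<lambda>x. B +>\<^bsub>M\<^esub> x) ` Z"
      then obtain x y where *: "Q' = B +>\<^bsub>M\<^esub> x" "(x, y) \<in> R"
        using ex[OF Q] by blast
      show "f (a \<odot>\<^bsub>quot_module M B\<^esub> Q') = a \<odot>\<^bsub>quot_module M' B'\<^esub> f Q'"
        using f[OF *(2)] f[OF linear_relD(5)[OF R(1) a *(2)]] Ryz[OF *(2)] a
        by (simp add: * quot_module_smult[OF M B(1)] quot_module_smult[OF M' B'(1)] ZM ZM'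
            del: quot_module_simps)
    qed
  qed
qed


section \<open>Inhomogeneous cochains\<close>

lemma tuples_0 [simp]: "tuples G 0 = {[]}"
  by (auto simp: tuples_def)

lemma Cons_in_tuples [simp]: "a # l \<in> tuples G (Suc n) \<longleftrightarrow> a \<in> carrier G \<and> l \<in> tuples G n"
  by (auto simp: tuples_def)

lemma tuples_SucE:
  assumes "l \<in> tuples G (Suc n)"
  obtains a m where "l = a # m" "a \<in> carrier G" "m \<in> tuples G n"
  using assms by (cases l) (auto simp: tuples_def)

text \<open>The coboundary without its first term, by recursion on the argument.\<close>

fun tail_diff :: "('g, 'm) monoid_scheme \<Rightarrow> ('k, 'v, 'z) module_scheme \<Rightarrow> ('g list \<Rightarrow> 'v) \<Rightarrow>
    'g list \<Rightarrow> 'v" where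
  "tail_diff G V f [] = \<zero>\<^bsub>V\<^esub>"
| "tail_diff G V f [a] = \<ominus>\<^bsub>V\<^esub> f []"
| "tail_diff G V f (a # b # l) =
     \<ominus>\<^bsub>V\<^esub> f ((a \<otimes>\<^bsub>G\<^esub> b) # l) \<ominus>\<^bsub>V\<^esub> tail_diff G V (\<lambda>m. f (a # m)) (b # l)"

lemma tail_diff_cong:
  assumes "group G" "\<And>m. m \<in> tuples G n \<Longrightarrow> f m = g m" "l \<in> tuples G (Suc n)"
  shows "tail_diff G V f l = tail_diff G V g l"
  using assms(2,3)
proof (induction n arbitrary: f g l)
  case 0
  then show ?case by (auto elim!: tuples_SucE)
next
  case (Suc n)
  interpret group G by (rule assms)
  obtain a b m where l: "l = a # b # m" "a \<in> carrier G" "b \<in> carrier G" "m \<in> tuples G n"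
    using Suc.prems(2) by (auto elim!: tuples_SucE)
  have "tail_diff G V (\<lambda>m. f (a # m)) (b # m) = tail_diff G V (\<lambda>m. g (a # m)) (b # m)"
    using l by (intro Suc.IH Suc.prems(1)) auto
  then show ?case using l Suc.prems(1) by simp
qed

context
  fixes G :: "('g, 'm) monoid_scheme" and K :: "('k, 'n) ring_scheme"
    and V :: "('k, 'v, 'z) module_scheme"
  assumes G: "group G" and V: "module K V"
begin

interpretation G: group G by (rule G)
interpretation V: module K V by (rule V)

lemma tail_diff_closed:
  "\<lbrakk>f \<in> tuples G n \<rightarrow> carrier V; l \<in> tuples G (Suc n)\<rbrakk> \<Longrightarrow> tail_diff G V f l \<in> carrier V"
proof (induction n arbitrary: f l)
  case 0
  then show ?case by (auto elim!: tuples_SucE)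
next
  case (Suc n)
  obtain a b m where l: "l = a # b # m" "a \<in> carrier G" "b \<in> carrier G" "m \<in> tuples G n"
    using Suc.prems(2) by (auto elim!: tuples_SucE)
  have "tail_diff G V (\<lambda>m. f (a # m)) (b # m) \<in> carrier V"
    using l Suc.prems(1) by (intro Suc.IH) auto
  moreover have "f ((a \<otimes>\<^bsub>G\<^esub> b) # m) \<in> carrier V" using l Suc.prems(1) by auto
  ultimately show ?case using l by simp
qed

text \<open>The tail involves additions and signs but no group action, so it commutes with every
  linear map, equivariant or not. It is applied to the action of one group element, to scalars, and
  to the summands of a trace.\<close>

lemma tail_diff_linear_hom:
  fixes W :: "('k, 'w, 'y) module_scheme"
  assumes "module K W" "\<phi> \<in> linear_hom K V W"
  shows "\<lbrakk>f \<in> tuples G n \<rightarrow> carrier V; l \<in> tuples G (Suc n)\<rbrakk> \<Longrightarrow>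
    \<phi> (tail_diff G V f l) = tail_diff G W (\<lambda>m. \<phi> (f m)) l"
proof (induction n arbitrary: f l)
  case 0
  then show ?case by (auto elim!: tuples_SucE simp: linear_hom_a_inv[OF V assms])
next
  case (Suc n)
  obtain a b m where l: "l = a # b # m" "a \<in> carrier G" "b \<in> carrier G" "m \<in> tuples G n"
    using Suc.prems(2) by (auto elim!: tuples_SucE)
  have *: "(\<lambda>m. f (a # m)) \<in> tuples G n \<rightarrow> carrier V" using l Suc.prems(1) by auto
  have "f ((a \<otimes>\<^bsub>G\<^esub> b) # m) \<in> carrier V" using l Suc.prems(1) by auto
  then show ?case
    using l Suc.IH[OF *, of "b # m"] tail_diff_closed[OF *, of "b # m"]
    by (simp add: linear_hom_a_inv[OF V assms] linear_hom_minus[OF V assms])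
qed

lemma tail_diff_zero: "l \<in> tuples G (Suc n) \<Longrightarrow> tail_diff G V (\<lambda>m. \<zero>\<^bsub>V\<^esub>) l = \<zero>\<^bsub>V\<^esub>"
  using tail_diff_linear_hom[OF V linear_hom_zero_fun[OF V V], of "\<lambda>m. \<zero>\<^bsub>V\<^esub>"] by auto

lemma tail_diff_add:
  "\<lbrakk>f \<in> tuples G n \<rightarrow> carrier V; g \<in> tuples G n \<rightarrow> carrier V; l \<in> tuples G (Suc n)\<rbrakk> \<Longrightarrow>
    tail_diff G V (\<lambda>m. f m \<oplus>\<^bsub>V\<^esub> g m) l = tail_diff G V f l \<oplus>\<^bsub>V\<^esub> tail_diff G V g l"
proof (induction n arbitrary: f g l)
  case 0
  then show ?case by (auto elim!: tuples_SucE simp: V.M.minus_add)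
next
  case (Suc n)
  obtain a b m where l: "l = a # b # m" "a \<in> carrier G" "b \<in> carrier G" "m \<in> tuples G n"
    using Suc.prems(3) by (auto elim!: tuples_SucE)
  have *: "(\<lambda>m. f (a # m)) \<in> tuples G n \<rightarrow> carrier V" "(\<lambda>m. g (a # m)) \<in> tuples G n \<rightarrow> carrier V"
    using l Suc.prems by auto
  have c: "f ((a \<otimes>\<^bsub>G\<^esub> b) # m) \<in> carrier V" "g ((a \<otimes>\<^bsub>G\<^esub> b) # m) \<in> carrier V" using l Suc.prems by auto
  show ?case
    using c l Suc.IH[OF *, of "b # m"] tail_diff_closed[OF *(1), of "b # m"] tail_diff_closed[OF *(2), of "b # m"]
    by (simp add: V.M.minus_add a_minus_def V.M.a_ac)
qed

lemma tail_diff_minus: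
  assumes "f \<in> tuples G n \<rightarrow> carrier V" "g \<in> tuples G n \<rightarrow> carrier V" "l \<in> tuples G (Suc n)"
  shows "tail_diff G V (\<lambda>m. f m \<ominus>\<^bsub>V\<^esub> g m) l = tail_diff G V f l \<ominus>\<^bsub>V\<^esub> tail_diff G V g l"
proof -
  have "(\<lambda>x. \<ominus>\<^bsub>V\<^esub> x) \<in> linear_hom K V V"
    by (intro linear_homI) (auto simp: V.M.minus_add V.smult_r_minus)
  from tail_diff_linear_hom[OF V this assms(2,3)]
  have "\<ominus>\<^bsub>V\<^esub> tail_diff G V g l = tail_diff G V (\<lambda>m. \<ominus>\<^bsub>V\<^esub> g m) l" .
  then show ?thesis
    using tail_diff_add[of f n "\<lambda>m. \<ominus>\<^bsub>V\<^esub> g m"] assms by (simp add: a_minus_def Pi_iff)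
qed

lemma tail_diff_finsum:
  assumes "\<And>i. i \<in> A \<Longrightarrow> f i \<in> tuples G n \<rightarrow> carrier V" "l \<in> tuples G (Suc n)"
  shows "tail_diff G V (\<lambda>m. \<Oplus>\<^bsub>V\<^esub>i \<in> A. f i m) l = (\<Oplus>\<^bsub>V\<^esub>i \<in> A. tail_diff G V (f i) l)"
proof (cases "finite A")
  case True
  then show ?thesis using assms(1)
  proof (induction A)
    case empty
    then show ?case using tail_diff_zero assms(2) by simp
  next
    case (insert i A)
    have "tail_diff G V (\<lambda>m. \<Oplus>\<^bsub>V\<^esub>i \<in> insert i A. f i m) l =
        tail_diff G V (\<lambda>m. f i m \<oplus>\<^bsub>V\<^esub> (\<Oplus>\<^bsub>V\<^esub>i \<in> A. f i m)) l"
      using insert.prems insert.hyps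
      by (intro tail_diff_cong[OF G _ assms(2)] V.M.finsum_insert) auto
    also have "\<dots> = tail_diff G V (f i) l \<oplus>\<^bsub>V\<^esub> tail_diff G V (\<lambda>m. \<Oplus>\<^bsub>V\<^esub>i \<in> A. f i m) l"
      using insert.prems by (intro tail_diff_add[OF _ _ assms(2)]) (auto intro!: V.M.finsum_closed)
    also have "\<dots> = (\<Oplus>\<^bsub>V\<^esub>i \<in> insert i A. tail_diff G V (f i) l)"
    proof -
      have "(\<lambda>i. tail_diff G V (f i) l) \<in> insert i A \<rightarrow> carrier V"
        using insert.prems by (auto intro!: tail_diff_closed[OF _ assms(2)])
      then show ?thesis using insert by (simp add: V.M.finsum_insert)
    qed
    finally show ?case .
  qed
next
  case False
  then show ?thesis using tail_diff_zero assms(2) by (simp add: V.M.finsum_infinite)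
qed

lemma merge_in_tuples:
  "\<lbrakk>xs \<in> tuples G (Suc n); i \<in> {1..n}\<rbrakk> \<Longrightarrow>
    take (i - 1) xs @ [xs ! (i - 1) \<otimes>\<^bsub>G\<^esub> xs ! i] @ drop (i + 1) xs \<in> tuples G n"
  by (auto simp: tuples_def dest!: in_set_takeD in_set_dropD intro!: G.m_closed)

lemma butlast_in_tuples: "xs \<in> tuples G (Suc n) \<Longrightarrow> butlast xs \<in> tuples G n"
  by (auto simp: tuples_def dest: in_set_butlastD)

lemma alternate_closed: "v \<in> carrier V \<Longrightarrow> alternate V i v \<in> carrier V"
  by (simp add: alternate_def)

text \<open>Merging the first two entries gives the leading term of the recursion. Every other term
  leaves the first entry \<open>a\<close> alone, so it is a term for \<open>f (a # -)\<close> on the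
  shorter list with its index raised by one; this explains the minus sign in the recursion.\<close>

lemma tail_diff_eq_sum:
  "\<lbrakk>f \<in> tuples G n \<rightarrow> carrier V; gs \<in> tuples G (Suc n)\<rbrakk> \<Longrightarrow>
    tail_diff G V f gs = (\<Oplus>\<^bsub>V\<^esub>i \<in> {1..n}. alternate V i
        (f (take (i - 1) gs @ [gs ! (i - 1) \<otimes>\<^bsub>G\<^esub> gs ! i] @ drop (i + 1) gs))) \<oplus>\<^bsub>V\<^esub>
      alternate V (Suc n) (f (butlast gs))"
proof (induction n arbitrary: f gs)
  case 0
  then show ?case by (auto elim!: tuples_SucE simp: alternate_def)
next
  case (Suc n)
  obtain a b l where gs: "gs = a # b # l" "a \<in> carrier G" "b \<in> carrier G" "l \<in> tuples G n"
    using Suc.prems(2) by (auto elim!: tuples_SucE)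
  define h where "h m = f (a # m)" for m
  have h: "h \<in> tuples G n \<rightarrow> carrier V" using gs Suc.prems(1) by (auto simp: h_def)
  have bl: "b # l \<in> tuples G (Suc n)" using gs by simp
  define merge where "merge i xs = take (i - 1) xs @ [xs ! (i - 1) \<otimes>\<^bsub>G\<^esub> xs ! i] @ drop (i + 1) xs"
    for i and xs :: "'g list"
  have merge: "merge i xs \<in> tuples G n" if "xs \<in> tuples G (Suc n)" "i \<in> {1..n}" for i n and xs :: "'g list"
    unfolding merge_def by (rule merge_in_tuples[OF that])
  have merge_Suc: "merge (Suc i) gs = a # merge i (b # l)" if "i \<in> {1..n}" for i
    using that gs by (cases i) (auto simp: merge_def)
  have alt_Suc: "alternate V (Suc i) v = \<ominus>\<^bsub>V\<^esub> alternate V i v" if "v \<in> carrier V" for i v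
    using that by (simp add: alternate_def)
  define s where "s = (\<Oplus>\<^bsub>V\<^esub>i \<in> {1..n}. alternate V i (h (merge i (b # l))))"
  have hm: "(\<lambda>i. alternate V i (h (merge i (b # l)))) \<in> {1..n} \<rightarrow> carrier V"
    using merge[OF bl] h by (auto intro!: alternate_closed)
  then have s: "s \<in> carrier V" unfolding s_def by (rule V.M.finsum_closed)
  have fm: "(\<lambda>i. alternate V i (f (merge i gs))) \<in> {1..Suc n} \<rightarrow> carrier V"
    using merge[OF Suc.prems(2)] Suc.prems(1) by (auto intro!: alternate_closed)
  have 1: "{1..Suc n} = insert 1 (Suc ` {1..n})"
    by (auto simp: image_iff Bex_def)
  have "(\<Oplus>\<^bsub>V\<^esub>i \<in> {1..Suc n}. alternate V i (f (merge i gs))) =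
      alternate V 1 (f (merge 1 gs)) \<oplus>\<^bsub>V\<^esub> (\<Oplus>\<^bsub>V\<^esub>i \<in> Suc ` {1..n}. alternate V i (f (merge i gs)))"
    unfolding 1 using fm by (intro V.M.finsum_insert) auto
  also have "(\<Oplus>\<^bsub>V\<^esub>i \<in> Suc ` {1..n}. alternate V i (f (merge i gs))) =
      (\<Oplus>\<^bsub>V\<^esub>i \<in> {1..n}. alternate V (Suc i) (f (merge (Suc i) gs)))"
    using fm by (intro V.M.finsum_reindex) auto
  also have "\<dots> = (\<Oplus>\<^bsub>V\<^esub>i \<in> {1..n}. \<ominus>\<^bsub>V\<^esub> alternate V i (h (merge i (b # l))))"
  proof (rule V.M.finsum_cong')
    show "(\<lambda>i. \<ominus>\<^bsub>V\<^esub> alternate V i (h (merge i (b # l)))) \<in> {1..n} \<rightarrow> carrier V"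
      using hm by auto
    show "alternate V (Suc i) (f (merge (Suc i) gs)) = \<ominus>\<^bsub>V\<^esub> alternate V i (h (merge i (b # l)))"
      if "i \<in> {1..n}" for i
    proof -
      have "h (merge i (b # l)) \<in> carrier V" using h merge[OF bl that] by blast
      then show ?thesis using merge_Suc[OF that] alt_Suc[of "h (merge i (b # l))" i] by (simp add: h_def)
    qed
  qed simp
  also have "\<dots> = \<ominus>\<^bsub>V\<^esub> s"
    unfolding s_def
    by (rule linear_hom_finsum[OF V V, symmetric])
      (use hm in \<open>auto intro!: linear_homI simp: V.M.minus_add V.smult_r_minus\<close>)
  also have "alternate V 1 (f (merge 1 gs)) = \<ominus>\<^bsub>V\<^esub> f ((a \<otimes>\<^bsub>G\<^esub> b) # l)"
    using gs by (simp add: merge_def alternate_def)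
  finally have sum: "(\<Oplus>\<^bsub>V\<^esub>i \<in> {1..Suc n}. alternate V i (f (merge i gs))) =
      \<ominus>\<^bsub>V\<^esub> f ((a \<otimes>\<^bsub>G\<^esub> b) # l) \<oplus>\<^bsub>V\<^esub> \<ominus>\<^bsub>V\<^esub> s" .
  have last: "alternate V (Suc (Suc n)) (f (butlast gs)) = \<ominus>\<^bsub>V\<^esub> alternate V (Suc n) (h (butlast (b # l)))"
  proof -
    have "h (butlast (b # l)) \<in> carrier V" using h butlast_in_tuples[OF bl] by blast
    moreover have "f (butlast gs) = h (butlast (b # l))" by (simp add: gs h_def)
    ultimately show ?thesis using alt_Suc[of "h (butlast (b # l))" "Suc n"] by simp
  qed
  have c: "f ((a \<otimes>\<^bsub>G\<^esub> b) # l) \<in> carrier V" "alternate V (Suc n) (h (butlast (b # l))) \<in> carrier V"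
    using gs Suc.prems(1) butlast_in_tuples[OF bl] h by (auto intro!: alternate_closed)
  have "tail_diff G V f gs = \<ominus>\<^bsub>V\<^esub> f ((a \<otimes>\<^bsub>G\<^esub> b) # l) \<ominus>\<^bsub>V\<^esub> tail_diff G V h (b # l)"
    by (simp add: gs h_def[abs_def])
  also have "tail_diff G V h (b # l) = s \<oplus>\<^bsub>V\<^esub> alternate V (Suc n) (h (butlast (b # l)))"
    using Suc.IH[OF h bl] by (simp only: s_def merge_def)
  finally show ?case
    using c s sum last by (simp only: merge_def[symmetric]) (simp add: a_minus_def V.M.minus_add V.M.a_ac)
qed

end

section \<open>The complex of inhomogeneous cochains\<close>

context kG_module
begin

lemma act_linear_hom: "g \<in> carrier G \<Longrightarrow> act V g \<in> linear_hom K V V"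
  by (intro linear_homI act_closed act_add act_smult)

lemmas module_V = V.module_axioms

text \<open>The indexed sum in the definition is replaced here once and for all: from now on the
  differential is its head term, the only one with an action, plus the recursively defined
  tail.\<close>

lemma cochain_diff_Cons:
  assumes f: "f \<in> tuples G n \<rightarrow> carrier V" and a: "a \<in> carrier G" "l \<in> tuples G n"
  shows "cochain_diff G V n f (a # l) = act V a (f l) \<oplus>\<^bsub>V\<^esub> tail_diff G V f (a # l)"
proof -
  have al: "a # l \<in> tuples G (Suc n)" using a by simp
  have "(\<Oplus>\<^bsub>V\<^esub>i \<in> {1..n}. alternate V i (f (take (i - 1) (a # l) @
      [(a # l) ! (i - 1) \<otimes>\<^bsub>G\<^esub> (a # l) ! i] @ drop (i + 1) (a # l)))) \<in> carrier V"
    using f merge_in_tuples[OF G.group_axioms module_V al]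
    by (intro V.finsum_closed) (blast intro: alternate_closed[OF G.group_axioms module_V])
  moreover have "alternate V (Suc n) (f (butlast (a # l))) \<in> carrier V"
    using f butlast_in_tuples[OF G.group_axioms module_V al]
    by (auto intro!: alternate_closed[OF G.group_axioms module_V])
  moreover have "act V a (f l) \<in> carrier V" using f a act_closed by auto
  ultimately show ?thesis
    unfolding tail_diff_eq_sum[OF G.group_axioms module_V f al] cochain_diff_def
    using al by (simp only: restrict_apply' list.sel V.a_assoc)
qed

lemma cochain_diff_closed:
  assumes "f \<in> tuples G n \<rightarrow> carrier V"
  shows "cochain_diff G V n f \<in> tuples G (Suc n) \<rightarrow>\<^sub>E carrier V"
proof (rule PiE_I)
  fix l assume l: "l \<in> tuples G (Suc n)"
  then obtain a m where am: "l = a # m" "a \<in> carrier G" "m \<in> tuples G n" by (rule tuples_SucE)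
  then show "cochain_diff G V n f l \<in> carrier V"
    using assms tail_diff_closed[OF G.group_axioms module_V assms l] act_closed
    by (auto simp: cochain_diff_Cons)
qed (simp add: cochain_diff_def)

lemma cochain_diff_eqI:
  assumes "f \<in> tuples G n \<rightarrow> carrier V" "h \<in> extensional (tuples G (Suc n))"
    and "\<And>a l. \<lbrakk>a \<in> carrier G; l \<in> tuples G n\<rbrakk> \<Longrightarrow>
      act V a (f l) \<oplus>\<^bsub>V\<^esub> tail_diff G V f (a # l) = h (a # l)"
  shows "cochain_diff G V n f = h"
proof (rule extensionalityI[OF _ assms(2)])
  show "cochain_diff G V n f \<in> extensional (tuples G (Suc n))" by (simp add: cochain_diff_def)
  show "cochain_diff G V n f l = h l" if "l \<in> tuples G (Suc n)" for l
    using that by (rule tuples_SucE) (simp add: cochain_diff_Cons assms)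
qed

lemma cochain_diff_cong:
  assumes f: "f \<in> tuples G n \<rightarrow> carrier V" and fg: "\<And>l. l \<in> tuples G n \<Longrightarrow> f l = g l"
  shows "cochain_diff G V n f = cochain_diff G V n g"
proof (rule cochain_diff_eqI[OF f])
  fix a l assume al: "a \<in> carrier G" "l \<in> tuples G n"
  have g: "g \<in> tuples G n \<rightarrow> carrier V" using f by (auto simp: fg[symmetric])
  show "act V a (f l) \<oplus>\<^bsub>V\<^esub> tail_diff G V f (a # l) = cochain_diff G V n g (a # l)"
    using al fg tail_diff_cong[OF G.group_axioms, of n f g "a # l" V] by (simp add: cochain_diff_Cons[OF g])
qed (simp add: cochain_diff_def)

lemma cochain_diff_linear:
  "cochain_diff G V n \<in> linear_hom K (cochains G V n) (cochains G V (Suc n))"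
proof (rule linear_homI)
  fix f assume "f \<in> carrier (cochains G V n)"
  then show "cochain_diff G V n f \<in> carrier (cochains G V (Suc n))"
    using cochain_diff_closed[of f n] by (auto simp: cochains_def)
next
  fix f g assume "f \<in> carrier (cochains G V n)" "g \<in> carrier (cochains G V n)"
  then have f: "f \<in> tuples G n \<rightarrow> carrier V" and g: "g \<in> tuples G n \<rightarrow> carrier V" 
    by (auto simp: cochains_def)
  have "cochain_diff G V n (\<lambda>l \<in> tuples G n. f l \<oplus>\<^bsub>V\<^esub> g l) =
      cochain_diff G V n (\<lambda>l. f l \<oplus>\<^bsub>V\<^esub> g l)"
    using f g by (intro cochain_diff_cong) auto
  also have "\<dots> = (\<lambda>l \<in> tuples G (Suc n). cochain_diff G V n f l \<oplus>\<^bsub>V\<^esub> cochain_diff G V n g l)"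
  proof (rule cochain_diff_eqI)
    fix a l assume al: "a \<in> carrier G" "l \<in> tuples G n"
    then have "tail_diff G V f (a # l) \<in> carrier V" "tail_diff G V g (a # l) \<in> carrier V"
      using f g by (auto intro!: tail_diff_closed[OF G.group_axioms module_V])
    moreover have "f l \<in> carrier V" "g l \<in> carrier V" using f g al by auto
    ultimately show "act V a (f l \<oplus>\<^bsub>V\<^esub> g l) \<oplus>\<^bsub>V\<^esub> tail_diff G V (\<lambda>l. f l \<oplus>\<^bsub>V\<^esub> g l) (a # l) =
        (\<lambda>l \<in> tuples G (Suc n). cochain_diff G V n f l \<oplus>\<^bsub>V\<^esub> cochain_diff G V n g l) (a # l)"
      using al by (simp add: cochain_diff_Cons[OF f] cochain_diff_Cons[OF g] act_add act_closed
          tail_diff_add[OF G.group_axioms module_V f g] V.a_ac)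
  qed (use f g in auto)
  finally show "cochain_diff G V n (f \<oplus>\<^bsub>cochains G V n\<^esub> g) =
      cochain_diff G V n f \<oplus>\<^bsub>cochains G V (Suc n)\<^esub> cochain_diff G V n g"
    by (simp add: cochains_def)
next
  fix c f assume c: "c \<in> carrier K" and "f \<in> carrier (cochains G V n)"
  then have f: "f \<in> tuples G n \<rightarrow> carrier V" by (auto simp: cochains_def)
  have lin: "(\<lambda>v. c \<odot>\<^bsub>V\<^esub> v) \<in> linear_hom K V V"
    using c by (intro linear_homI) (auto simp: V.smult_r_distr V.smult_assoc1[symmetric] K.m_comm)
  have "cochain_diff G V n (\<lambda>l \<in> tuples G n. c \<odot>\<^bsub>V\<^esub> f l) =
      cochain_diff G V n (\<lambda>l. c \<odot>\<^bsub>V\<^esub> f l)"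
    using f c by (intro cochain_diff_cong) auto
  also have "\<dots> = (\<lambda>l \<in> tuples G (Suc n). c \<odot>\<^bsub>V\<^esub> cochain_diff G V n f l)"
  proof (rule cochain_diff_eqI)
    fix a l assume al: "a \<in> carrier G" "l \<in> tuples G n"
    then have "tail_diff G V f (a # l) \<in> carrier V"
      using f by (auto intro!: tail_diff_closed[OF G.group_axioms module_V])
    moreover have "f l \<in> carrier V" using f al by auto
    moreover have "tail_diff G V (\<lambda>l. c \<odot>\<^bsub>V\<^esub> f l) (a # l) = c \<odot>\<^bsub>V\<^esub> tail_diff G V f (a # l)"
      using al tail_diff_linear_hom[OF G.group_axioms module_V module_V lin f, of "a # l"] by simp
    ultimately show "act V a (c \<odot>\<^bsub>V\<^esub> f l) \<oplus>\<^bsub>V\<^esub> tail_diff G V (\<lambda>l. c \<odot>\<^bsub>V\<^esub> f l) (a # l) =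
        (\<lambda>l \<in> tuples G (Suc n). c \<odot>\<^bsub>V\<^esub> cochain_diff G V n f l) (a # l)"
      using al c by (simp add: cochain_diff_Cons[OF f] act_smult act_closed V.smult_r_distr)
  qed (use f c in auto)
  finally show "cochain_diff G V n (c \<odot>\<^bsub>cochains G V n\<^esub> f) =
      c \<odot>\<^bsub>cochains G V (Suc n)\<^esub> cochain_diff G V n f"
    by (simp add: cochains_def)
qed

lemma module_cochains: "module K (cochains G V n)"
  unfolding cochains_def by (rule module_pointwise_module[OF module_V]) auto

text \<open>Equivariance of \<open>\<phi>\<close> handles the head term and linearity alone handles
  the tail.\<close>

lemma cochain_diff_kG_hom:
  fixes W :: "('k, 'w, 'g) gmodule"
  assumes W: "kG_module G K W" and \<phi>: "\<phi> \<in> kG_hom G K V W" and f: "f \<in> tuples G n \<rightarrow> carrier V"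
    and l: "l \<in> tuples G (Suc n)"
  shows "cochain_diff G W n (\<lambda>m. \<phi> (f m)) l = \<phi> (cochain_diff G V n f l)"
proof -
  interpret W: kG_module G K W by (rule W)
  have lin: "\<phi> \<in> linear_hom K V W" and equi: "\<And>g x. \<lbrakk>g \<in> carrier G; x \<in> carrier V\<rbrakk> \<Longrightarrow> \<phi> (act V g x) = act W g (\<phi> x)"
    using \<phi> by (auto simp: kG_hom_def)
  obtain a m where am: "l = a # m" "a \<in> carrier G" "m \<in> tuples G n" using l by (rule tuples_SucE)
  have \<phi>f: "(\<lambda>m. \<phi> (f m)) \<in> tuples G n \<rightarrow> carrier W" using f linear_hom_closed[OF lin] by auto
  have "f m \<in> carrier V" using f am by auto
  then show ?thesis
    using am tail_diff_closed[OF G.group_axioms module_V f l]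
    by (simp add: cochain_diff_Cons[OF f] W.cochain_diff_Cons[OF \<phi>f] linear_hom_add[OF lin] act_closed equi
        tail_diff_linear_hom[OF G.group_axioms module_V W.module_V lin f])
qed

text \<open>
  \<open>\<delta>\<delta> = 0\<close> is proved by induction for cochains with values in functions of a tuple on which
  \<open>G\<close> acts by right multiplication in the first entry; fixing the first argument of a cochain
  and adjoining it to that tuple leads from degree \<open>n + 1\<close> to degree \<open>n\<close>.
\<close>

definition shifted_diff :: "('g list \<Rightarrow> 'g list \<Rightarrow> 'v) \<Rightarrow> 'g list \<Rightarrow> 'g list \<Rightarrow> 'v" where
  "shifted_diff F x l = F ((hd x \<otimes>\<^bsub>G\<^esub> hd l) # tl x) (tl l) \<oplus>\<^bsub>V\<^esub> tail_diff G V (F x) l"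

lemma shifted_diff_closed:
  assumes "F \<in> tuples G (Suc k) \<rightarrow> tuples G n \<rightarrow> carrier V" "x \<in> tuples G (Suc k)" "l \<in> tuples G (Suc n)"
  shows "shifted_diff F x l \<in> carrier V"
proof -
  have "F x \<in> tuples G n \<rightarrow> carrier V" using assms by auto
  then have "tail_diff G V (F x) l \<in> carrier V" 
    using assms(3) by (rule tail_diff_closed[OF G.group_axioms module_V])
  moreover have "F ((hd x \<otimes>\<^bsub>G\<^esub> hd l) # tl x) \<in> tuples G n \<rightarrow> carrier V" "tl l \<in> tuples G n"
    using assms by (auto elim!: tuples_SucE)
  ultimately show ?thesis by (auto simp: shifted_diff_def)
qed

text \<open>With the first argument \<open>a\<close> moved into the parameter tuple, merging
  \<open>a\<close> with the next argument \<open>b\<close> becomes right multiplication of the first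
  parameter by \<open>b\<close>. So everything except the head term is a shifted coboundary of one
  degree less, with opposite sign.\<close>

lemma shifted_diff_rec:
  assumes F: "F \<in> tuples G (Suc k) \<rightarrow> tuples G (Suc n) \<rightarrow> carrier V"
    and x: "c \<in> carrier G" "x \<in> tuples G k" and l: "a \<in> carrier G" "l \<in> tuples G (Suc n)"
  shows "shifted_diff F (c # x) (a # l) = F ((c \<otimes>\<^bsub>G\<^esub> a) # x) l \<ominus>\<^bsub>V\<^esub>
    shifted_diff (\<lambda>y m. F (tl y) (hd y # m)) (a # c # x) l"
proof -
  obtain b m where bm: "l = b # m" "b \<in> carrier G" "m \<in> tuples G n" using l(2) by (rule tuples_SucE)
  have "(\<lambda>m. F (c # x) (a # m)) \<in> tuples G n \<rightarrow> carrier V" using F x l by fastforce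
  from tail_diff_closed[OF G.group_axioms module_V this l(2)]
  have "tail_diff G V (\<lambda>m. F (c # x) (a # m)) (b # m) \<in> carrier V" using bm by simp
  moreover have "F (c # x) ((a \<otimes>\<^bsub>G\<^esub> b) # m) \<in> carrier V"
    using F x l bm by (auto simp: Pi_iff)
  moreover have "F ((c \<otimes>\<^bsub>G\<^esub> a) # x) (b # m) \<in> carrier V"
    using F x l bm by (auto simp: Pi_iff)
  ultimately show ?thesis
    by (simp add: bm shifted_diff_def a_minus_def V.minus_add V.a_ac)
qed

lemma shifted_diff_sq:
  "\<lbrakk>F \<in> tuples G (Suc k) \<rightarrow> tuples G n \<rightarrow> carrier V; x \<in> tuples G (Suc k); l \<in> tuples G (Suc (Suc n))\<rbrakk> \<Longrightarrow>
    shifted_diff (shifted_diff F) x l = \<zero>\<^bsub>V\<^esub>"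
proof (induction n arbitrary: k F x l)
  case 0
  obtain a b c y where l: "l = [a, b]" "a \<in> carrier G" "b \<in> carrier G" 
    and x: "x = c # y" "c \<in> carrier G" "y \<in> tuples G k"
    using 0 by (auto elim!: tuples_SucE)
  have "F z [] \<in> carrier V" if "z \<in> tuples G (Suc k)" for z using 0(1) that by auto
  then have "F (c # y) [] \<in> carrier V" "F ((c \<otimes>\<^bsub>G\<^esub> a) # y) [] \<in> carrier V"
    "F ((c \<otimes>\<^bsub>G\<^esub> a \<otimes>\<^bsub>G\<^esub> b) # y) [] \<in> carrier V" using x l by auto
  then show ?case using l x
    by (simp add: shifted_diff_def G.m_assoc a_minus_def V.minus_add V.a_ac V.r_neg1 V.r_neg2 V.r_neg V.l_neg)
next
  case (Suc n)
  obtain a b m where l: "l = a # b # m" "a \<in> carrier G" "b \<in> carrier G" "m \<in> tuples G (Suc n)"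
    using Suc.prems(3) by (auto elim!: tuples_SucE)
  obtain c y where x: "x = c # y" "c \<in> carrier G" "y \<in> tuples G k"
    using Suc.prems(2) by (auto elim!: tuples_SucE)
  define F' where "F' = (\<lambda>y m. F (tl y) (hd y # m))"
  have F': "F' \<in> tuples G (Suc (Suc k)) \<rightarrow> tuples G n \<rightarrow> carrier V"
    using Suc.prems(1) by (fastforce simp: F'_def Pi_iff elim!: tuples_SucE)
  note rec = shifted_diff_rec[OF Suc.prems(1), folded F'_def]
  have DF': "shifted_diff F' z \<in> tuples G (Suc n) \<rightarrow> carrier V" if "z \<in> tuples G (Suc (Suc k))" for z
    using shifted_diff_closed[OF F' that] by auto
  have Fx: "F z \<in> tuples G (Suc n) \<rightarrow> carrier V" if "z \<in> tuples G (Suc k)" for z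
    using Suc.prems(1) that by auto
  have t: "tail_diff G V f (b # m) \<in> carrier V" if "f \<in> tuples G (Suc n) \<rightarrow> carrier V" for f
    using l that by (intro tail_diff_closed[OF G.group_axioms module_V]) auto
  have 1: "tail_diff G V (\<lambda>m'. shifted_diff F x (a # m')) (b # m) =
      tail_diff G V (\<lambda>m'. F ((c \<otimes>\<^bsub>G\<^esub> a) # y) m' \<ominus>\<^bsub>V\<^esub> shifted_diff F' (a # c # y) m') (b # m)"
    using l x by (intro tail_diff_cong[OF G.group_axioms]) (auto simp: rec)
  also have "\<dots> = tail_diff G V (F ((c \<otimes>\<^bsub>G\<^esub> a) # y)) (b # m) \<ominus>\<^bsub>V\<^esub>
      tail_diff G V (shifted_diff F' (a # c # y)) (b # m)"
    using l x by (intro tail_diff_minus[OF G.group_axioms module_V Fx DF']) auto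
  finally have 1: "tail_diff G V (\<lambda>m'. shifted_diff F x (a # m')) (b # m) =
      tail_diff G V (F ((c \<otimes>\<^bsub>G\<^esub> a) # y)) (b # m) \<ominus>\<^bsub>V\<^esub>
      tail_diff G V (shifted_diff F' (a # c # y)) (b # m)" .
  have 2: "shifted_diff F ((c \<otimes>\<^bsub>G\<^esub> a) # y) (b # m) =
      F ((c \<otimes>\<^bsub>G\<^esub> a \<otimes>\<^bsub>G\<^esub> b) # y) m \<oplus>\<^bsub>V\<^esub> tail_diff G V (F ((c \<otimes>\<^bsub>G\<^esub> a) # y)) (b # m)"
    by (simp add: shifted_diff_def)
  have 3: "shifted_diff F x ((a \<otimes>\<^bsub>G\<^esub> b) # m) =
      F ((c \<otimes>\<^bsub>G\<^esub> a \<otimes>\<^bsub>G\<^esub> b) # y) m \<ominus>\<^bsub>V\<^esub> shifted_diff F' ((a \<otimes>\<^bsub>G\<^esub> b) # c # y) m"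
    using l x by (simp add: rec G.m_assoc)
  \<comment> \<open>The induction hypothesis for \<open>F'\<close> at the longer parameter
    \<open>a # c # y\<close>. All other terms of the double coboundary cancel in pairs, and this sum
    is what remains.\<close>
  have 4: "shifted_diff F' ((a \<otimes>\<^bsub>G\<^esub> b) # c # y) m \<oplus>\<^bsub>V\<^esub>
      tail_diff G V (shifted_diff F' (a # c # y)) (b # m) = \<zero>\<^bsub>V\<^esub>"
    using Suc.IH[OF F', of "a # c # y" "b # m"] l x by (simp add: shifted_diff_def[of "shifted_diff F'"])
  have c: "F ((c \<otimes>\<^bsub>G\<^esub> a \<otimes>\<^bsub>G\<^esub> b) # y) m \<in> carrier V"
    "tail_diff G V (F ((c \<otimes>\<^bsub>G\<^esub> a) # y)) (b # m) \<in> carrier V"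
    "tail_diff G V (shifted_diff F' (a # c # y)) (b # m) \<in> carrier V"
    "shifted_diff F' ((a \<otimes>\<^bsub>G\<^esub> b) # c # y) m \<in> carrier V"
    using l x Fx DF' by (auto intro!: t simp: Pi_iff)
  have "shifted_diff (shifted_diff F) x l = shifted_diff F ((c \<otimes>\<^bsub>G\<^esub> a) # y) (b # m) \<oplus>\<^bsub>V\<^esub>
      (\<ominus>\<^bsub>V\<^esub> shifted_diff F x ((a \<otimes>\<^bsub>G\<^esub> b) # m) \<ominus>\<^bsub>V\<^esub> tail_diff G V (\<lambda>m'. shifted_diff F x (a # m')) (b # m))"
    by (simp add: shifted_diff_def[of "shifted_diff F"] l x)
  also have "\<dots> = shifted_diff F' ((a \<otimes>\<^bsub>G\<^esub> b) # c # y) m \<oplus>\<^bsub>V\<^esub>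
      tail_diff G V (shifted_diff F' (a # c # y)) (b # m)"
  proof -
    have "(p \<oplus>\<^bsub>V\<^esub> t) \<oplus>\<^bsub>V\<^esub> (\<ominus>\<^bsub>V\<^esub> (p \<ominus>\<^bsub>V\<^esub> s) \<ominus>\<^bsub>V\<^esub> (t \<ominus>\<^bsub>V\<^esub> u)) = s \<oplus>\<^bsub>V\<^esub> u"
      if "p \<in> carrier V" "t \<in> carrier V" "u \<in> carrier V" "s \<in> carrier V" for p t u s
    proof -
      have "(p \<oplus>\<^bsub>V\<^esub> t) \<oplus>\<^bsub>V\<^esub> (\<ominus>\<^bsub>V\<^esub> (p \<ominus>\<^bsub>V\<^esub> s) \<ominus>\<^bsub>V\<^esub> (t \<ominus>\<^bsub>V\<^esub> u)) =
          (p \<oplus>\<^bsub>V\<^esub> \<ominus>\<^bsub>V\<^esub> p) \<oplus>\<^bsub>V\<^esub> ((t \<oplus>\<^bsub>V\<^esub> \<ominus>\<^bsub>V\<^esub> t) \<oplus>\<^bsub>V\<^esub> (s \<oplus>\<^bsub>V\<^esub> u))"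
        using that by (simp add: a_minus_def V.minus_add V.a_ac)
      then show ?thesis using that by (simp add: V.r_neg)
    qed
    then show ?thesis unfolding 1 2 3 using c by simp
  qed
  finally show ?case using 4 by simp
qed

text \<open>For \<open>F [c] m = c f(m)\<close>, right multiplication of the parameter turns into
  the action, and the shifted coboundary at \<open>[c]\<close> is \<open>c\<close> applied to the
  ordinary one. Taking \<open>c\<close> to be the unit in \<open>shifted_diff_sq\<close> gives the
  claim.\<close>

lemma cochain_diff_sq:
  assumes f: "f \<in> tuples G n \<rightarrow> carrier V" and l: "l \<in> tuples G (Suc (Suc n))"
  shows "cochain_diff G V (Suc n) (cochain_diff G V n f) l = \<zero>\<^bsub>V\<^esub>"
proof -
  define F where "F x m = act V (hd x) (f m)" for x m
  have F: "F \<in> tuples G (Suc 0) \<rightarrow> tuples G n \<rightarrow> carrier V"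
    using f act_closed by (fastforce simp: F_def Pi_iff elim!: tuples_SucE)
  have df: "cochain_diff G V n f \<in> tuples G (Suc n) \<rightarrow> carrier V" using cochain_diff_closed[OF f] by auto
  have D: "shifted_diff (\<lambda>x m. act V (hd x) (h m)) [c] m = act V c (cochain_diff G V n h m)"
    if h: "h \<in> tuples G n \<rightarrow> carrier V" and c: "c \<in> carrier G" and m: "m \<in> tuples G (Suc n)" for h n c m
  proof -
    obtain a m' where am: "m = a # m'" "a \<in> carrier G" "m' \<in> tuples G n" using m by (rule tuples_SucE)
    have "h m' \<in> carrier V" using h am by auto
    then show ?thesis
      using c am tail_diff_closed[OF G.group_axioms module_V h m]
      by (simp add: shifted_diff_def cochain_diff_Cons[OF h] act_add act_closed act_mult
          tail_diff_linear_hom[OF G.group_axioms module_V module_V act_linear_hom h])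
  qed
  have F_eq: "F = (\<lambda>x m. act V (hd x) (f m))" by (simp add: F_def fun_eq_iff)
  obtain a m where am: "l = a # m" "a \<in> carrier G" "m \<in> tuples G (Suc n)" using l by (rule tuples_SucE)
  have "\<zero>\<^bsub>V\<^esub> = shifted_diff (shifted_diff F) [\<one>\<^bsub>G\<^esub>] l"
    using shifted_diff_sq[OF F _ l, of "[\<one>\<^bsub>G\<^esub>]"] by simp
  also have "\<dots> = shifted_diff (\<lambda>x m. act V (hd x) (cochain_diff G V n f m)) [\<one>\<^bsub>G\<^esub>] l"
  proof -
    have "tail_diff G V (shifted_diff F [\<one>\<^bsub>G\<^esub>]) l = 
        tail_diff G V (\<lambda>m. act V (hd [\<one>\<^bsub>G\<^esub>]) (cochain_diff G V n f m)) l"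
      by (rule tail_diff_cong[OF G.group_axioms _ l]) (simp add: F_eq D[OF f])
    then show ?thesis
      unfolding shifted_diff_def[of "shifted_diff F"]
        shifted_diff_def[of "\<lambda>x m. act V (hd x) (cochain_diff G V n f m)"]
      using am by (simp add: F_eq D[OF f])
  qed
  also have "\<dots> = cochain_diff G V (Suc n) (cochain_diff G V n f) l"
    using D[OF df _ l, of "\<one>\<^bsub>G\<^esub>"] cochain_diff_closed[OF df] l by (auto simp: act_one PiE_iff)
  finally show ?thesis by simp
qed

section \<open>Vanishing of cohomology in positive degrees for modules with a trace\<close>

lemma finsum_act_translate:
  assumes "b \<in> carrier G" "f \<in> carrier G \<rightarrow> carrier V"
  shows "(\<Oplus>\<^bsub>V\<^esub>a \<in> carrier G. f (a \<otimes>\<^bsub>G\<^esub> b)) = (\<Oplus>\<^bsub>V\<^esub>a \<in> carrier G. f a)"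
proof -
  have im: "(\<lambda>a. a \<otimes>\<^bsub>G\<^esub> b) ` carrier G = carrier G"
  proof (intro equalityI subsetI)
    fix a assume "a \<in> carrier G"
    then show "a \<in> (\<lambda>a. a \<otimes>\<^bsub>G\<^esub> b) ` carrier G"
      using assms(1) by (intro image_eqI[of _ _ "a \<otimes>\<^bsub>G\<^esub> inv\<^bsub>G\<^esub> b"]) (auto simp: G.m_assoc)
  qed (use assms(1) in auto)
  show ?thesis
    using V.finsum_reindex[of f "\<lambda>a. a \<otimes>\<^bsub>G\<^esub> b" "carrier G"] assms unfolding im
    by (simp add: inj_on_def)
qed

text \<open>The contracting homotopy of a relatively projective module: e(l) is the sum over a of
  a^{-1} \<theta>(f(a, l)). The cocycle condition at (a, b, l), hit with a^{-1} \<theta> and summed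
  over a, has f(b, l) on one side by the trace identity and the coboundary of e on the
  other.\<close>

lemma cocycle_is_coboundary_of_trace:
  assumes \<theta>: "\<theta> \<in> linear_hom K V V"
    and tr: "\<And>v. v \<in> carrier V \<Longrightarrow> (\<Oplus>\<^bsub>V\<^esub>a \<in> carrier G. act V (inv\<^bsub>G\<^esub> a) (\<theta> (act V a v))) = v"
    and f: "f \<in> tuples G (Suc n) \<rightarrow>\<^sub>E carrier V"
    and cocyc: "\<And>l. l \<in> tuples G (Suc (Suc n)) \<Longrightarrow> cochain_diff G V (Suc n) f l = \<zero>\<^bsub>V\<^esub>"
  obtains e where "e \<in> tuples G n \<rightarrow>\<^sub>E carrier V" "cochain_diff G V n e = f"
proof -
  define \<psi> where "\<psi> a v = act V (inv\<^bsub>G\<^esub> a) (\<theta> v)" for a v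
  have \<psi>: "\<psi> a \<in> linear_hom K V V" if "a \<in> carrier G" for a
    unfolding \<psi>_def using that by (intro linear_hom_comp[OF \<theta>] act_linear_hom) auto
  have f1: "f \<in> tuples G (Suc n) \<rightarrow> carrier V" using f by auto
  have fcl: "f (a # l) \<in> carrier V" if "a \<in> carrier G" "l \<in> tuples G n" for a l
    using f1 that by (auto simp: Pi_iff)
  have \<psi>cl: "\<psi> a v \<in> carrier V" if "a \<in> carrier G" "v \<in> carrier V" for a v
    using linear_hom_closed[OF \<psi>] that by auto
  define e where "e l = (\<Oplus>\<^bsub>V\<^esub>a \<in> carrier G. \<psi> a (f (a # l)))" for l
  have e: "e \<in> tuples G n \<rightarrow> carrier V"
    unfolding e_def by (auto intro!: V.finsum_closed \<psi>cl fcl)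
  have "cochain_diff G V n e = f"
  proof (rule cochain_diff_eqI[OF e])
    show "f \<in> extensional (tuples G (Suc n))" using f by (auto simp: PiE_def)
  next
    fix b l assume b: "b \<in> carrier G" and l: "l \<in> tuples G n"
    have bl: "b # l \<in> tuples G (Suc n)" using b l by simp
    have *: "(\<lambda>m. f (a # m)) \<in> tuples G n \<rightarrow> carrier V" if "a \<in> carrier G" for a
      using fcl that by auto
    have t: "tail_diff G V (\<lambda>m. f (a # m)) (b # l) \<in> carrier V" if "a \<in> carrier G" for a
      by (rule tail_diff_closed[OF G.group_axioms module_V *[OF that] bl])
    \<comment> \<open>The cocycle condition at (a, b, l), solved for its head term.\<close>
    have eq: "act V a (f (b # l)) = f ((a \<otimes>\<^bsub>G\<^esub> b) # l) \<oplus>\<^bsub>V\<^esub> tail_diff G V (\<lambda>m. f (a # m)) (b # l)"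
      if a: "a \<in> carrier G" for a
    proof -
      have "act V a (f (b # l)) \<oplus>\<^bsub>V\<^esub> (\<ominus>\<^bsub>V\<^esub> f ((a \<otimes>\<^bsub>G\<^esub> b) # l) \<ominus>\<^bsub>V\<^esub>
          tail_diff G V (\<lambda>m. f (a # m)) (b # l)) = \<zero>\<^bsub>V\<^esub>"
        using cocyc[of "a # b # l"] a b l by (simp add: cochain_diff_Cons[OF f1])
      then have "act V a (f (b # l)) = \<ominus>\<^bsub>V\<^esub> (\<ominus>\<^bsub>V\<^esub> f ((a \<otimes>\<^bsub>G\<^esub> b) # l) \<ominus>\<^bsub>V\<^esub>
          tail_diff G V (\<lambda>m. f (a # m)) (b # l))"
        using a b l t[OF a] fcl act_closed by (intro V.minus_equality[symmetric]) auto
      then show ?thesis using a b l t[OF a] fcl by (simp add: a_minus_def V.minus_add)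
    qed
    have "f (b # l) = (\<Oplus>\<^bsub>V\<^esub>a \<in> carrier G. \<psi> a (act V a (f (b # l))))"
      using tr[OF fcl[OF b l]] by (simp add: \<psi>_def)
    also have "\<dots> = (\<Oplus>\<^bsub>V\<^esub>a \<in> carrier G. act V b (\<psi> (a \<otimes>\<^bsub>G\<^esub> b) (f ((a \<otimes>\<^bsub>G\<^esub> b) # l))) \<oplus>\<^bsub>V\<^esub>
        tail_diff G V (\<lambda>m. \<psi> a (f (a # m))) (b # l))"
    proof (rule V.finsum_cong')
      fix a assume a: "a \<in> carrier G"
      \<comment> \<open>Since a^{-1} = b (ab)^{-1}, the summand depends on a only through ab apart
        from the outer \<open>b\<close>; the sum can then be reindexed by translation and
        \<open>b\<close> pulled out.\<close>
      have "act V b (\<psi> (a \<otimes>\<^bsub>G\<^esub> b) v) = \<psi> a v" if "v \<in> carrier V" for v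
        using a b that by (simp add: \<psi>_def act_mult[symmetric] linear_hom_closed[OF \<theta>]
            G.inv_mult_group G.m_assoc[symmetric])
      then show "\<psi> a (act V a (f (b # l))) = act V b (\<psi> (a \<otimes>\<^bsub>G\<^esub> b) (f ((a \<otimes>\<^bsub>G\<^esub> b) # l))) \<oplus>\<^bsub>V\<^esub>
        tail_diff G V (\<lambda>m. \<psi> a (f (a # m))) (b # l)"
        using a b l t[OF a] fcl tail_diff_linear_hom[OF G.group_axioms module_V module_V \<psi>[OF a] *[OF a] bl]
        by (simp add: eq linear_hom_add[OF \<psi>[OF a]])
    next
      show "(\<lambda>a. act V b (\<psi> (a \<otimes>\<^bsub>G\<^esub> b) (f ((a \<otimes>\<^bsub>G\<^esub> b) # l))) \<oplus>\<^bsub>V\<^esub>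
        tail_diff G V (\<lambda>m. \<psi> a (f (a # m))) (b # l)) \<in> carrier G \<rightarrow> carrier V"
        using b l fcl by (auto intro!: V.a_closed act_closed \<psi>cl tail_diff_closed[OF G.group_axioms module_V, of _ n])
    qed simp
    also have "\<dots> = (\<Oplus>\<^bsub>V\<^esub>a \<in> carrier G. act V b (\<psi> (a \<otimes>\<^bsub>G\<^esub> b) (f ((a \<otimes>\<^bsub>G\<^esub> b) # l)))) \<oplus>\<^bsub>V\<^esub>
        (\<Oplus>\<^bsub>V\<^esub>a \<in> carrier G. tail_diff G V (\<lambda>m. \<psi> a (f (a # m))) (b # l))"
      using b l fcl by (intro V.finsum_addf)
        (auto intro!: act_closed \<psi>cl tail_diff_closed[OF G.group_axioms module_V, of _ n])
    also have "(\<Oplus>\<^bsub>V\<^esub>a \<in> carrier G. act V b (\<psi> (a \<otimes>\<^bsub>G\<^esub> b) (f ((a \<otimes>\<^bsub>G\<^esub> b) # l)))) =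
        (\<Oplus>\<^bsub>V\<^esub>a \<in> carrier G. act V b (\<psi> a (f (a # l))))"
      using b l fcl by (intro finsum_act_translate[of b "\<lambda>a. act V b (\<psi> a (f (a # l)))"])
        (auto intro!: act_closed \<psi>cl)
    also have "\<dots> = act V b (e l)"
      unfolding e_def using l by (intro linear_hom_finsum[OF module_V module_V act_linear_hom[OF b], symmetric] \<psi>cl fcl)
    also have "(\<Oplus>\<^bsub>V\<^esub>a \<in> carrier G. tail_diff G V (\<lambda>m. \<psi> a (f (a # m))) (b # l)) = tail_diff G V e (b # l)"
      unfolding e_def
      by (rule tail_diff_finsum[OF G.group_axioms module_V _ bl, symmetric]) (auto intro!: \<psi>cl fcl)
    finally show "act V b (e l) \<oplus>\<^bsub>V\<^esub> tail_diff G V e (b # l) = f (b # l)" by simp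
  qed
  moreover have "cochain_diff G V n (restrict e (tuples G n)) = cochain_diff G V n e"
    using e by (intro cochain_diff_cong) auto
  moreover have "restrict e (tuples G n) \<in> tuples G n \<rightarrow>\<^sub>E carrier V" using e by auto
  ultimately show thesis using that by metis
qed

end


section \<open>Normal subgroups of finite groups\<close>

context group
begin

lemma normal_set_mult:
  assumes N: "N \<lhd> G" and M: "M \<lhd> G"
  shows "N <#> M \<lhd> G"
proof -
  interpret second_isomorphism_grp N G M
    using N M normal_imp_subgroup by (auto simp: second_isomorphism_grp_def second_isomorphism_grp_axioms_def)
  show ?thesis unfolding normal_inv_iff
  proof (intro conjI ballI)
    show "subgroup (N <#> M) G" by (rule normal_set_mult_subgroup)
    fix x y assume x: "x \<in> carrier G" and "y \<in> N <#> M"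
    then obtain n m where nm: "n \<in> N" "m \<in> M" "y = n \<otimes> m" by (auto simp: set_mult_def)
    have c: "n \<in> carrier G" "m \<in> carrier G"
      using nm normal_imp_subgroup[OF N] normal_imp_subgroup[OF M] subgroup.mem_carrier by metis+
    have "x \<otimes> y \<otimes> inv x = (x \<otimes> n \<otimes> inv x) \<otimes> (x \<otimes> m \<otimes> inv x)"
      using x c by (simp add: nm m_assoc) (simp add: m_assoc[symmetric])
    then show "x \<otimes> y \<otimes> inv x \<in> N <#> M"
      using nm x N M unfolding set_mult_def normal_inv_iff by blast
  qed
qed

lemma order_FactGroup:
  assumes "N \<lhd> G"
  shows "order (G Mod N) * card N = order G"
  using lagrange[OF normal_imp_subgroup[OF assms]] by (simp add: FactGroup_def order_def)

text \<open>The second isomorphism theorem, with Lagrange applied to both quotients.\<close>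

lemma card_set_mult_normal:
  assumes N: "N \<lhd> G" and M: "subgroup M G"
  shows "card (N <#> M) * card (N \<inter> M) = card N * card M"
proof -
  interpret second_isomorphism_grp N G M
    using N M by (auto simp: second_isomorphism_grp_def second_isomorphism_grp_axioms_def)
  have 1: "order (G\<lparr>carrier := M\<rparr> Mod (N \<inter> M)) = order (G\<lparr>carrier := N <#> M\<rparr> Mod N)"
    using normal_intersection_quotient_isom by (auto intro!: iso_same_order)
  interpret GM: group "G\<lparr>carrier := M\<rparr>" by (rule subgroup_imp_group[OF M])
  interpret GNM: group "G\<lparr>carrier := N <#> M\<rparr>"
    by (rule subgroup_imp_group[OF normal_set_mult_subgroup])
  have "order (G\<lparr>carrier := M\<rparr> Mod (N \<inter> M)) * card (N \<inter> M) = card M"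
    using GM.order_FactGroup[of "N \<inter> M"] normal_subgrp_intersection_normal
    by (simp add: Int_commute order_def)
  moreover have "order (G\<lparr>carrier := N <#> M\<rparr> Mod N) * card N = card (N <#> M)"
    using GNM.order_FactGroup[of N]
      normal_restrict_supergroup[OF normal_set_mult_subgroup N H_contained_in_set_mult]
    by (simp add: order_def)
  ultimately show ?thesis using 1 by (metis (no_types, lifting) mult.commute mult.left_commute)
qed

text \<open>\<open>GREATEST\<close> refers to inclusion, so a largest candidate must be exhibited.
  One of maximal cardinality works: its product with another candidate is again normal of order
  prime to \<open>r\<close>, hence equal to it.\<close>

lemma O_prime_core_normal:
  assumes fin: "finite (carrier G)" and r: "Factorial_Ring.prime r"
  shows "O_prime_core r G \<lhd> G \<and> \<not> r dvd card (O_prime_core r G)"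
proof -
  define P where "P N \<longleftrightarrow> N \<lhd> G \<and> \<not> r dvd card N" for N
  have fin_N: "finite N" "card N \<le> card (carrier G)" if "P N" for N
    using that fin normal_imp_subgroup[of N G] subgroup.subset[of N G]
    by (auto simp: P_def intro: finite_subset card_mono)
  have "P {\<one>}" using r by (auto simp: P_def one_is_normal prime_nat_iff)
  then obtain N where N: "P N" and max: "\<And>M. P M \<Longrightarrow> card M \<le> card N"
    using ex_has_greatest_nat[of P "{\<one>}" card "Suc (card (carrier G))"] fin_N(2)
    by (auto simp: less_Suc_eq_le)
  have "M \<subseteq> N" if M: "P M" for M
  proof -
    have NM: "N \<lhd> G" "M \<lhd> G" using N M by (auto simp: P_def)
    interpret second_isomorphism_grp N G M
      using NM normal_imp_subgroup by (auto simp: second_isomorphism_grp_def second_isomorphism_grp_axioms_def)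
    have "card (N <#> M) * card (N \<inter> M) = card N * card M"
      using NM normal_imp_subgroup by (auto intro: card_set_mult_normal)
    moreover have "\<not> r dvd card N * card M" using N M r by (auto simp: P_def prime_dvd_mult_iff)
    ultimately have "\<not> r dvd card (N <#> M)" by (metis dvd_mult2)
    then have P: "P (N <#> M)" using normal_set_mult[OF NM] by (simp add: P_def)
    then have "N = N <#> M"
      using max[OF P] H_contained_in_set_mult fin_N(1)[OF P] by (metis card_subset_eq card_mono le_antisym)
    then show ?thesis using S_contained_in_set_mult by simp
  qed
  then have "O_prime_core r G = N"
    unfolding O_prime_core_def using N by (intro Greatest_equality) (auto simp: P_def)
  then show ?thesis using N by (simp add: P_def)
qed

text \<open>Dual to the previous argument: a candidate of minimal cardinality lies in every other
  one, because the intersection of two normal subgroups of \<open>r\<close>-power index has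
  \<open>r\<close>-power index.\<close>

lemma O_residual_normal:
  assumes fin: "finite (carrier G)" and r: "Factorial_Ring.prime r"
  shows "O_residual r G \<lhd> G \<and> (\<exists>m. order (G Mod O_residual r G) = r ^ m)"
proof -
  define P where "P N \<longleftrightarrow> N \<lhd> G \<and> (\<exists>m. order (G Mod N) = r ^ m)" for N
  have ord: "order G > 0" using fin by (simp add: order_gt_0_iff_finite)
  have fin_N: "finite N" if "P N" for N
    using that fin normal_imp_subgroup[of N G] subgroup.subset[of N G]
    by (auto simp: P_def intro: finite_subset)
  have nG: "carrier G \<lhd> G" by (simp add: normal_inv_iff subgroup_self)
  then have "order (G Mod carrier G) = r ^ 0"
    using order_FactGroup[OF nG] ord by (simp add: order_def)
  then have "P (carrier G)" using nG unfolding P_def by blast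
  then obtain N where N: "P N" and min: "\<And>M. P M \<Longrightarrow> card N \<le> card M"
    using ex_has_least_nat[of P "carrier G" card] by auto
  have "N \<subseteq> M" if M: "P M" for M
  proof -
    have NM: "N \<lhd> G" "M \<lhd> G" using N M by (auto simp: P_def)
    obtain a b where ab: "order (G Mod N) = r ^ a" "order (G Mod M) = r ^ b"
      using N M by (auto simp: P_def)
    interpret second_isomorphism_grp N G M
      using NM normal_imp_subgroup by (auto simp: second_isomorphism_grp_def second_isomorphism_grp_axioms_def)
    have nI: "N \<inter> M \<lhd> G" using NM by (rule normal_subgroup_intersect)
    have 1: "card (N <#> M) * card (N \<inter> M) = card N * card M"
      using NM normal_imp_subgroup by (auto intro: card_set_mult_normal)
    obtain c where c: "order G = c * card (N <#> M)"
      using lagrange[OF normal_set_mult_subgroup] by metis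
    have e: "r ^ a * card N = order G" "r ^ b * card M = order G"
      "order (G Mod (N \<inter> M)) * card (N \<inter> M) = order G"
      using order_FactGroup[OF NM(1)] order_FactGroup[OF NM(2)] order_FactGroup[OF nI] ab by auto
    \<comment> \<open>With c = [G : NM], this is the identity [G : N \<inter> M] c = r^a r^b
      multiplied by |N| |M|, which is cancelled afterwards.\<close>
    have "order (G Mod (N \<inter> M)) * c * (card N * card M) =
        (order (G Mod (N \<inter> M)) * card (N \<inter> M)) * (c * card (N <#> M))"
      using 1 by (metis mult.commute mult.left_commute)
    also have "\<dots> = (r ^ a * card N) * (r ^ b * card M)"
      using e c by simp
    also have "\<dots> = r ^ (a + b) * (card N * card M)" by (simp add: power_add)
    finally have "order (G Mod (N \<inter> M)) * c * (card N * card M) = r ^ (a + b) * (card N * card M)" .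
    moreover have "card N * card M \<noteq> 0" using e ord by (metis mult_is_0 less_numeral_extra(3))
    ultimately have "order (G Mod (N \<inter> M)) dvd r ^ (a + b)"
      by (metis dvd_triv_left mult_cancel2)
    then obtain m where "order (G Mod (N \<inter> M)) = r ^ m" using r by (auto simp: divides_primepow_nat)
    then have P: "P (N \<inter> M)" using nI by (auto simp: P_def)
    then have "N \<inter> M = N"
      using min[OF P] fin_N[OF N] by (metis Int_lower1 card_subset_eq card_mono le_antisym)
    then show ?thesis by auto
  qed
  then have "O_residual r G = N"
    unfolding O_residual_def using N by (intro Least_equality) (auto simp: P_def)
  then show ?thesis using N by (simp add: P_def)
qed

end


section \<open>Prime characteristic\<close>

context field
begin

lemma add_pow_one_eq_zero_iff: "add_pow R (n) \<one> = \<zero> \<longleftrightarrow> ring_char R dvd n" for n :: nat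
proof -
  have "group.ord (add_monoid R) \<one> dvd n \<longleftrightarrow> \<one> [^]\<^bsub>add_monoid R\<^esub> n = \<one>\<^bsub>add_monoid R\<^esub>"
    using group.pow_eq_id[OF a_group, of \<one> n] by simp
  then show ?thesis by (simp add: ring_char_def add_pow_def)
qed

text \<open>Multiples of one multiply like integers, and a field has no zero divisors.\<close>

lemma ring_char_prime:
  assumes "ring_char R > 0"
  shows "Factorial_Ring.prime (ring_char R)"
proof -
  let ?r = "ring_char R"
  have "?r \<noteq> 1"
  proof
    assume "?r = 1"
    then have "add_pow R ((1::nat)) \<one> = \<zero>" using add_pow_one_eq_zero_iff[of 1] by simp
    then show False by simp
  qed
  moreover have "?r dvd a \<or> ?r dvd b" if "?r dvd a * b" for a b
  proof -
    have "(add_pow R (a) \<one>) \<otimes> (add_pow R (b) \<one>) = add_pow R (a * b) \<one>"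
      by (simp add: add_pow_ldistr add.nat_pow_pow mult.commute)
    then have "(add_pow R (a) \<one>) \<otimes> (add_pow R (b) \<one>) = \<zero>" using that by (simp add: add_pow_one_eq_zero_iff)
    then show ?thesis using integral[of "add_pow R (a) \<one>" "add_pow R (b) \<one>"] by (simp add: add_pow_one_eq_zero_iff)
  qed
  ultimately show ?thesis using assms
    unfolding Factorial_Ring.prime_def Factorial_Ring.prime_elem_def by auto
qed

end


section \<open>Fixed points\<close>

context kG_module
begin

text \<open>
  The orbit of a non-zero vector spans a finite vector space over the prime field, of order
  divisible by \<open>r\<close>; a group acting through an \<open>r\<close>-group cannot fix exactly one of its points.
\<close>

lemma ex_fixed_point:
  assumes fin: "finite (carrier G)" and r: "ring_char K = r" "r > 0"
    and N: "N \<lhd> G" "order (G Mod N) = r ^ m"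
    and v: "v \<in> fixed_points V N" "v \<noteq> \<zero>\<^bsub>V\<^esub>"
  shows "fixed_points V (carrier G) \<noteq> {\<zero>\<^bsub>V\<^esub>}"
proof
  assume fix0: "fixed_points V (carrier G) = {\<zero>\<^bsub>V\<^esub>}"
  have prime: "Factorial_Ring.prime r" using K.ring_char_prime r by simp
  have vV: "v \<in> carrier V" and vN: "\<And>n. n \<in> N \<Longrightarrow> act V n v = v" using v by (auto simp: fixed_points_def)
  \<comment> \<open>The prime field, as the set of natural multiples of one. It has at most
    \<open>r\<close> elements, which keeps the set of combinations below finite.\<close>
  define F where "F = range (\<lambda>k::nat. add_pow K (k) \<one>\<^bsub>K\<^esub>)"
  have "F \<subseteq> (\<lambda>k::nat. add_pow K (k) \<one>\<^bsub>K\<^esub>) ` {..<r}"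
  proof
    fix a assume "a \<in> F"
    then obtain k :: nat where k: "a = add_pow K (k) \<one>\<^bsub>K\<^esub>" by (auto simp: F_def)
    have "add_pow K (r * (k div r)) \<one>\<^bsub>K\<^esub> = \<zero>\<^bsub>K\<^esub>" using r by (subst K.add_pow_one_eq_zero_iff) simp
    moreover have "add_pow K (k) \<one>\<^bsub>K\<^esub> = add_pow K (r * (k div r)) \<one>\<^bsub>K\<^esub> \<oplus>\<^bsub>K\<^esub> add_pow K (k mod r) \<one>\<^bsub>K\<^esub>"
      by (subst K.add.nat_pow_mult) auto
    ultimately have "a = add_pow K (k mod r) \<one>\<^bsub>K\<^esub>" using k by simp
    then show "a \<in> (\<lambda>k::nat. add_pow K (k) \<one>\<^bsub>K\<^esub>) ` {..<r}" using r(2) by (intro image_eqI[of _ _ "k mod r"]) auto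
  qed
  then have F_fin: "finite F" by (rule finite_subset) simp
  have F_cl: "F \<subseteq> carrier K" by (auto simp: F_def)
  have F_add: "a \<oplus>\<^bsub>K\<^esub> b \<in> F" if ab: "a \<in> F" "b \<in> F" for a b
  proof -
    obtain j k :: nat where "a = add_pow K (j) \<one>\<^bsub>K\<^esub>" "b = add_pow K (k) \<one>\<^bsub>K\<^esub>" using ab by (auto simp: F_def)
    then have "a \<oplus>\<^bsub>K\<^esub> b = add_pow K (j + k) \<one>\<^bsub>K\<^esub>" by (simp add: K.add.nat_pow_mult)
    then show ?thesis by (auto simp: F_def)
  qed
  have F01: "\<zero>\<^bsub>K\<^esub> \<in> F" "\<one>\<^bsub>K\<^esub> \<in> F"
    by (auto simp: F_def intro: range_eqI[of _ _ "0::nat"] range_eqI[of _ _ "1::nat"])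
  define comb where "comb c = (\<Oplus>\<^bsub>V\<^esub>g \<in> carrier G. c g \<odot>\<^bsub>V\<^esub> act V g v)" for c
  define W where "W = comb ` (carrier G \<rightarrow>\<^sub>E F)"
  have term_cl: "c g \<odot>\<^bsub>V\<^esub> act V g v \<in> carrier V" if "c \<in> carrier G \<rightarrow> F" "g \<in> carrier G" for c g
    using that F_cl act_closed[OF _ vV] by (auto intro!: V.smult_closed)
  have combW: "comb c \<in> W" if "c \<in> carrier G \<rightarrow> F" for c
  proof -
    have "comb c = comb (restrict c (carrier G))"
      unfolding comb_def using term_cl[OF that] by (intro V.finsum_cong') auto
    moreover have "restrict c (carrier G) \<in> carrier G \<rightarrow>\<^sub>E F" using that by auto
    ultimately show ?thesis unfolding W_def by simp
  qed
  have WE: "\<exists>c. c \<in> carrier G \<rightarrow> F \<and> w = comb c" if "w \<in> W" for w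
    using that by (auto simp: W_def)
  have W_fin: "finite W" using fin F_fin by (auto simp: W_def intro!: finite_PiE)
  have W_cl: "W \<subseteq> carrier V"
    by (auto dest!: WE simp: comb_def intro!: V.finsum_closed term_cl)
  have W_add: "w \<oplus>\<^bsub>V\<^esub> w' \<in> W" if ww: "w \<in> W" "w' \<in> W" for w w'
  proof -
    obtain c c' where c: "c \<in> carrier G \<rightarrow> F" "w = comb c" "c' \<in> carrier G \<rightarrow> F" "w' = comb c'"
      using WE[OF ww(1)] WE[OF ww(2)] by blast
    have "comb c \<oplus>\<^bsub>V\<^esub> comb c' = (\<Oplus>\<^bsub>V\<^esub>g \<in> carrier G. c g \<odot>\<^bsub>V\<^esub> act V g v \<oplus>\<^bsub>V\<^esub> c' g \<odot>\<^bsub>V\<^esub> act V g v)"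
      unfolding comb_def using term_cl c by (intro V.finsum_addf[symmetric]) auto
    also have "\<dots> = comb (\<lambda>g. c g \<oplus>\<^bsub>K\<^esub> c' g)"
      unfolding comb_def
    proof (rule V.finsum_cong')
      show "(\<lambda>g. (c g \<oplus>\<^bsub>K\<^esub> c' g) \<odot>\<^bsub>V\<^esub> act V g v) \<in> carrier G \<rightarrow> carrier V"
        using c F_cl act_closed[OF _ vV] by (auto intro!: V.smult_closed K.a_closed)
      fix g assume g: "g \<in> carrier G"
      then have "c g \<in> carrier K" "c' g \<in> carrier K" using c F_cl by auto
      then show "c g \<odot>\<^bsub>V\<^esub> act V g v \<oplus>\<^bsub>V\<^esub> c' g \<odot>\<^bsub>V\<^esub> act V g v = (c g \<oplus>\<^bsub>K\<^esub> c' g) \<odot>\<^bsub>V\<^esub> act V g v"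
        using g act_closed[OF _ vV] by (simp add: V.smult_l_distr)
    qed simp
    finally show ?thesis using combW[of "\<lambda>g. c g \<oplus>\<^bsub>K\<^esub> c' g"] c F_add by auto
  qed
  have W_act: "act V h w \<in> W" if h: "h \<in> carrier G" and w: "w \<in> W" for h w
  proof -
    obtain c where c: "c \<in> carrier G \<rightarrow> F" "w = comb c" using w WE by blast
    have cK: "c g \<in> carrier K" if "g \<in> carrier G" for g using that c F_cl by auto
    have im: "(\<lambda>g. h \<otimes>\<^bsub>G\<^esub> g) ` carrier G = carrier G"
    proof (intro equalityI subsetI)
      fix g assume "g \<in> carrier G"
      then show "g \<in> (\<lambda>g. h \<otimes>\<^bsub>G\<^esub> g) ` carrier G"
        using h by (intro image_eqI[of _ _ "inv\<^bsub>G\<^esub> h \<otimes>\<^bsub>G\<^esub> g"]) (auto simp: G.m_assoc[symmetric])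
    qed (use h in auto)
    define c' where "c' g = c (inv\<^bsub>G\<^esub> h \<otimes>\<^bsub>G\<^esub> g)" for g
    have c': "c' \<in> carrier G \<rightarrow> F" using c h by (auto simp: c'_def)
    have "act V h w = (\<Oplus>\<^bsub>V\<^esub>g \<in> carrier G. act V h (c g \<odot>\<^bsub>V\<^esub> act V g v))"
      unfolding c(2) comb_def by (intro linear_hom_finsum[OF module_V module_V act_linear_hom[OF h]] term_cl[OF c(1)])
    also have "\<dots> = (\<Oplus>\<^bsub>V\<^esub>g \<in> carrier G. c' (h \<otimes>\<^bsub>G\<^esub> g) \<odot>\<^bsub>V\<^esub> act V (h \<otimes>\<^bsub>G\<^esub> g) v)"
    proof (rule V.finsum_cong')
      fix g assume g: "g \<in> carrier G"
      then show "act V h (c g \<odot>\<^bsub>V\<^esub> act V g v) = c' (h \<otimes>\<^bsub>G\<^esub> g) \<odot>\<^bsub>V\<^esub> act V (h \<otimes>\<^bsub>G\<^esub> g) v"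
        using h vV cK act_closed
        by (simp add: act_smult act_mult c'_def G.m_assoc[symmetric])
    next
      show "(\<lambda>g. c' (h \<otimes>\<^bsub>G\<^esub> g) \<odot>\<^bsub>V\<^esub> act V (h \<otimes>\<^bsub>G\<^esub> g) v) \<in> carrier G \<rightarrow> carrier V"
        using term_cl[OF c'] h by auto
    qed simp
    also have "\<dots> = comb c'"
      unfolding comb_def using V.finsum_reindex[of "\<lambda>g. c' g \<odot>\<^bsub>V\<^esub> act V g v" "\<lambda>g. h \<otimes>\<^bsub>G\<^esub> g" "carrier G"]
        term_cl[OF c'] h unfolding im by (auto simp: inj_on_def)
    finally show ?thesis using combW[OF c'] by simp
  qed
  have W0: "\<zero>\<^bsub>V\<^esub> \<in> W"
  proof -
    have "comb (\<lambda>g. \<zero>\<^bsub>K\<^esub>) = (\<Oplus>\<^bsub>V\<^esub>g \<in> carrier G. \<zero>\<^bsub>V\<^esub>)"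
      unfolding comb_def using act_closed[OF _ vV] by (intro V.finsum_cong') auto
    then show ?thesis using combW[of "\<lambda>g. \<zero>\<^bsub>K\<^esub>"] F01 by simp
  qed
  have Wv: "v \<in> W"
  proof -
    have "comb (\<lambda>g. if \<one>\<^bsub>G\<^esub> = g then \<one>\<^bsub>K\<^esub> else \<zero>\<^bsub>K\<^esub>) = (\<Oplus>\<^bsub>V\<^esub>g \<in> carrier G. if \<one>\<^bsub>G\<^esub> = g then v else \<zero>\<^bsub>V\<^esub>)"
      unfolding comb_def using act_closed[OF _ vV] vV by (intro V.finsum_cong') (auto simp: act_one)
    also have "\<dots> = v" using V.finsum_singleton[of "\<one>\<^bsub>G\<^esub>" "carrier G" "\<lambda>_. v"] fin vV by simp
    finally show ?thesis using combW[of "\<lambda>g. if \<one>\<^bsub>G\<^esub> = g then \<one>\<^bsub>K\<^esub> else \<zero>\<^bsub>K\<^esub>"] F01 by simp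
  qed
  have rW: "r dvd card W"
  proof -
    have pow: "add_pow V (r) v = \<zero>\<^bsub>V\<^esub>"
    proof -
      have "add_pow V (k) v = (add_pow K (k) \<one>\<^bsub>K\<^esub>) \<odot>\<^bsub>V\<^esub> v" for k :: nat
        by (induction k) (use vV in \<open>auto simp: V.smult_l_distr\<close>)
      moreover have "add_pow K (r) \<one>\<^bsub>K\<^esub> = \<zero>\<^bsub>K\<^esub>" using r by (subst K.add_pow_one_eq_zero_iff) simp
      ultimately show ?thesis using vV by simp
    qed
    have sub: "subgroup W (add_monoid V)"
    proof -
      \<comment> \<open>\<open>W\<close> is finite and closed under addition, so translation by
        \<open>w\<close> is a bijection of \<open>W\<close>; the element sent to zero is the
        negative.\<close>
      have neg: "\<ominus>\<^bsub>V\<^esub> w \<in> W" if w: "w \<in> W" for w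
      proof -
        have wV: "w \<in> carrier V" using W_cl w by auto
        have inj: "inj_on (\<lambda>u. w \<oplus>\<^bsub>V\<^esub> u) W" using W_cl wV by (auto simp: inj_on_def subset_iff)
        have "(\<lambda>u. w \<oplus>\<^bsub>V\<^esub> u) ` W = W"
          using endo_inj_surj[OF W_fin _ inj] W_add[OF w] by auto
        then obtain u where u: "u \<in> W" "w \<oplus>\<^bsub>V\<^esub> u = \<zero>\<^bsub>V\<^esub>" using W0 by (metis imageE)
        have "\<ominus>\<^bsub>V\<^esub> w = u" using u W_cl wV by (intro V.minus_equality) (auto simp: V.a_comm)
        then show ?thesis using u by simp
      qed
      show ?thesis
        using W_cl W0 W_add neg by (intro V.add.subgroupI) auto
    qed
    interpret GW: group "add_monoid V\<lparr>carrier := W\<rparr>"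
      using V.add.subgroup_imp_group[OF sub] .
    have "v [^]\<^bsub>add_monoid V\<lparr>carrier := W\<rparr>\<^esub> r = \<one>\<^bsub>add_monoid V\<lparr>carrier := W\<rparr>\<^esub>"
      using pow by (simp add: add_pow_def nat_pow_def)
    \<comment> \<open>As \<open>v\<close> is non-zero and killed by the prime \<open>r\<close>, its
      additive order is exactly \<open>r\<close>, and Lagrange gives
      \<open>r dvd card W\<close>.\<close>
    then have "GW.ord v dvd r" using GW.pow_eq_id[of v r] Wv by simp
    moreover have "GW.ord v \<noteq> 1"
      using GW.pow_eq_id[of v 1] Wv v(2) W_cl vV by (auto simp: nat_pow_def)
    ultimately have "GW.ord v = r" using prime by (auto simp: prime_nat_iff)
    then show ?thesis using GW.ord_dvd_group_order[of v] Wv by (simp add: order_def)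
  qed
  define \<phi> where "\<phi> g = (\<lambda>w \<in> W. act V g w)" for g
  have act_inv: "act V (inv\<^bsub>G\<^esub> g) (act V g w) = w" "act V g (act V (inv\<^bsub>G\<^esub> g) w) = w"
    if "g \<in> carrier G" "w \<in> W" for g w
    using that W_cl by (auto simp: act_mult[symmetric] act_one)
  have bij: "\<phi> g \<in> Bij W" if g: "g \<in> carrier G" for g
  proof -
    have "bij_betw (\<lambda>w. act V g w) W W"
      by (rule bij_betwI[where g = "\<lambda>w. act V (inv\<^bsub>G\<^esub> g) w"]) (use g W_act act_inv in auto)
    then show ?thesis by (auto simp: \<phi>_def Bij_def bij_betw_restrict_eq)
  qed
  interpret action: group_action G W \<phi>
  proof (intro group_action.intro group_hom.intro group_hom_axioms.intro G.group_axioms group_BijGroup)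
    show "\<phi> \<in> hom G (BijGroup W)"
    proof (rule homI)
      fix g h assume gh: "g \<in> carrier G" "h \<in> carrier G"
      then show "\<phi> (g \<otimes>\<^bsub>G\<^esub> h) = \<phi> g \<otimes>\<^bsub>BijGroup W\<^esub> \<phi> h"
        using bij W_cl W_act by (auto simp: BijGroup_def \<phi>_def compose_def act_mult fun_eq_iff)
    qed (auto simp: BijGroup_def bij)
  qed
  have orb: "orb = {\<zero>\<^bsub>V\<^esub>} \<or> r dvd card orb" if orbs: "orb \<in> orbits G W \<phi>" for orb
  proof -
    obtain w where w: "w \<in> W" "orb = orbit G \<phi> w" using orbs by (auto simp: orbits_def)
    have NG: "N \<subseteq> carrier G" using normal_imp_subgroup[OF N(1)] subgroup.subset by blast
    have Nw: "act V n u = u" if n: "n \<in> N" and u: "u \<in> W" for n u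
    proof -
      obtain c where c: "c \<in> carrier G \<rightarrow> F" "u = comb c" using u WE by blast
      have cK: "c g \<in> carrier K" if "g \<in> carrier G" for g using that c F_cl by auto
      have nG: "n \<in> carrier G" using n NG by auto
      \<comment> \<open>Normality of \<open>N\<close> is used here: n g v = g (g^{-1} n g) v = g v.
        So \<open>N\<close> fixes the whole of \<open>W\<close>, not only \<open>v\<close>.\<close>
      have "act V n (act V g v) = act V g v" if g: "g \<in> carrier G" for g
      proof -
        have "inv\<^bsub>G\<^esub> g \<otimes>\<^bsub>G\<^esub> n \<otimes>\<^bsub>G\<^esub> g \<in> N" using N(1) g n by (rule normal.inv_op_closed1)
        then have "act V g (act V (inv\<^bsub>G\<^esub> g \<otimes>\<^bsub>G\<^esub> n \<otimes>\<^bsub>G\<^esub> g) v) = act V g v" using vN by simp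
        then show ?thesis using g nG vV by (simp add: act_mult[symmetric] G.m_assoc[symmetric])
      qed
      then show ?thesis
        unfolding c(2) comb_def
        using linear_hom_finsum[OF module_V module_V act_linear_hom[OF nG], of "carrier G" "\<lambda>g. c g \<odot>\<^bsub>V\<^esub> act V g v"]
          term_cl[OF c(1)] nG cK act_closed[OF _ vV]
        by (simp add: act_smult cong: V.finsum_cong)
    qed
    have stab: "subgroup (stabilizer G \<phi> w) G" using action.stabilizer_subgroup w by simp
    \<comment> \<open>The stabiliser contains \<open>N\<close>, so the orbit length divides the
      index of \<open>N\<close>, a power of \<open>r\<close>.\<close>
    have "N \<subseteq> stabilizer G \<phi> w"
      using Nw w NG by (auto simp: stabilizer_def \<phi>_def)
    then have "subgroup N (G\<lparr>carrier := stabilizer G \<phi> w\<rparr>)"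
      using normal_imp_subgroup[OF N(1)] stab G.subgroup_incl by blast
    then obtain k where k: "card (stabilizer G \<phi> w) = k * card N"
      using group.lagrange[OF G.subgroup_imp_group[OF stab]] by (metis order_def partial_object.select_convs(1) partial_object.surjective partial_object.update_convs(1))
    have "card orb * card (stabilizer G \<phi> w) = order G"
      using action.orbit_stabilizer_theorem w by simp
    then have "card orb * k * card N = r ^ m * card N"
      using G.order_FactGroup[OF N(1)] N(2) k by simp
    moreover have "card N \<noteq> 0"
      using G.order_FactGroup[OF N(1)] fin G.order_gt_0_iff_finite by (metis mult_0_right neq0_conv)
    ultimately have "card orb dvd r ^ m" by (metis dvd_triv_left mult_cancel2)
    then obtain i where i: "card orb = r ^ i" using prime by (auto simp: divides_primepow_nat)
    show ?thesis
    proof (cases i)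
      case 0
      \<comment> \<open>An orbit of length one is a fixed point of the whole group, hence zero by
        assumption.\<close>
      then obtain u where u: "orb = {u}" using i by (auto simp: card_1_singleton_iff)
      have "w \<in> orb" using action.orbit_refl w by simp
      then have "orbit G \<phi> w = {w}" using u w by simp
      then have "act V g w = w" if "g \<in> carrier G" for g
        using that w by (auto simp: orbit_def \<phi>_def)
      then have "w \<in> fixed_points V (carrier G)" using w W_cl by (auto simp: fixed_points_def)
      then show ?thesis using fix0 \<open>orbit G \<phi> w = {w}\<close> w by auto
    qed (use i in simp)
  qed
  have "orbit G \<phi> \<zero>\<^bsub>V\<^esub> = {\<zero>\<^bsub>V\<^esub>}"
    using W0 linear_hom_zero[OF module_V module_V act_linear_hom] G.one_closed unfolding orbit_def \<phi>_def by force
  then have o0: "{\<zero>\<^bsub>V\<^esub>} \<in> orbits G W \<phi>" using W0 by (auto simp: orbits_def)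
  have fo: "finite (orbits G W \<phi>)" using W_fin by (auto simp: orbits_def)
  \<comment> \<open>Exactly one orbit, that of zero, has length prime to \<open>r\<close>, so the
    order of \<open>W\<close> is 1 modulo \<open>r\<close>; this contradicts
    \<open>rW\<close>.\<close>
  have "card W = (\<Sum>orb \<in> orbits G W \<phi>. card orb)"
    using action.disjoint_sum[OF W_fin, of "\<lambda>_. 1::nat"] by simp
  also have "\<dots> = 1 + (\<Sum>orb \<in> orbits G W \<phi> - {{\<zero>\<^bsub>V\<^esub>}}. card orb)"
    using sum.remove[OF fo o0, of card] by simp
  finally have "card W = 1 + (\<Sum>orb \<in> orbits G W \<phi> - {{\<zero>\<^bsub>V\<^esub>}}. card orb)" .
  moreover have "r dvd (\<Sum>orb \<in> orbits G W \<phi> - {{\<zero>\<^bsub>V\<^esub>}}. card orb)"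
    using orb by (intro dvd_sum) auto
  ultimately have "r dvd 1" using rW by (metis dvd_add_left_iff)
  then show False using prime by (metis prime_nat_iff nat_dvd_1_iff_1 less_irrefl)
qed

end


section \<open>Traces and projective modules\<close>

lemma kG_homD:
  assumes "f \<in> kG_hom G K M N"
  shows "f \<in> linear_hom K M N"
    and "\<lbrakk>g \<in> carrier G; x \<in> carrier M\<rbrakk> \<Longrightarrow> f (act M g x) = act N g (f x)"
  using assms by (auto simp: kG_hom_def)

lemma kG_homI:
  assumes "f \<in> linear_hom K M N"
    and "\<And>g x. \<lbrakk>g \<in> carrier G; x \<in> carrier M\<rbrakk> \<Longrightarrow> f (act M g x) = act N g (f x)"
  shows "f \<in> kG_hom G K M N"
  using assms by (auto simp: kG_hom_def)

lemma kG_hom_comp: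
  assumes "f \<in> kG_hom G K M N" "g \<in> kG_hom G K N Q"
  shows "(\<lambda>x. g (f x)) \<in> kG_hom G K M Q"
  by (intro kG_homI linear_hom_comp[OF kG_homD(1)[OF assms(1)] kG_homD(1)[OF assms(2)]])
    (simp add: kG_homD(2)[OF assms(1)] kG_homD(2)[OF assms(2)] linear_hom_closed[OF kG_homD(1)[OF assms(1)]])

lemma kG_hom_minus_fun:
  assumes "kG_module G K M" "kG_module G K N" "f \<in> kG_hom G K M N" "g \<in> kG_hom G K M N"
  shows "(\<lambda>x. f x \<ominus>\<^bsub>N\<^esub> g x) \<in> kG_hom G K M N"
proof -
  interpret M: kG_module G K M by (rule assms)
  interpret N: kG_module G K N by (rule assms)
  show ?thesis
    using kG_homD[OF assms(3)] kG_homD[OF assms(4)]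
    by (intro kG_homI linear_hom_minus_fun M.module_V N.module_V)
      (simp_all add: linear_hom_minus[OF N.module_V N.module_V N.act_linear_hom] linear_hom_closed)
qed

lemma kG_module_subgroup:
  assumes "kG_module G K M" "subgroup H G"
  shows "kG_module (G\<lparr>carrier := H\<rparr>) K M"
proof -
  interpret M: kG_module G K M by (rule assms)
  interpret H: subgroup H G by (rule assms)
  show ?thesis
    by (intro kG_module.intro kG_module_axioms.intro M.G.subgroup_imp_group assms M.module_V)
      (simp_all add: M.act_closed M.act_add M.act_smult M.act_one M.act_mult M.K.field_axioms)
qed

context
  fixes G :: "('g, 'm) monoid_scheme" and K :: "('k, 'n) ring_scheme"
    and M :: "('k, 'v, 'g) gmodule" and N :: "('k, 'w, 'g) gmodule"
  assumes M: "kG_module G K M" and N: "kG_module G K N"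
begin

interpretation M: kG_module G K M by (rule M)
interpretation N: kG_module G K N by (rule N)

text \<open>Replacing the summation index \<open>g\<close> by \<open>g b\<close> moves
  \<open>b\<close> from the argument to the front. There is no division by the group order, so this
  works in every characteristic.\<close>

lemma trace_kG_hom:
  assumes \<psi>: "\<psi> \<in> linear_hom K M N"
  shows "(\<lambda>x. \<Oplus>\<^bsub>N\<^esub>g \<in> carrier G. act N (inv\<^bsub>G\<^esub> g) (\<psi> (act M g x))) \<in> kG_hom G K M N"
proof (rule kG_homI)
  show "(\<lambda>x. \<Oplus>\<^bsub>N\<^esub>g \<in> carrier G. act N (inv\<^bsub>G\<^esub> g) (\<psi> (act M g x))) \<in> linear_hom K M N"
    by (intro linear_hom_finsum_fun M.module_V N.module_V linear_hom_comp[OF _ N.act_linear_hom]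
        linear_hom_comp[OF M.act_linear_hom \<psi>]) auto
next
  fix b x assume b: "b \<in> carrier G" and x: "x \<in> carrier M"
  have cl: "act N (inv\<^bsub>G\<^esub> g) (\<psi> (act M g y)) \<in> carrier N" if "g \<in> carrier G" "y \<in> carrier M" for g y
    using that by (intro N.act_closed linear_hom_closed[OF \<psi>] M.act_closed) auto
  have "(\<Oplus>\<^bsub>N\<^esub>g \<in> carrier G. act N (inv\<^bsub>G\<^esub> g) (\<psi> (act M g (act M b x)))) =
      (\<Oplus>\<^bsub>N\<^esub>g \<in> carrier G. act N b (act N (inv\<^bsub>G\<^esub> (g \<otimes>\<^bsub>G\<^esub> b)) (\<psi> (act M (g \<otimes>\<^bsub>G\<^esub> b) x))))"
  proof (rule N.V.finsum_cong')
    fix g assume g: "g \<in> carrier G"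
    then show "act N (inv\<^bsub>G\<^esub> g) (\<psi> (act M g (act M b x))) =
        act N b (act N (inv\<^bsub>G\<^esub> (g \<otimes>\<^bsub>G\<^esub> b)) (\<psi> (act M (g \<otimes>\<^bsub>G\<^esub> b) x)))"
      using b x by (simp add: M.act_mult[symmetric] N.act_mult[symmetric] linear_hom_closed[OF \<psi>]
          M.act_closed M.G.inv_mult_group M.G.m_assoc[symmetric])
  next
    show "(\<lambda>g. act N b (act N (inv\<^bsub>G\<^esub> (g \<otimes>\<^bsub>G\<^esub> b)) (\<psi> (act M (g \<otimes>\<^bsub>G\<^esub> b) x)))) \<in> carrier G \<rightarrow> carrier N"
      using b x by (auto intro!: N.act_closed[OF b] cl)
  qed simp
  also have "\<dots> = (\<Oplus>\<^bsub>N\<^esub>g \<in> carrier G. act N b (act N (inv\<^bsub>G\<^esub> g) (\<psi> (act M g x))))"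
    using b x by (intro N.finsum_act_translate[of b "\<lambda>g. act N b (act N (inv\<^bsub>G\<^esub> g) (\<psi> (act M g x)))"])
      (auto intro!: N.act_closed[OF b] cl)
  also have "\<dots> = act N b (\<Oplus>\<^bsub>N\<^esub>g \<in> carrier G. act N (inv\<^bsub>G\<^esub> g) (\<psi> (act M g x)))"
    using x by (intro linear_hom_finsum[OF N.module_V N.module_V N.act_linear_hom[OF b], symmetric] cl)
  finally show "(\<Oplus>\<^bsub>N\<^esub>g \<in> carrier G. act N (inv\<^bsub>G\<^esub> g) (\<psi> (act M g (act M b x)))) =
      act N b (\<Oplus>\<^bsub>N\<^esub>g \<in> carrier G. act N (inv\<^bsub>G\<^esub> g) (\<psi> (act M g x)))" .
qed

end

text \<open>
  Higman's criterion for projectivity; unlike the definition, it is visibly inherited by subgroups.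
\<close>

definition has_trace :: "('g, 'm) monoid_scheme \<Rightarrow> ('k, 'n) ring_scheme \<Rightarrow> ('k, 'v, 'g) gmodule \<Rightarrow> bool" where
  "has_trace G K M \<longleftrightarrow> (\<exists>\<theta> \<in> linear_hom K M M. \<forall>x \<in> carrier M.
     (\<Oplus>\<^bsub>M\<^esub>g \<in> carrier G. act M (inv\<^bsub>G\<^esub> g) (\<theta> (act M g x))) = x)"

text \<open>A linear lift \<open>\<psi>\<close> exists because \<open>K\<close> is a field. The
  trace of \<open>\<psi>\<close> after \<open>\<theta>\<close> is equivariant, and it is still a
  lift: \<open>d\<close> and \<open>\<phi>\<close> commute with the action, so \<open>d\<close>
  sends it to \<open>\<phi>\<close> of the trace of \<open>\<theta>\<close>, which is
  \<open>\<phi>\<close>.\<close>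

lemma kG_hom_lift:
  assumes M: "kG_module G K M" and N: "kG_module G K N" and N': "kG_module G K N'"
    and tr: "has_trace G K M"
    and \<phi>: "\<phi> \<in> kG_hom G K M N'" and d: "d \<in> kG_hom G K N N'"
    and im: "\<And>x. x \<in> carrier M \<Longrightarrow> \<exists>y \<in> carrier N. d y = \<phi> x"
  obtains \<Phi> where "\<Phi> \<in> kG_hom G K M N" "\<And>x. x \<in> carrier M \<Longrightarrow> d (\<Phi> x) = \<phi> x"
proof -
  interpret M: kG_module G K M by (rule M)
  interpret N: kG_module G K N by (rule N)
  interpret N': kG_module G K N' by (rule N')
  note \<phi>l = kG_homD[OF \<phi>] and dl = kG_homD[OF d]
  have zero: "d \<zero>\<^bsub>N\<^esub> = \<phi> \<zero>\<^bsub>M\<^esub>"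
    using linear_hom_zero[OF M.module_V N'.module_V \<phi>l(1)] linear_hom_zero[OF N.module_V N'.module_V dl(1)] by simp
  obtain \<psi> where \<psi>: "\<psi> \<in> linear_hom K M N" and "\<And>x. x \<in> carrier M \<Longrightarrow> (x, \<psi> x) \<in> {(x, y). x \<in> carrier M \<and> y \<in> carrier N \<and> d y = \<phi> x}"
  proof (rule linear_selection[OF M.K.field_axioms M.module_V N.module_V, 
        of "{(x, y). x \<in> carrier M \<and> y \<in> carrier N \<and> d y = \<phi> x}" "{(\<zero>\<^bsub>M\<^esub>, \<zero>\<^bsub>N\<^esub>)}"])
    show "linear_rel K M N {(x, y). x \<in> carrier M \<and> y \<in> carrier N \<and> d y = \<phi> x}"
      by (rule linear_relI)
        (simp_all add: zero linear_hom_add[OF \<phi>l(1)] linear_hom_add[OF dl(1)]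
          linear_hom_smult[OF \<phi>l(1)] linear_hom_smult[OF dl(1)])
    show "linear_rel K M N {(\<zero>\<^bsub>M\<^esub>, \<zero>\<^bsub>N\<^esub>)}"
      by (rule linear_relI) auto
  qed (use im zero in auto)
  then have d\<psi>: "d (\<psi> x) = \<phi> x" if "x \<in> carrier M" for x using that by auto
  obtain \<theta> where \<theta>: "\<theta> \<in> linear_hom K M M"
    and \<theta>_tr: "\<And>x. x \<in> carrier M \<Longrightarrow> (\<Oplus>\<^bsub>M\<^esub>g \<in> carrier G. act M (inv\<^bsub>G\<^esub> g) (\<theta> (act M g x))) = x"
    using tr by (auto simp: has_trace_def)
  define \<Phi> where "\<Phi> x = (\<Oplus>\<^bsub>N\<^esub>g \<in> carrier G. act N (inv\<^bsub>G\<^esub> g) (\<psi> (\<theta> (act M g x))))" for x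
  have "\<Phi> \<in> kG_hom G K M N"
    using trace_kG_hom[OF M N linear_hom_comp[OF \<theta> \<psi>]] by (simp add: \<Phi>_def[abs_def])
  moreover have "d (\<Phi> x) = \<phi> x" if x: "x \<in> carrier M" for x
  proof -
    have cl: "\<theta> (act M g x) \<in> carrier M" if "g \<in> carrier G" for g
      using that x by (intro linear_hom_closed[OF \<theta>] M.act_closed)
    have "d (\<Phi> x) = (\<Oplus>\<^bsub>N'\<^esub>g \<in> carrier G. d (act N (inv\<^bsub>G\<^esub> g) (\<psi> (\<theta> (act M g x)))))"
      unfolding \<Phi>_def using cl
      by (intro linear_hom_finsum[OF N.module_V N'.module_V dl(1)] N.act_closed linear_hom_closed[OF \<psi>]) auto
    also have "\<dots> = (\<Oplus>\<^bsub>N'\<^esub>g \<in> carrier G. \<phi> (act M (inv\<^bsub>G\<^esub> g) (\<theta> (act M g x))))"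
    proof (rule N'.V.finsum_cong')
      fix g assume g: "g \<in> carrier G"
      then show "d (act N (inv\<^bsub>G\<^esub> g) (\<psi> (\<theta> (act M g x)))) = \<phi> (act M (inv\<^bsub>G\<^esub> g) (\<theta> (act M g x)))"
        using cl by (simp add: dl(2) \<phi>l(2) linear_hom_closed[OF \<psi>] d\<psi>)
    qed (use cl M.act_closed linear_hom_closed[OF \<phi>l(1)] in auto)
    also have "\<dots> = \<phi> (\<Oplus>\<^bsub>M\<^esub>g \<in> carrier G. act M (inv\<^bsub>G\<^esub> g) (\<theta> (act M g x)))"
      using cl by (intro linear_hom_finsum[OF M.module_V N'.module_V \<phi>l(1), symmetric] M.act_closed) auto
    finally show ?thesis using \<theta>_tr[OF x] by simp
  qed
  ultimately show thesis by (rule that)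
qed

text \<open>\<open>T\<close> picks one element in each right coset of \<open>H\<close>. The unique
  translate of \<open>g\<close> landing in \<open>T\<close> is what makes the sum in
  \<open>projective_has_trace\<close> have a single non-zero term.\<close>

lemma (in group) ex_transversal:
  assumes H: "subgroup H G"
  obtains T where "\<And>g. g \<in> carrier G \<Longrightarrow> \<exists>!h. h \<in> H \<and> h \<otimes> g \<in> T"
proof -
  interpret H: subgroup H G by (rule H)
  define t where "t g = (SOME y. y \<in> H #> g)" for g
  have t: "t g \<in> H #> g" if "g \<in> carrier G" for g
    unfolding t_def using rcos_self[OF that H] by (rule someI)
  have t_eq: "t (h \<otimes> g) = t g" if "h \<in> H" "g \<in> carrier G" for h g
    using that by (simp add: t_def coset_mult_assoc[symmetric] H.subset H.rcos_const)
  define T where "T = {g \<in> carrier G. t g = g}"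
  have "\<exists>!h. h \<in> H \<and> h \<otimes> g \<in> T" if g: "g \<in> carrier G" for g
  proof -
    obtain h where h: "h \<in> H" "t g = h \<otimes> g" using t[OF g] by (auto simp: r_coset_def)
    show ?thesis
    proof (rule ex1I[of _ h])
      show "h \<in> H \<and> h \<otimes> g \<in> T" using h g t_eq[OF h(1) g] by (simp add: T_def)
      fix h' assume h': "h' \<in> H \<and> h' \<otimes> g \<in> T"
      then have "h' \<otimes> g = h \<otimes> g" using h t_eq[of h' g] g by (simp add: T_def)
      then show "h' = h" using h h' g by simp
    qed
  qed
  then show thesis by (rule that)
qed

text \<open>On a free module, let \<open>\<theta>\<close> cut a function off outside
  \<open>B \<times> T\<close> with \<open>T\<close> a transversal of the right cosets of
  \<open>H\<close>. The \<open>H\<close>-translates of this region tile the basis, so the cut-off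
  pieces add up to the identity. For a summand, \<open>\<theta>\<close> is sandwiched between the
  inclusion \<open>s\<close> and the projection \<open>p\<close>.\<close>

lemma projective_has_trace:
  fixes G :: "('g, 'm) monoid_scheme" and K :: "('k, 'n) ring_scheme" and P :: "('k, 'v, 'g) gmodule"
  assumes G: "group G" "finite (carrier G)" and K: "field K" and H: "subgroup H G"
    and P: "projective_gmodule G K P"
  shows "has_trace (G\<lparr>carrier := H\<rparr>) K P"
proof -
  interpret G: group G by (rule G)
  interpret K: field K by (rule K)
  interpret H: subgroup H G by (rule H)
  obtain B :: "'v set" and s p where Pmod: "kG_module G K P" and s: "s \<in> kG_hom G K P (free_gmodule G K B)"
    and p: "p \<in> kG_hom G K (free_gmodule G K B) P" and ps: "\<And>x. x \<in> carrier P \<Longrightarrow> p (s x) = x"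
    using P by (auto simp: projective_gmodule_def)
  interpret P: kG_module G K P by (rule Pmod)
  define F where "F = free_gmodule G K B"
  define C where "C = {f \<in> B \<times> carrier G \<rightarrow>\<^sub>E carrier K. finite {q \<in> B \<times> carrier G. f q \<noteq> \<zero>\<^bsub>K\<^esub>}}"
  have F_simps: "carrier F = C" "\<And>f g. f \<oplus>\<^bsub>F\<^esub> g = (\<lambda>q \<in> B \<times> carrier G. f q \<oplus>\<^bsub>K\<^esub> g q)"
    "\<And>a f. a \<odot>\<^bsub>F\<^esub> f = (\<lambda>q \<in> B \<times> carrier G. a \<otimes>\<^bsub>K\<^esub> f q)"
    "\<And>g f. act F g f = (\<lambda>q \<in> B \<times> carrier G. f (fst q, inv\<^bsub>G\<^esub> g \<otimes>\<^bsub>G\<^esub> snd q))"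
    by (simp_all add: F_def free_gmodule_def C_def)
  have CI: "(\<lambda>q \<in> B \<times> carrier G. f q) \<in> C"
    if "\<And>q. q \<in> B \<times> carrier G \<Longrightarrow> f q \<in> carrier K" "finite {q \<in> B \<times> carrier G. f q \<noteq> \<zero>\<^bsub>K\<^esub>}" for f
  proof -
    have "{q \<in> B \<times> carrier G. restrict f (B \<times> carrier G) q \<noteq> \<zero>\<^bsub>K\<^esub>} = {q \<in> B \<times> carrier G. f q \<noteq> \<zero>\<^bsub>K\<^esub>}"
      by (rule Collect_cong) auto
    then show ?thesis unfolding C_def using that by (simp add: restrict_PiE_iff)
  qed
  have C_cl: "f q \<in> carrier K" if "f \<in> C" "q \<in> B \<times> carrier G" for f q
    using that by (auto simp: C_def)
  have C_fin: "finite {q \<in> B \<times> carrier G. f q \<noteq> \<zero>\<^bsub>K\<^esub>}" if "f \<in> C" for f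
    using that by (auto simp: C_def)
  have regK: "module K (regular_module K)" by (rule module_regular_module) (rule K.is_cring)
  have C_sub: "C \<subseteq> B \<times> carrier G \<rightarrow>\<^sub>E carrier (regular_module K)" by (auto simp: C_def)
  have "module K (pointwise_module C (B \<times> carrier G) (regular_module K))"
  proof (rule module_pointwise_module[OF regK C_sub])
    show "(\<lambda>q\<in>B \<times> carrier G. \<zero>\<^bsub>regular_module K\<^esub>) \<in> C" by (rule CI) auto
  next
    fix f g assume fg: "f \<in> C" "g \<in> C"
    show "(\<lambda>q\<in>B \<times> carrier G. f q \<oplus>\<^bsub>regular_module K\<^esub> g q) \<in> C"
    proof (rule CI)
      have "{q \<in> B \<times> carrier G. f q \<oplus>\<^bsub>regular_module K\<^esub> g q \<noteq> \<zero>\<^bsub>K\<^esub>} \<subseteq>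
          {q \<in> B \<times> carrier G. f q \<noteq> \<zero>\<^bsub>K\<^esub>} \<union> {q \<in> B \<times> carrier G. g q \<noteq> \<zero>\<^bsub>K\<^esub>}"
        by auto
      then show "finite {q \<in> B \<times> carrier G. f q \<oplus>\<^bsub>regular_module K\<^esub> g q \<noteq> \<zero>\<^bsub>K\<^esub>}"
        by (rule finite_subset) (use C_fin fg in blast)
    qed (use C_cl fg in auto)
  next
    fix a f assume af: "a \<in> carrier K" "f \<in> C"
    show "(\<lambda>q\<in>B \<times> carrier G. a \<odot>\<^bsub>regular_module K\<^esub> f q) \<in> C"
    proof (rule CI)
      show "finite {q \<in> B \<times> carrier G. a \<odot>\<^bsub>regular_module K\<^esub> f q \<noteq> \<zero>\<^bsub>K\<^esub>}"
        by (rule finite_subset[OF _ C_fin[OF af(2)]]) (use af in auto)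
    qed (use C_cl af in auto)
  qed
  then have F: "module K F"
    unfolding F_def free_gmodule_def C_def by (rule module_with_action)
  interpret F: module K F by (rule F)
  have eval: "(\<lambda>f. f q) \<in> linear_hom K F (regular_module K)" if "q \<in> B \<times> carrier G" for q
    using that C_cl by (intro linear_homI) (auto simp: F_simps)
  have actF: "act F g \<in> linear_hom K F F" if g: "g \<in> carrier G" for g
  proof (rule linear_homI)
    fix f assume f: "f \<in> carrier F"
    have "{q \<in> B \<times> carrier G. f (fst q, inv\<^bsub>G\<^esub> g \<otimes>\<^bsub>G\<^esub> snd q) \<noteq> \<zero>\<^bsub>K\<^esub>} \<subseteq>
        (\<lambda>q. (fst q, g \<otimes>\<^bsub>G\<^esub> snd q)) ` {q \<in> B \<times> carrier G. f q \<noteq> \<zero>\<^bsub>K\<^esub>}"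
    proof
      fix q assume "q \<in> {q \<in> B \<times> carrier G. f (fst q, inv\<^bsub>G\<^esub> g \<otimes>\<^bsub>G\<^esub> snd q) \<noteq> \<zero>\<^bsub>K\<^esub>}"
      then show "q \<in> (\<lambda>q. (fst q, g \<otimes>\<^bsub>G\<^esub> snd q)) ` {q \<in> B \<times> carrier G. f q \<noteq> \<zero>\<^bsub>K\<^esub>}"
        using g by (intro image_eqI[of _ _ "(fst q, inv\<^bsub>G\<^esub> g \<otimes>\<^bsub>G\<^esub> snd q)"]) (auto simp: G.m_assoc[symmetric])
    qed
    then have "finite {q \<in> B \<times> carrier G. f (fst q, inv\<^bsub>G\<^esub> g \<otimes>\<^bsub>G\<^esub> snd q) \<noteq> \<zero>\<^bsub>K\<^esub>}"
      using C_fin f by (auto simp: F_simps intro: finite_subset)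
    then show "act F g f \<in> carrier F"
      unfolding F_simps using g f by (intro CI C_cl) (auto simp: F_simps)
  qed (use g in \<open>auto simp: F_simps\<close>)
  obtain T where T: "\<And>g. g \<in> carrier G \<Longrightarrow> \<exists>!h. h \<in> H \<and> h \<otimes>\<^bsub>G\<^esub> g \<in> T"
    using G.ex_transversal[OF H] by blast
  define \<theta> where "\<theta> f = (\<lambda>q \<in> B \<times> carrier G. if snd q \<in> T then f q else \<zero>\<^bsub>K\<^esub>)" for f :: "'v \<times> 'g \<Rightarrow> 'k"
  have \<theta>: "\<theta> \<in> linear_hom K F F"
  proof (rule linear_homI)
    fix f assume f: "f \<in> carrier F"
    show "\<theta> f \<in> carrier F"
      unfolding \<theta>_def F_simps
    proof (rule CI)
      have "{q \<in> B \<times> carrier G. (if snd q \<in> T then f q else \<zero>\<^bsub>K\<^esub>) \<noteq> \<zero>\<^bsub>K\<^esub>} \<subseteq> {q \<in> B \<times> carrier G. f q \<noteq> \<zero>\<^bsub>K\<^esub>}"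
        by auto
      then show "finite {q \<in> B \<times> carrier G. (if snd q \<in> T then f q else \<zero>\<^bsub>K\<^esub>) \<noteq> \<zero>\<^bsub>K\<^esub>}"
        by (rule finite_subset) (use C_fin f in \<open>auto simp: F_simps\<close>)
    qed (use f C_cl in \<open>auto simp: F_simps\<close>)
  qed (auto simp: \<theta>_def F_simps)
  have Hfin: "finite H" using G(2) H.subset finite_subset by blast
  have term_cl: "act F (inv\<^bsub>G\<^esub> h) (\<theta> (act F h f)) \<in> carrier F" if "h \<in> H" "f \<in> carrier F" for h f
    using that by (intro linear_hom_closed[OF actF] linear_hom_closed[OF \<theta>]) auto
  have tr: "(\<Oplus>\<^bsub>F\<^esub>h \<in> H. act F (inv\<^bsub>G\<^esub> h) (\<theta> (act F h f))) = f" if f: "f \<in> carrier F" for f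
  proof (rule extensionalityI[of _ "B \<times> carrier G"])
    have "(\<Oplus>\<^bsub>F\<^esub>h \<in> H. act F (inv\<^bsub>G\<^esub> h) (\<theta> (act F h f))) \<in> carrier F"
      using term_cl f by (intro F.finsum_closed) auto
    then show "(\<Oplus>\<^bsub>F\<^esub>h \<in> H. act F (inv\<^bsub>G\<^esub> h) (\<theta> (act F h f))) \<in> extensional (B \<times> carrier G)"
      by (auto simp: F_simps C_def PiE_def)
    show "f \<in> extensional (B \<times> carrier G)" using f by (auto simp: F_simps C_def PiE_def)
    fix q assume q: "q \<in> B \<times> carrier G"
    then obtain b g where bg: "q = (b, g)" "b \<in> B" "g \<in> carrier G" by auto
    \<comment> \<open>At (b, g) the summand of \<open>h\<close> looks whether \<open>h g\<close> is
      in \<open>T\<close>; only \<open>h0\<close> passes, and there the two translations cancel and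
      return \<open>f q\<close>.\<close>
    obtain h0 where h0: "h0 \<in> H" "h0 \<otimes>\<^bsub>G\<^esub> g \<in> T" "\<And>h. h \<in> H \<Longrightarrow> h \<otimes>\<^bsub>G\<^esub> g \<in> T \<longleftrightarrow> h0 = h"
      using T[OF bg(3)] by blast
    have "(\<Oplus>\<^bsub>F\<^esub>h \<in> H. act F (inv\<^bsub>G\<^esub> h) (\<theta> (act F h f))) q =
        (\<Oplus>\<^bsub>regular_module K\<^esub>h \<in> H. act F (inv\<^bsub>G\<^esub> h) (\<theta> (act F h f)) q)"
      using term_cl f by (intro linear_hom_finsum[OF F regK eval[OF q]])
    also have "\<dots> = (\<Oplus>\<^bsub>K\<^esub>h \<in> H. if h0 = h then f q else \<zero>\<^bsub>K\<^esub>)"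
      unfolding finsum_regular_module
    proof (rule K.finsum_cong')
      fix h assume h: "h \<in> H"
      have "inv\<^bsub>G\<^esub> h \<otimes>\<^bsub>G\<^esub> (h \<otimes>\<^bsub>G\<^esub> g) = g" using h bg by (simp add: G.m_assoc[symmetric])
      then show "act F (inv\<^bsub>G\<^esub> h) (\<theta> (act F h f)) q = (if h0 = h then f q else \<zero>\<^bsub>K\<^esub>)"
        using h bg h0 by (simp add: F_simps \<theta>_def)
    qed (use f q C_cl in \<open>auto simp: F_simps\<close>)
    also have "\<dots> = f q"
      using h0 Hfin f q C_cl by (intro K.finsum_singleton) (auto simp: F_simps)
    finally show "(\<Oplus>\<^bsub>F\<^esub>h \<in> H. act F (inv\<^bsub>G\<^esub> h) (\<theta> (act F h f))) q = f q" .
  qed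
  note sl = kG_homD[OF s, folded F_def] and pl = kG_homD[OF p, folded F_def]
  have "(\<Oplus>\<^bsub>P\<^esub>h \<in> H. act P (inv\<^bsub>G\<^esub> h) (p (\<theta> (s (act P h x))))) = x" if x: "x \<in> carrier P" for x
  proof -
    have sx: "s x \<in> carrier F" using linear_hom_closed[OF sl(1) x] .
    have "x = p (\<Oplus>\<^bsub>F\<^esub>h \<in> H. act F (inv\<^bsub>G\<^esub> h) (\<theta> (act F h (s x))))"
      using tr[OF sx] ps[OF x] by simp
    also have "\<dots> = (\<Oplus>\<^bsub>P\<^esub>h \<in> H. p (act F (inv\<^bsub>G\<^esub> h) (\<theta> (act F h (s x)))))"
      using term_cl sx by (intro linear_hom_finsum[OF F P.module_V pl(1)])
    also have "\<dots> = (\<Oplus>\<^bsub>P\<^esub>h \<in> H. act P (inv\<^bsub>G\<^esub> h) (p (\<theta> (s (act P h x)))))"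
    proof (rule P.V.finsum_cong')
      fix h assume "h \<in> H"
      then show "p (act F (inv\<^bsub>G\<^esub> h) (\<theta> (act F h (s x)))) = act P (inv\<^bsub>G\<^esub> h) (p (\<theta> (s (act P h x))))"
        using x sx linear_hom_closed[OF \<theta> linear_hom_closed[OF actF]] by (simp add: pl(2) sl(2))
    next
      show "(\<lambda>h. act P (inv\<^bsub>G\<^esub> h) (p (\<theta> (s (act P h x))))) \<in> H \<rightarrow> carrier P"
        using x by (auto intro!: P.act_closed linear_hom_closed[OF pl(1)] linear_hom_closed[OF \<theta>] linear_hom_closed[OF sl(1)])
    qed simp
    finally show ?thesis by simp
  qed
  moreover have "(\<lambda>x. p (\<theta> (s x))) \<in> linear_hom K P P"
    by (rule linear_hom_comp[OF linear_hom_comp[OF sl(1) \<theta>] pl(1)])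
  ultimately show ?thesis
    unfolding has_trace_def
  proof (intro bexI ballI)
    fix x assume x: "x \<in> carrier P"
    have "(\<Oplus>\<^bsub>P\<^esub>g \<in> carrier (G\<lparr>carrier := H\<rparr>). act P (inv\<^bsub>G\<lparr>carrier := H\<rparr>\<^esub> g) (p (\<theta> (s (act P g x))))) =
        (\<Oplus>\<^bsub>P\<^esub>h \<in> H. act P (inv\<^bsub>G\<^esub> h) (p (\<theta> (s (act P h x)))))"
    proof (rule P.V.finsum_cong')
      show "(\<lambda>h. act P (inv\<^bsub>G\<^esub> h) (p (\<theta> (s (act P h x))))) \<in> H \<rightarrow> carrier P"
        using x by (auto intro!: P.act_closed linear_hom_closed[OF pl(1)] linear_hom_closed[OF \<theta>] linear_hom_closed[OF sl(1)])
    qed (simp_all add: G.m_inv_consistent[OF H])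
    then show "(\<Oplus>\<^bsub>P\<^esub>g \<in> carrier (G\<lparr>carrier := H\<rparr>). act P (inv\<^bsub>G\<lparr>carrier := H\<rparr>\<^esub> g) (p (\<theta> (s (act P g x))))) = x"
      using \<open>\<And>x. x \<in> carrier P \<Longrightarrow> (\<Oplus>\<^bsub>P\<^esub>h \<in> H. act P (inv\<^bsub>G\<^esub> h) (p (\<theta> (s (act P h x))))) = x\<close>[OF x] by simp
  qed
qed


section \<open>Dual modules\<close>

context kG_module
begin

lemma dual_gmodule_simps:
  "carrier (dual_gmodule G K V) = linear_hom K V (regular_module K) \<inter> extensional (carrier V)"
  "f \<oplus>\<^bsub>dual_gmodule G K V\<^esub> h = (\<lambda>v \<in> carrier V. f v \<oplus>\<^bsub>K\<^esub> h v)"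
  "\<zero>\<^bsub>dual_gmodule G K V\<^esub> = (\<lambda>v \<in> carrier V. \<zero>\<^bsub>K\<^esub>)"
  "a \<odot>\<^bsub>dual_gmodule G K V\<^esub> f = (\<lambda>v \<in> carrier V. a \<otimes>\<^bsub>K\<^esub> f v)"
  "act (dual_gmodule G K V) g f = (\<lambda>v \<in> carrier V. f (act V (inv\<^bsub>G\<^esub> g) v))"
  by (simp_all add: dual_gmodule_def)

lemma module_regular: "module K (regular_module K)"
  by (rule module_regular_module) (rule K.is_cring)

lemma restrict_in_dual:
  "f \<in> linear_hom K V (regular_module K) \<Longrightarrow> restrict f (carrier V) \<in> carrier (dual_gmodule G K V)"
  using linear_hom_cong[OF _ module_V, of "restrict f (carrier V)" f "regular_module K"] by (simp add: dual_gmodule_simps)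

lemma dual_closed: "\<lbrakk>f \<in> carrier (dual_gmodule G K V); v \<in> carrier V\<rbrakk> \<Longrightarrow> f v \<in> carrier K"
  using linear_hom_closed[of f K V "regular_module K" v] by (simp add: dual_gmodule_simps)

lemma kG_module_dual: "kG_module G K (dual_gmodule G K V)"
proof -
  let ?D = "dual_gmodule G K V"
  show ?thesis
  proof (intro kG_module.intro kG_module_axioms.intro G.group_axioms K.field_axioms)
    show "module K ?D"
      unfolding dual_gmodule_def
    proof (intro module_with_action module_pointwise_module module_regular)
      show "linear_hom K V (regular_module K) \<inter> extensional (carrier V) \<subseteq> carrier V \<rightarrow>\<^sub>E carrier (regular_module K)"
        by (auto simp: PiE_def linear_hom_def)
      show "(\<lambda>v\<in>carrier V. \<zero>\<^bsub>regular_module K\<^esub>) \<in> linear_hom K V (regular_module K) \<inter> extensional (carrier V)"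
        using restrict_in_dual[OF linear_hom_zero_fun[OF module_V module_regular]] by (simp add: dual_gmodule_simps)
    next
      fix f h assume "f \<in> linear_hom K V (regular_module K) \<inter> extensional (carrier V)"
        "h \<in> linear_hom K V (regular_module K) \<inter> extensional (carrier V)"
      then show "(\<lambda>v\<in>carrier V. f v \<oplus>\<^bsub>regular_module K\<^esub> h v) \<in> linear_hom K V (regular_module K) \<inter> extensional (carrier V)"
        using restrict_in_dual[OF linear_hom_add_fun[OF module_V module_regular, of f h]] by (simp add: dual_gmodule_simps)
    next
      fix a f assume "a \<in> carrier K" "f \<in> linear_hom K V (regular_module K) \<inter> extensional (carrier V)"
      then show "(\<lambda>v\<in>carrier V. a \<odot>\<^bsub>regular_module K\<^esub> f v) \<in> linear_hom K V (regular_module K) \<inter> extensional (carrier V)"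
        using restrict_in_dual[OF linear_hom_smult_fun[OF module_V module_regular, of f a]] by (simp add: dual_gmodule_simps)
    qed
  next
    fix g f assume "g \<in> carrier G" "f \<in> carrier ?D"
    then show "act ?D g f \<in> carrier ?D"
      using restrict_in_dual[OF linear_hom_comp[OF act_linear_hom[of "inv\<^bsub>G\<^esub> g"], of f]]
      by (simp add: dual_gmodule_simps)
  next
    fix f assume "f \<in> carrier ?D"
    then show "act ?D \<one>\<^bsub>G\<^esub> f = f"
      by (auto simp: dual_gmodule_simps act_one extensional_def fun_eq_iff)
  next
    fix g h f assume "g \<in> carrier G" "h \<in> carrier G" "f \<in> carrier ?D"
    then show "act ?D (g \<otimes>\<^bsub>G\<^esub> h) f = act ?D g (act ?D h f)"
      by (auto simp: dual_gmodule_simps G.inv_mult_group act_mult act_closed fun_eq_iff)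
  qed (auto simp: dual_gmodule_simps act_closed fun_eq_iff)
qed

lemma dual_eval: "v \<in> carrier V \<Longrightarrow> (\<lambda>f. f v) \<in> linear_hom K (dual_gmodule G K V) (regular_module K)"
  by (intro linear_homI) (auto simp: dual_gmodule_simps dest: linear_hom_closed)

text \<open>The trace of the transpose of \<open>\<theta>\<close> is the transpose of the trace of
  \<open>\<theta>\<close>: evaluated at x, the summand of g is f(g^{-1} \<theta>(g x)). This makes
  the duals of projectives acyclic.\<close>

lemma has_trace_dual:
  assumes "has_trace G K V"
  shows "has_trace G K (dual_gmodule G K V)"
proof -
  let ?D = "dual_gmodule G K V"
  interpret D: kG_module G K ?D by (rule kG_module_dual)
  obtain \<theta> where \<theta>: "\<theta> \<in> linear_hom K V V"
    and tr: "\<And>x. x \<in> carrier V \<Longrightarrow> (\<Oplus>\<^bsub>V\<^esub>g \<in> carrier G. act V (inv\<^bsub>G\<^esub> g) (\<theta> (act V g x))) = x"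
    using assms by (auto simp: has_trace_def)
  define \<theta>' where "\<theta>' f = (\<lambda>v \<in> carrier V. f (\<theta> v))" for f :: "'v \<Rightarrow> 'k"
  have \<theta>': "\<theta>' \<in> linear_hom K ?D ?D"
  proof (rule linear_homI)
    fix f assume "f \<in> carrier ?D"
    then show "\<theta>' f \<in> carrier ?D"
      using restrict_in_dual[OF linear_hom_comp[OF \<theta>]] by (simp add: dual_gmodule_simps \<theta>'_def)
  qed (auto simp: dual_gmodule_simps \<theta>'_def linear_hom_closed[OF \<theta>] fun_eq_iff)
  have cl: "act ?D (inv\<^bsub>G\<^esub> g) (\<theta>' (act ?D g f)) \<in> carrier ?D" if "g \<in> carrier G" "f \<in> carrier ?D" for g f
    using that by (intro D.act_closed linear_hom_closed[OF \<theta>']) auto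
  have "(\<Oplus>\<^bsub>?D\<^esub>g \<in> carrier G. act ?D (inv\<^bsub>G\<^esub> g) (\<theta>' (act ?D g f))) = f" if f: "f \<in> carrier ?D" for f
  proof (rule extensionalityI[of _ "carrier V"])
    have "(\<Oplus>\<^bsub>?D\<^esub>g \<in> carrier G. act ?D (inv\<^bsub>G\<^esub> g) (\<theta>' (act ?D g f))) \<in> carrier ?D"
      using cl f by (intro D.V.finsum_closed) auto
    then show "(\<Oplus>\<^bsub>?D\<^esub>g \<in> carrier G. act ?D (inv\<^bsub>G\<^esub> g) (\<theta>' (act ?D g f))) \<in> extensional (carrier V)"
      by (simp add: dual_gmodule_simps)
    show "f \<in> extensional (carrier V)" using f by (simp add: dual_gmodule_simps)
    fix x assume x: "x \<in> carrier V"
    have fl: "f \<in> linear_hom K V (regular_module K)" using f by (simp add: dual_gmodule_simps)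
    have c: "act V (inv\<^bsub>G\<^esub> g) (\<theta> (act V g x)) \<in> carrier V" if "g \<in> carrier G" for g
      using that x by (intro act_closed linear_hom_closed[OF \<theta>]) auto
    have "(\<Oplus>\<^bsub>?D\<^esub>g \<in> carrier G. act ?D (inv\<^bsub>G\<^esub> g) (\<theta>' (act ?D g f))) x =
        (\<Oplus>\<^bsub>regular_module K\<^esub>g \<in> carrier G. act ?D (inv\<^bsub>G\<^esub> g) (\<theta>' (act ?D g f)) x)"
      using cl f by (intro linear_hom_finsum[OF D.module_V module_regular dual_eval[OF x]])
    also have "\<dots> = (\<Oplus>\<^bsub>regular_module K\<^esub>g \<in> carrier G. f (act V (inv\<^bsub>G\<^esub> g) (\<theta> (act V g x))))"
      unfolding finsum_regular_module
    proof (rule K.finsum_cong')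
      fix g assume "g \<in> carrier G"
      then show "act ?D (inv\<^bsub>G\<^esub> g) (\<theta>' (act ?D g f)) x = f (act V (inv\<^bsub>G\<^esub> g) (\<theta> (act V g x)))"
        using x by (simp add: dual_gmodule_simps \<theta>'_def act_closed linear_hom_closed[OF \<theta>])
    qed (use c dual_closed f in auto)
    also have "\<dots> = f (\<Oplus>\<^bsub>V\<^esub>g \<in> carrier G. act V (inv\<^bsub>G\<^esub> g) (\<theta> (act V g x)))"
      using c by (intro linear_hom_finsum[OF module_V module_regular fl, symmetric])
    finally show "(\<Oplus>\<^bsub>?D\<^esub>g \<in> carrier G. act ?D (inv\<^bsub>G\<^esub> g) (\<theta>' (act ?D g f))) x = f x"
      using tr[OF x] by simp
  qed
  then show ?thesis unfolding has_trace_def using \<theta>' by blast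
qed

end


section \<open>Null homotopies\<close>

text \<open>The usual construction of a chain homotopy from \<open>E\<close> to zero:
  \<open>h (Suc j)\<close> lifts \<open>E (Suc j) - h j d\<close> through \<open>d (Suc j)\<close>.
  The traces stand in for projectivity in each lift.\<close>

lemma null_homotopy:
  fixes P :: "nat \<Rightarrow> ('k, 'p, 'g) gmodule"
  assumes P: "\<And>j. kG_module G K (P j)" and tr: "\<And>j. has_trace G K (P j)"
    and d: "\<And>j. d j \<in> kG_hom G K (P (Suc j)) (P j)"
    and dd: "\<And>j x. x \<in> carrier (P (Suc (Suc j))) \<Longrightarrow> d j (d (Suc j) x) = \<zero>\<^bsub>P j\<^esub>"
    and ex: "\<And>j x. \<lbrakk>x \<in> carrier (P (Suc j)); d j x = \<zero>\<^bsub>P j\<^esub>\<rbrakk> \<Longrightarrow> \<exists>y \<in> carrier (P (Suc (Suc j))). d (Suc j) y = x"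
    and E: "\<And>j. E j \<in> kG_hom G K (P j) (P j)"
    and comm: "\<And>j x. x \<in> carrier (P (Suc j)) \<Longrightarrow> d j (E (Suc j) x) = E j (d j x)"
    and E0: "\<And>x. x \<in> carrier (P 0) \<Longrightarrow> \<exists>y \<in> carrier (P (Suc 0)). d 0 y = E 0 x"
  obtains h where "\<And>j. h j \<in> kG_hom G K (P j) (P (Suc j))"
    and "\<And>x. x \<in> carrier (P 0) \<Longrightarrow> d 0 (h 0 x) = E 0 x"
    and "\<And>j x. x \<in> carrier (P (Suc j)) \<Longrightarrow> d (Suc j) (h (Suc j) x) = E (Suc j) x \<ominus>\<^bsub>P (Suc j)\<^esub> h j (d j x)"
proof -
  note lin = kG_homD(1)[OF d] and mod = kG_module.module_V[OF P]
  \<comment> \<open>The invariant of the recursion. Its middle condition, the homotopy identity on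
    boundaries, is what puts the next map to be lifted into the kernel of \<open>d j\<close>;
    \<open>Q\<close> records the identity linking consecutive maps.\<close>
  define A where "A j h \<longleftrightarrow> h \<in> kG_hom G K (P j) (P (Suc j)) \<and>
      (\<forall>y \<in> carrier (P (Suc j)). d j (h (d j y)) = E j (d j y)) \<and>
      (j = 0 \<longrightarrow> (\<forall>x \<in> carrier (P 0). d 0 (h x) = E 0 x))" for j h
  define Q where "Q j h h' \<longleftrightarrow> (\<forall>x \<in> carrier (P (Suc j)).
      d (Suc j) (h' x) = E (Suc j) x \<ominus>\<^bsub>P (Suc j)\<^esub> h (d j x))" for j h h'
  have "\<exists>h. \<forall>j. A j (h j) \<and> Q j (h j) (h (Suc j))"
  proof (rule dependent_nat_choice)
    obtain h where "h \<in> kG_hom G K (P 0) (P (Suc 0))" "\<And>x. x \<in> carrier (P 0) \<Longrightarrow> d 0 (h x) = E 0 x"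
      using kG_hom_lift[OF P P P tr E d E0] by blast
    then show "\<exists>h. A 0 h" unfolding A_def using linear_hom_closed[OF lin] by blast
  next
    fix h j assume A: "A j h"
    then have h: "h \<in> kG_hom G K (P j) (P (Suc j))"
      and hE: "\<And>y. y \<in> carrier (P (Suc j)) \<Longrightarrow> d j (h (d j y)) = E j (d j y)" by (auto simp: A_def)
    define \<phi> where "\<phi> x = E (Suc j) x \<ominus>\<^bsub>P (Suc j)\<^esub> h (d j x)" for x
    interpret Pj: module K "P j" by (rule mod)
    interpret Pj1: module K "P (Suc j)" by (rule mod)
    have \<phi>: "\<phi> \<in> kG_hom G K (P (Suc j)) (P (Suc j))"
      unfolding \<phi>_def by (rule kG_hom_minus_fun[OF P P E kG_hom_comp[OF d h]])
    have "\<exists>y \<in> carrier (P (Suc (Suc j))). d (Suc j) y = \<phi> x" if x: "x \<in> carrier (P (Suc j))" for x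
    proof (rule ex)
      show "\<phi> x \<in> carrier (P (Suc j))" by (rule linear_hom_closed[OF kG_homD(1)[OF \<phi>] x])
      have c: "E (Suc j) x \<in> carrier (P (Suc j))" "h (d j x) \<in> carrier (P (Suc j))" "E j (d j x) \<in> carrier (P j)"
        using x linear_hom_closed[OF lin] linear_hom_closed[OF kG_homD(1)[OF h]]
          linear_hom_closed[OF kG_homD(1)[OF E]] by auto
      \<comment> \<open>\<open>d j\<close> commutes with \<open>E\<close>, and the invariant gives
        the same value for the subtracted term.\<close>
      have "d j (\<phi> x) = E j (d j x) \<ominus>\<^bsub>P j\<^esub> E j (d j x)"
        unfolding \<phi>_def by (subst linear_hom_minus[OF mod mod lin c(1,2)]) (simp add: hE[OF x] comm[OF x])
      then show "d j (\<phi> x) = \<zero>\<^bsub>P j\<^esub>" using c(3) by (simp add: a_minus_def Pj.M.r_neg)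
    qed
    then obtain h' where h': "h' \<in> kG_hom G K (P (Suc j)) (P (Suc (Suc j)))"
      "\<And>x. x \<in> carrier (P (Suc j)) \<Longrightarrow> d (Suc j) (h' x) = \<phi> x"
      using kG_hom_lift[OF P P P tr \<phi> d] by blast
    have "d (Suc j) (h' (d (Suc j) y)) = E (Suc j) (d (Suc j) y)" if y: "y \<in> carrier (P (Suc (Suc j)))" for y
    proof -
      have dy: "d (Suc j) y \<in> carrier (P (Suc j))" by (rule linear_hom_closed[OF lin y])
      have "h \<zero>\<^bsub>P j\<^esub> = \<zero>\<^bsub>P (Suc j)\<^esub>" by (rule linear_hom_zero[OF mod mod kG_homD(1)[OF h]])
      then show ?thesis
        using linear_hom_closed[OF kG_homD(1)[OF E] dy] by (simp add: h'(2)[OF dy] \<phi>_def dd[OF y] a_minus_def)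
    qed
    then show "\<exists>h'. A (Suc j) h' \<and> Q j h h'"
      using h' by (auto simp: A_def Q_def \<phi>_def)
  qed
  then obtain h where "\<And>j. A j (h j)" "\<And>j. Q j (h j) (h (Suc j))" by blast
  then show thesis using that[of h] by (auto simp: A_def Q_def)
qed

section \<open>Averaging over a normal subgroup of order prime to the characteristic\<close>

context kG_module
begin

definition average :: "'g set \<Rightarrow> 'v \<Rightarrow> 'v" where
  "average N x = inv\<^bsub>K\<^esub> (add_pow K (card N) \<one>\<^bsub>K\<^esub>) \<odot>\<^bsub>V\<^esub> (\<Oplus>\<^bsub>V\<^esub>n \<in> N. act V n x)"

end

context
  fixes G :: "('g, 'm) monoid_scheme" and K :: "('k, 'n) ring_scheme" and N r
  assumes r: "ring_char K = r" and N: "N \<lhd> G" "\<not> r dvd card N"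
begin

text \<open>Conjugation by \<open>g\<close> permutes \<open>N\<close>, which gives equivariance
  under the whole group; left multiplication by \<open>b\<close> permutes \<open>N\<close>, which
  gives invariance of the sum. The group is later taken to be \<open>H\<close>.\<close>

lemma normal_finsum_act:
  assumes M: "kG_module G K M"
  shows "(\<lambda>x. \<Oplus>\<^bsub>M\<^esub>n \<in> N. act M n x) \<in> kG_hom G K M M"
    and "\<lbrakk>b \<in> N; x \<in> carrier M\<rbrakk> \<Longrightarrow> act M b (\<Oplus>\<^bsub>M\<^esub>n \<in> N. act M n x) = (\<Oplus>\<^bsub>M\<^esub>n \<in> N. act M n x)"
proof -
  interpret M: kG_module G K M by (rule M)
  interpret N: normal N G by (rule N)
  show "(\<lambda>x. \<Oplus>\<^bsub>M\<^esub>n \<in> N. act M n x) \<in> kG_hom G K M M"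
  proof (rule kG_homI)
    show "(\<lambda>x. \<Oplus>\<^bsub>M\<^esub>n \<in> N. act M n x) \<in> linear_hom K M M"
      by (intro linear_hom_finsum_fun M.module_V M.act_linear_hom) auto
    fix g x assume g: "g \<in> carrier G" and x: "x \<in> carrier M"
    define c where "c n = g \<otimes>\<^bsub>G\<^esub> n \<otimes>\<^bsub>G\<^esub> inv\<^bsub>G\<^esub> g" for n
    have c: "c n \<in> N" if "n \<in> N" for n using N.inv_op_closed2[OF g that] by (simp add: c_def)
    have im: "c ` N = N"
    proof (intro equalityI subsetI)
      fix n assume n: "n \<in> N"
      have "inv\<^bsub>G\<^esub> g \<otimes>\<^bsub>G\<^esub> n \<otimes>\<^bsub>G\<^esub> g \<in> N" using N.inv_op_closed1[OF g n] .
      moreover have "n = c (inv\<^bsub>G\<^esub> g \<otimes>\<^bsub>G\<^esub> n \<otimes>\<^bsub>G\<^esub> g)"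
        using g n by (simp add: c_def M.G.m_assoc) (simp add: M.G.m_assoc[symmetric])
      ultimately show "n \<in> c ` N" by (rule image_eqI[rotated])
    qed (use c in auto)
    have inj: "inj_on c N"
      using g by (auto simp: inj_on_def c_def)
    have "act M g (\<Oplus>\<^bsub>M\<^esub>n \<in> N. act M n x) = (\<Oplus>\<^bsub>M\<^esub>n \<in> N. act M g (act M n x))"
      using x by (intro linear_hom_finsum[OF M.module_V M.module_V M.act_linear_hom[OF g]]) (auto intro: M.act_closed)
    also have "\<dots> = (\<Oplus>\<^bsub>M\<^esub>n \<in> N. act M (c n) (act M g x))"
    proof (rule M.V.finsum_cong')
      show "(\<lambda>n. act M (c n) (act M g x)) \<in> N \<rightarrow> carrier M"
        by (intro Pi_I M.act_closed N.mem_carrier c g x)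
      fix n assume n: "n \<in> N"
      have "c n \<otimes>\<^bsub>G\<^esub> g = g \<otimes>\<^bsub>G\<^esub> n" using g n by (simp add: c_def M.G.m_assoc)
      then show "act M g (act M n x) = act M (c n) (act M g x)"
        using M.act_mult[of "c n" g x] M.act_mult[of g n x] g n x c by simp
    qed simp
    also have "\<dots> = (\<Oplus>\<^bsub>M\<^esub>n \<in> N. act M n (act M g x))"
      by (rule M.V.finsum_reindex[OF _ inj, of "\<lambda>n. act M n (act M g x)", unfolded im, symmetric])
        (intro Pi_I M.act_closed N.mem_carrier g x)
    finally show "(\<Oplus>\<^bsub>M\<^esub>n \<in> N. act M n (act M g x)) = act M g (\<Oplus>\<^bsub>M\<^esub>n \<in> N. act M n x)" by simp
  qed
  assume b: "b \<in> N" and x: "x \<in> carrier M"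
  have bG: "b \<in> carrier G" using b by simp
  have im: "(\<lambda>n. b \<otimes>\<^bsub>G\<^esub> n) ` N = N"
  proof (intro equalityI subsetI)
    fix n assume n: "n \<in> N"
    then show "n \<in> (\<lambda>n. b \<otimes>\<^bsub>G\<^esub> n) ` N"
      using b by (intro image_eqI[of _ _ "inv\<^bsub>G\<^esub> b \<otimes>\<^bsub>G\<^esub> n"]) (auto simp: M.G.m_assoc[symmetric])
  qed (use b in auto)
  have inj: "inj_on (\<lambda>n. b \<otimes>\<^bsub>G\<^esub> n) N" using b by (auto simp: inj_on_def)
  have "act M b (\<Oplus>\<^bsub>M\<^esub>n \<in> N. act M n x) = (\<Oplus>\<^bsub>M\<^esub>n \<in> N. act M b (act M n x))"
    using x by (intro linear_hom_finsum[OF M.module_V M.module_V M.act_linear_hom[OF bG]]) (auto intro: M.act_closed)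
  also have "\<dots> = (\<Oplus>\<^bsub>M\<^esub>n \<in> N. act M (b \<otimes>\<^bsub>G\<^esub> n) x)"
    using b x by (intro M.V.finsum_cong') (auto intro!: M.act_closed simp: M.act_mult)
  also have "\<dots> = (\<Oplus>\<^bsub>M\<^esub>n \<in> N. act M n x)"
    by (rule M.V.finsum_reindex[OF _ inj, of "\<lambda>n. act M n x", unfolded im, symmetric])
      (intro Pi_I M.act_closed N.mem_carrier x)
  finally show "act M b (\<Oplus>\<^bsub>M\<^esub>n \<in> N. act M n x) = (\<Oplus>\<^bsub>M\<^esub>n \<in> N. act M n x)" .
qed

lemma card_inverse:
  assumes "field K"
  shows "inv\<^bsub>K\<^esub> (add_pow K (card N) \<one>\<^bsub>K\<^esub>) \<in> carrier K"
    and "a \<in> carrier K \<Longrightarrow> inv\<^bsub>K\<^esub> (add_pow K (card N) \<one>\<^bsub>K\<^esub>) \<otimes>\<^bsub>K\<^esub> add_pow K (card N) a = a"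
proof -
  interpret K: field K by (rule assms)
  have "add_pow K (card N) \<one>\<^bsub>K\<^esub> \<noteq> \<zero>\<^bsub>K\<^esub>" using N(2) r by (simp add: K.add_pow_one_eq_zero_iff)
  then have u: "add_pow K (card N) \<one>\<^bsub>K\<^esub> \<in> Units K" by (simp add: K.field_Units)
  then show 1: "inv\<^bsub>K\<^esub> (add_pow K (card N) \<one>\<^bsub>K\<^esub>) \<in> carrier K" by simp
  assume a: "a \<in> carrier K"
  have "add_pow K (card N) a = add_pow K (card N) \<one>\<^bsub>K\<^esub> \<otimes>\<^bsub>K\<^esub> a"
    using a by (simp add: K.add_pow_ldistr)
  then show "inv\<^bsub>K\<^esub> (add_pow K (card N) \<one>\<^bsub>K\<^esub>) \<otimes>\<^bsub>K\<^esub> add_pow K (card N) a = a"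
    using a u 1 by (simp add: K.m_assoc[symmetric])
qed

lemma average_kG_hom:
  assumes M: "kG_module G K M"
  shows "kG_module.average K M N \<in> kG_hom G K M M"
proof -
  interpret M: kG_module G K M by (rule M)
  have "(\<lambda>x. inv\<^bsub>K\<^esub> (add_pow K (card N) \<one>\<^bsub>K\<^esub>) \<odot>\<^bsub>M\<^esub> x) \<in> kG_hom G K M M"
    using card_inverse[OF M.K.field_axioms]
    by (intro kG_homI linear_homI)
      (simp_all add: M.V.smult_r_distr M.V.smult_assoc1[symmetric] M.K.m_comm M.act_smult)
  from kG_hom_comp[OF normal_finsum_act(1)[OF M] this]
  show ?thesis by (simp add: M.average_def[abs_def])
qed

lemma kG_hom_average:
  assumes M: "kG_module G K M" and M': "kG_module G K M'" and \<phi>: "\<phi> \<in> kG_hom G K M M'" and x: "x \<in> carrier M"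
  shows "\<phi> (kG_module.average K M N x) = kG_module.average K M' N (\<phi> x)"
proof -
  interpret M: kG_module G K M by (rule M)
  interpret M': kG_module G K M' by (rule M')
  interpret N: normal N G by (rule N)
  have "\<phi> (\<Oplus>\<^bsub>M\<^esub>n \<in> N. act M n x) = (\<Oplus>\<^bsub>M'\<^esub>n \<in> N. \<phi> (act M n x))"
    using x by (intro linear_hom_finsum[OF M.module_V M'.module_V kG_homD(1)[OF \<phi>]] M.act_closed) auto
  also have "\<dots> = (\<Oplus>\<^bsub>M'\<^esub>n \<in> N. act M' n (\<phi> x))"
    using x linear_hom_closed[OF kG_homD(1)[OF \<phi>]]
    by (intro M'.V.finsum_cong') (auto intro!: M'.act_closed simp: kG_homD(2)[OF \<phi>])
  finally show ?thesis
    using x card_inverse[OF M.K.field_axioms]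
    by (simp add: M.average_def M'.average_def linear_hom_smult[OF kG_homD(1)[OF \<phi>]]
        linear_hom_closed[OF kG_homD(1)[OF normal_finsum_act(1)[OF M]]])
qed

text \<open>The functional takes the same value on all \<open>card N\<close> terms of the sum, and
  the factor in \<open>average\<close> cancels that number.\<close>

lemma average_invariant:
  assumes M: "kG_module G K M" and f: "f \<in> linear_hom K M (regular_module K)"
    and inv: "\<And>g x. \<lbrakk>g \<in> carrier G; x \<in> carrier M\<rbrakk> \<Longrightarrow> f (act M g x) = f x" and x: "x \<in> carrier M"
  shows "f (kG_module.average K M N x) = f x"
proof -
  interpret M: kG_module G K M by (rule M)
  interpret N: normal N G by (rule N)
  have fx: "f x \<in> carrier K" using linear_hom_closed[OF f x] by simp
  have "f (\<Oplus>\<^bsub>M\<^esub>n \<in> N. act M n x) = (\<Oplus>\<^bsub>regular_module K\<^esub>n \<in> N. f (act M n x))"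
    using x by (intro linear_hom_finsum[OF M.module_V M.module_regular f] M.act_closed) auto
  also have "\<dots> = (\<Oplus>\<^bsub>K\<^esub>n \<in> N. f x)"
    unfolding finsum_regular_module using fx x by (intro M.K.finsum_cong') (auto simp: inv)
  also have "\<dots> = add_pow K (card N) (f x)" using fx by (rule M.K.add.finprod_const)
  finally show ?thesis
    using x fx card_inverse[OF M.K.field_axioms]
    by (simp add: M.average_def linear_hom_smult[OF f] 
        linear_hom_closed[OF kG_homD(1)[OF normal_finsum_act(1)[OF M]]])
qed

end

text \<open>Evaluated at \<open>v\<close>, the sum of the translates of \<open>f\<close> is
  \<open>f\<close> of the sum of the translates of \<open>v\<close>, an \<open>N\<close>-fixed
  vector of \<open>V\<close> and therefore zero. The statement \<open>V^N = 0\<close> is thus used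
  on \<open>V\<close> itself, without passing to fixed points of the dual.\<close>

lemma average_dual_eq_zero:
  assumes H: "subgroup H G" and N: "N \<lhd> G\<lparr>carrier := H\<rparr>" "\<not> ring_char K dvd card N" and V: "kG_module G K V" and V0: "fixed_points V N = {\<zero>\<^bsub>V\<^esub>}" and f: "f \<in> carrier (dual_gmodule G K V)"
  shows "kG_module.average K (dual_gmodule G K V) N f = \<zero>\<^bsub>dual_gmodule G K V\<^esub>"
proof -
  interpret V: kG_module G K V by (rule V)
  interpret D: kG_module G K "dual_gmodule G K V" by (rule V.kG_module_dual)
  interpret N: normal N "G\<lparr>carrier := H\<rparr>" by (rule N)
  have VH: "kG_module (G\<lparr>carrier := H\<rparr>) K V" by (rule kG_module_subgroup[OF V H])
  have DH: "kG_module (G\<lparr>carrier := H\<rparr>) K (dual_gmodule G K V)" by (rule kG_module_subgroup[OF V.kG_module_dual H])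
  have NH: "n \<in> H" "n \<in> carrier G" if "n \<in> N" for n
    using N.subset that subgroup.subset[OF H] by auto
  have Ninv: "inv\<^bsub>G\<^esub> n \<in> N" if "n \<in> N" for n
    using N.m_inv_closed[OF that] V.G.m_inv_consistent[OF H NH(1)[OF that]] by simp
  let ?D = "dual_gmodule G K V"
  have fl: "f \<in> linear_hom K V (regular_module K)" using f by (simp add: V.dual_gmodule_simps)
  have sumD: "(\<Oplus>\<^bsub>?D\<^esub>n \<in> N. act ?D n f) \<in> carrier ?D"
    by (rule linear_hom_closed[OF kG_homD(1)[OF normal_finsum_act(1)[OF refl N DH]] f])
  have "(\<Oplus>\<^bsub>?D\<^esub>n \<in> N. act ?D n f) = \<zero>\<^bsub>?D\<^esub>"
  proof (rule extensionalityI[of _ "carrier V"])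
    fix v assume v: "v \<in> carrier V"
    \<comment> \<open>The dual action inverts group elements, so the sum over \<open>N\<close> has
      to be reindexed by inversion.\<close>
    have im: "(\<lambda>n. inv\<^bsub>G\<^esub> n) ` N = N"
    proof (intro equalityI subsetI)
      fix n assume "n \<in> N"
      then show "n \<in> (\<lambda>n. inv\<^bsub>G\<^esub> n) ` N" by (intro image_eqI[of _ _ "inv\<^bsub>G\<^esub> n"]) (auto simp: NH Ninv)
    qed (auto simp: Ninv)
    have inj: "inj_on (\<lambda>n. inv\<^bsub>G\<^esub> n) N" by (rule inj_on_inverseI[of _ "\<lambda>n. inv\<^bsub>G\<^esub> n"]) (simp add: NH)
    have "(\<Oplus>\<^bsub>?D\<^esub>n \<in> N. act ?D n f) v = (\<Oplus>\<^bsub>regular_module K\<^esub>n \<in> N. act ?D n f v)"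
      using f by (intro linear_hom_finsum[OF D.module_V V.module_regular V.dual_eval[OF v]] D.act_closed) (auto simp: NH)
    also have "\<dots> = (\<Oplus>\<^bsub>regular_module K\<^esub>n \<in> N. f (act V (inv\<^bsub>G\<^esub> n) v))"
      using v by (simp add: V.dual_gmodule_simps)
    also have "\<dots> = f (\<Oplus>\<^bsub>V\<^esub>n \<in> N. act V (inv\<^bsub>G\<^esub> n) v)"
      using v by (intro linear_hom_finsum[OF V.module_V V.module_regular fl, symmetric] V.act_closed) (auto simp: NH)
    also have "(\<Oplus>\<^bsub>V\<^esub>n \<in> N. act V (inv\<^bsub>G\<^esub> n) v) = (\<Oplus>\<^bsub>V\<^esub>n \<in> N. act V n v)"
      by (rule V.V.finsum_reindex[OF _ inj, of "\<lambda>n. act V n v", unfolded im, symmetric])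
        (intro Pi_I V.act_closed NH v)
    also have "\<dots> = \<zero>\<^bsub>V\<^esub>"
    proof -
      have "(\<Oplus>\<^bsub>V\<^esub>n \<in> N. act V n v) \<in> fixed_points V N"
        using normal_finsum_act[OF refl N VH] v
          linear_hom_closed[OF kG_homD(1)[OF normal_finsum_act(1)[OF refl N VH]]] by (auto simp: fixed_points_def)
      then show ?thesis using V0 by auto
    qed
    finally show "(\<Oplus>\<^bsub>?D\<^esub>n \<in> N. act ?D n f) v = \<zero>\<^bsub>?D\<^esub> v"
      using v by (simp only: V.dual_gmodule_simps(3) restrict_apply' regular_module_simps
          linear_hom_zero[OF V.module_V V.module_regular fl])
  qed (use sumD in \<open>auto simp: V.dual_gmodule_simps\<close>)
  then show ?thesis
    using card_inverse[OF refl N V.K.field_axioms] by (simp add: D.average_def)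
qed

lemma resolutionD:
  assumes "projective_resolution G K P d \<epsilon> M"
  shows "\<And>j. projective_gmodule G K (P j)" "\<And>j. kG_module G K (P j)" "\<And>j. d j \<in> kG_hom G K (P (Suc j)) (P j)"
    and "\<epsilon> \<in> kG_hom G K (P 0) M" "\<And>y. y \<in> carrier M \<Longrightarrow> \<exists>x \<in> carrier (P 0). \<epsilon> x = y"
    and "\<And>x. x \<in> carrier (P (Suc 0)) \<Longrightarrow> \<epsilon> (d 0 x) = \<zero>\<^bsub>M\<^esub>"
    and "\<And>x. \<lbrakk>x \<in> carrier (P 0); \<epsilon> x = \<zero>\<^bsub>M\<^esub>\<rbrakk> \<Longrightarrow> \<exists>y \<in> carrier (P (Suc 0)). d 0 y = x"
    and "\<And>j x. x \<in> carrier (P (Suc (Suc j))) \<Longrightarrow> d j (d (Suc j) x) = \<zero>\<^bsub>P j\<^esub>"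
    and "\<And>j x. \<lbrakk>x \<in> carrier (P (Suc j)); d j x = \<zero>\<^bsub>P j\<^esub>\<rbrakk> \<Longrightarrow> \<exists>y \<in> carrier (P (Suc (Suc j))). d (Suc j) y = x"
proof -
  have *: "\<And>n. projective_gmodule G K (P n)" "\<And>n. d n \<in> kG_hom G K (P (Suc n)) (P n)"
    "\<epsilon> \<in> kG_hom G K (P 0) M" "\<epsilon> ` carrier (P 0) = carrier M"
    "d 0 ` carrier (P (Suc 0)) = {x \<in> carrier (P 0). \<epsilon> x = \<zero>\<^bsub>M\<^esub>}"
    "\<And>n. d (Suc n) ` carrier (P (Suc (Suc n))) = {x \<in> carrier (P (Suc n)). d n x = \<zero>\<^bsub>P n\<^esub>}"
    using assms unfolding projective_resolution_def by auto
  show "\<And>j. projective_gmodule G K (P j)" "\<And>j. d j \<in> kG_hom G K (P (Suc j)) (P j)" "\<epsilon> \<in> kG_hom G K (P 0) M"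
    by (fact *)+
  show "\<And>j. kG_module G K (P j)" using *(1) by (auto simp: projective_gmodule_def)
  show "\<And>y. y \<in> carrier M \<Longrightarrow> \<exists>x \<in> carrier (P 0). \<epsilon> x = y"
    "\<And>x. x \<in> carrier (P (Suc 0)) \<Longrightarrow> \<epsilon> (d 0 x) = \<zero>\<^bsub>M\<^esub>"
    "\<And>x. \<lbrakk>x \<in> carrier (P 0); \<epsilon> x = \<zero>\<^bsub>M\<^esub>\<rbrakk> \<Longrightarrow> \<exists>y \<in> carrier (P (Suc 0)). d 0 y = x"
    using *(4,5) by (auto simp: set_eq_iff image_iff) metis+
  show "\<And>j x. x \<in> carrier (P (Suc (Suc j))) \<Longrightarrow> d j (d (Suc j) x) = \<zero>\<^bsub>P j\<^esub>"
    "\<And>j x. \<lbrakk>x \<in> carrier (P (Suc j)); d j x = \<zero>\<^bsub>P j\<^esub>\<rbrakk> \<Longrightarrow> \<exists>y \<in> carrier (P (Suc (Suc j))). d (Suc j) y = x"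
    using *(6) by (auto simp: set_eq_iff image_iff) metis
qed

text \<open>
  Averaging over \<open>N\<close> is a chain map of the resolution lifting the zero map of \<open>V\<^sup>*\<close>, hence
  \<open>H\<close>-equivariantly homotopic to zero; on \<open>H\<close>-invariant functionals it is the identity.
\<close>

lemma invariant_functionals_exact:
  fixes G :: "('g, 'm) monoid_scheme" and H :: "'g set" and K :: "('k, 'n) ring_scheme"
    and V :: "('k, 'v, 'g) gmodule" and P :: "nat \<Rightarrow> ('k, 'p, 'g) gmodule"
  assumes fin: "finite (carrier G)" and r: "ring_char K = r" and H: "subgroup H G"
    and V: "kG_module G K V" and res: "projective_resolution G K P d \<epsilon> (dual_gmodule G K V)"
    and N: "N \<lhd> G\<lparr>carrier := H\<rparr>" "\<not> r dvd card N" and V0: "fixed_points V N = {\<zero>\<^bsub>V\<^esub>}"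
    and f: "f \<in> linear_hom K (P n) (regular_module K)"
    and inv: "\<And>h x. \<lbrakk>h \<in> H; x \<in> carrier (P n)\<rbrakk> \<Longrightarrow> f (act (P n) h x) = f x"
    and fd: "\<And>x. x \<in> carrier (P (Suc n)) \<Longrightarrow> f (d n x) = \<zero>\<^bsub>K\<^esub>"
  shows "n = 0 \<Longrightarrow> x \<in> carrier (P n) \<Longrightarrow> f x = \<zero>\<^bsub>K\<^esub>"
    and "n = Suc m \<Longrightarrow> \<exists>f' \<in> linear_hom K (P m) (regular_module K).
      (\<forall>h \<in> H. \<forall>x \<in> carrier (P m). f' (act (P m) h x) = f' x) \<and> (\<forall>x \<in> carrier (P n). f x = f' (d m x))"
proof -
  interpret V: kG_module G K V by (rule V)
  interpret D: kG_module G K "dual_gmodule G K V" by (rule V.kG_module_dual)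
  interpret H: subgroup H G by (rule H)
  note resD = resolutionD[OF res]
  let ?H = "G\<lparr>carrier := H\<rparr>"
  have finH: "finite (carrier ?H)" using fin H.subset finite_subset by auto
  have PH: "kG_module ?H K (P j)" for j by (rule kG_module_subgroup[OF resD(2) H])
  have VH: "kG_module ?H K V" by (rule kG_module_subgroup[OF V H])
  have homH: "\<phi> \<in> kG_hom ?H K A B" if "\<phi> \<in> kG_hom G K A B" for \<phi> and A :: "('k, 'a, 'g) gmodule" and B :: "('k, 'b, 'g) gmodule"
    using that H.subset by (auto simp: kG_hom_def)
  have mod: "module K (P j)" for j using kG_module.module_V[OF PH] .
  define E where "E j = kG_module.average K (P j) N" for j
  note avg = average_kG_hom[OF r N PH, folded E_def] and lin = kG_homD(1)[OF resD(3)]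
  have Ecl: "E j x \<in> carrier (P j)" if "x \<in> carrier (P j)" for j x
    by (rule linear_hom_closed[OF kG_homD(1)[OF avg] that])
  have fE: "f (E n x) = f x" if "x \<in> carrier (P n)" for x
    unfolding E_def using average_invariant[OF r N PH f _ that] inv by simp
  obtain h where h: "\<And>j. h j \<in> kG_hom ?H K (P j) (P (Suc j))"
    and h0: "\<And>x. x \<in> carrier (P 0) \<Longrightarrow> d 0 (h 0 x) = E 0 x"
    and hS: "\<And>j x. x \<in> carrier (P (Suc j)) \<Longrightarrow>
      d (Suc j) (h (Suc j) x) = E (Suc j) x \<ominus>\<^bsub>P (Suc j)\<^esub> h j (d j x)"
  proof (rule null_homotopy[of ?H K P d E])
    show "has_trace ?H K (P j)" for j
      by (rule projective_has_trace[OF V.G.group_axioms fin V.K.field_axioms H resD(1)])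
    show "d j (E (Suc j) x) = E j (d j x)" if "x \<in> carrier (P (Suc j))" for j x
      unfolding E_def by (rule kG_hom_average[OF r N PH PH homH[OF resD(3)] that])
    \<comment> \<open>\<open>\<epsilon>\<close> commutes with averaging, and averages vanish in the
      dual of \<open>V\<close>; so \<open>E 0\<close> maps into the kernel of
      \<open>\<epsilon>\<close>, which is the image of \<open>d 0\<close>.\<close>
    show "\<exists>y \<in> carrier (P (Suc 0)). d 0 y = E 0 x" if x: "x \<in> carrier (P 0)" for x
    proof (rule resD(7)[OF Ecl[OF x]])
      have DH: "kG_module ?H K (dual_gmodule G K V)" by (rule kG_module_subgroup[OF V.kG_module_dual H])
      have "\<epsilon> (E 0 x) = kG_module.average K (dual_gmodule G K V) N (\<epsilon> x)"
        unfolding E_def by (rule kG_hom_average[OF r N PH DH homH[OF resD(4)] x])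
      also have "\<dots> = \<zero>\<^bsub>dual_gmodule G K V\<^esub>"
        using average_dual_eq_zero[OF H N(1) _ V V0] N(2) r linear_hom_closed[OF kG_homD(1)[OF resD(4)] x] by simp
      finally show "\<epsilon> (E 0 x) = \<zero>\<^bsub>dual_gmodule G K V\<^esub>" .
    qed
  qed (use PH homH[OF resD(3)] resD(8,9) avg in auto)
  \<comment> \<open>In degree 0 the homotopy reads \<open>E 0 = d 0 h 0\<close>, so f = f E = f d h
    = 0.\<close>
  show "f x = \<zero>\<^bsub>K\<^esub>" if "n = 0" "x \<in> carrier (P n)"
    using that fE[of x] h0[of x] fd[of "h 0 x"] linear_hom_closed[OF kG_homD(1)[OF h]] by simp
  show "\<exists>f' \<in> linear_hom K (P m) (regular_module K).
      (\<forall>h \<in> H. \<forall>x \<in> carrier (P m). f' (act (P m) h x) = f' x) \<and> (\<forall>x \<in> carrier (P n). f x = f' (d m x))"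
    if n: "n = Suc m"
  \<comment> \<open>The witness comes from the homotopy identity: f = f E = f d h + f h d, whose
    first summand is zero because \<open>f\<close> vanishes on boundaries.\<close>
  proof (intro bexI[of _ "\<lambda>x. f (h m x)"] conjI ballI)
    note hm = h[of m, folded n] and hl = kG_homD(1)[OF h]
    show "(\<lambda>x. f (h m x)) \<in> linear_hom K (P m) (regular_module K)"
      by (rule linear_hom_comp[OF kG_homD(1)[OF hm] f])
    show "f (h m (act (P m) g x)) = f (h m x)" if "g \<in> H" "x \<in> carrier (P m)" for g x
      using that kG_homD(2)[OF hm] inv linear_hom_closed[OF kG_homD(1)[OF hm]] by simp
    fix x assume x: "x \<in> carrier (P n)"
    have dx: "d m x \<in> carrier (P m)" using linear_hom_closed[OF lin] x n by auto
    have c: "h m (d m x) \<in> carrier (P n)" by (rule linear_hom_closed[OF kG_homD(1)[OF hm] dx])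
    have "h n x \<in> carrier (P (Suc n))" by (rule linear_hom_closed[OF hl x])
    then have "f (d n (h n x)) = \<zero>\<^bsub>K\<^esub>" by (rule fd)
    moreover have "d n (h n x) = E n x \<ominus>\<^bsub>P n\<^esub> h m (d m x)" using hS[of x m] x n by simp
    ultimately have "f x \<ominus>\<^bsub>K\<^esub> f (h m (d m x)) = \<zero>\<^bsub>K\<^esub>"
      using linear_hom_minus[OF mod V.module_regular f Ecl[OF x] c] fE[OF x] by simp
    moreover have "f x \<in> carrier K" "f (h m (d m x)) \<in> carrier K"
      using linear_hom_closed[OF f] x c by auto
    ultimately show "f x = f (h m (d m x))" by simp
  qed
qed


section \<open>Quotients and permutation modules\<close>

context kG_module
begin

lemma fixed_points_submodule: "submodule (fixed_points V (carrier G)) K V"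
  by (rule V.submoduleI')
    (auto simp: fixed_points_def act_add act_smult linear_hom_zero[OF module_V module_V act_linear_hom])

context
  fixes S
  assumes S: "submodule S K V" and S_act: "\<And>g s. \<lbrakk>g \<in> carrier G; s \<in> S\<rbrakk> \<Longrightarrow> act V g s \<in> S"
begin

lemma quot_gmodule_simps:
  "carrier (quot_gmodule V S) = carrier (quot_module V S)"
  "ring.add (quot_gmodule V S) = ring.add (quot_module V S)"
  "\<zero>\<^bsub>quot_gmodule V S\<^esub> = S"
  "smult (quot_gmodule V S) = smult (quot_module V S)"
  "\<lbrakk>g \<in> carrier G; x \<in> carrier V\<rbrakk> \<Longrightarrow> act (quot_gmodule V S) g (S +>\<^bsub>V\<^esub> x) = S +>\<^bsub>V\<^esub> (act V g x)"
proof -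
  assume g: "g \<in> carrier G" and x: "x \<in> carrier V"
  have "(\<Union>y \<in> S +>\<^bsub>V\<^esub> x. S +>\<^bsub>V\<^esub> (act V g y)) = S +>\<^bsub>V\<^esub> (act V g x)"
  proof (rule quot_module_map[OF module_V S x])
    fix y assume y: "y \<in> carrier V" "x \<ominus>\<^bsub>V\<^esub> y \<in> S"
    then show "act V g x \<ominus>\<^bsub>V\<^esub> act V g y \<in> S"
      using S_act[OF g y(2)] linear_hom_minus[OF module_V module_V act_linear_hom[OF g] x] by simp
  qed (rule act_closed[OF g])
  then show "act (quot_gmodule V S) g (S +>\<^bsub>V\<^esub> x) = S +>\<^bsub>V\<^esub> (act V g x)"
    by (simp add: quot_gmodule_def)
qed (simp_all add: quot_gmodule_def)

lemma quot_proj: "(\<lambda>x. S +>\<^bsub>V\<^esub> x) \<in> kG_hom G K V (quot_gmodule V S)"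
  by (intro kG_homI linear_homI)
    (simp_all add: quot_gmodule_simps quot_module_carrierI[OF module_V S] quot_module_add[OF module_V S]
      quot_module_smult[OF module_V S] del: quot_module_simps)

lemma quot_proj_eq_zero_iff: "x \<in> carrier V \<Longrightarrow> S +>\<^bsub>V\<^esub> x = \<zero>\<^bsub>quot_gmodule V S\<^esub> \<longleftrightarrow> x \<in> S"
proof -
  assume x: "x \<in> carrier V"
  interpret S: abelian_subgroup S V by (rule submodule_abelian_subgroup[OF module_V S])
  have "S = S +>\<^bsub>V\<^esub> \<zero>\<^bsub>V\<^esub>" using S.a_rcos_const S.zero_closed by auto
  moreover have "x \<ominus>\<^bsub>V\<^esub> \<zero>\<^bsub>V\<^esub> = x" using x by simp
  ultimately show ?thesis using coset_eq_iff[OF module_V S x, of "\<zero>\<^bsub>V\<^esub>"] x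
    by (simp add: quot_gmodule_simps)
qed

lemma kG_module_quot: "kG_module G K (quot_gmodule V S)"
proof (intro kG_module.intro kG_module_axioms.intro G.group_axioms K.field_axioms)
  let ?Q = "quot_gmodule V S"
  note E = quot_module_carrierE[OF module_V S]
  note lin = kG_homD(1)[OF quot_proj]
  show "module K ?Q"
    by (rule module_cong[OF module_quot_module[OF module_V S]]) (simp_all add: quot_gmodule_def)
  fix g u assume g: "g \<in> carrier G" and "u \<in> carrier ?Q"
  then obtain x where x: "x \<in> carrier V" "u = S +>\<^bsub>V\<^esub> x" using E by (auto simp: quot_gmodule_simps(1))
  show "act ?Q g u \<in> carrier ?Q"
    using g x linear_hom_closed[OF lin act_closed[OF g]] by (simp add: quot_gmodule_simps(5))
  show "act ?Q g (a \<odot>\<^bsub>?Q\<^esub> u) = a \<odot>\<^bsub>?Q\<^esub> act ?Q g u" if "a \<in> carrier K" for a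
    using g x that act_closed[OF g]
    by (simp add: quot_gmodule_simps(5) linear_hom_smult[OF lin, symmetric] act_smult)
  show "act ?Q (g \<otimes>\<^bsub>G\<^esub> h) u = act ?Q g (act ?Q h u)" if "h \<in> carrier G" for h
    using g x that act_closed by (simp add: quot_gmodule_simps(5) act_mult)
  fix w assume "w \<in> carrier ?Q"
  then obtain y where y: "y \<in> carrier V" "w = S +>\<^bsub>V\<^esub> y" using E by (auto simp: quot_gmodule_simps(1))
  show "act ?Q g (u \<oplus>\<^bsub>?Q\<^esub> w) = act ?Q g u \<oplus>\<^bsub>?Q\<^esub> act ?Q g w"
    using g x y act_closed[OF g]
    by (simp add: quot_gmodule_simps(5) linear_hom_add[OF lin, symmetric] act_add)
next
  let ?Q = "quot_gmodule V S"
  fix u assume "u \<in> carrier ?Q"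
  then obtain x where x: "x \<in> carrier V" "u = S +>\<^bsub>V\<^esub> x"
    using quot_module_carrierE[OF module_V S] by (auto simp: quot_gmodule_simps(1))
  then show "act ?Q \<one>\<^bsub>G\<^esub> u = u" by (simp add: quot_gmodule_simps(5) act_one)
qed

end

end

section \<open>The permutation module and Frobenius reciprocity\<close>

context
  fixes G :: "('g, 'm) monoid_scheme" and K :: "('k, 'n) ring_scheme" and H
  assumes G: "group G" and K: "field K" and H: "subgroup H G"
begin

interpretation G: group G by (rule G)
interpretation K: field K by (rule K)
interpretation H: subgroup H G by (rule H)

lemma perm_gmodule_simps:
  "carrier (perm_gmodule G K H) = (lcosets\<^bsub>G\<^esub> H \<rightarrow>\<^sub>E carrier K)"
  "f \<oplus>\<^bsub>perm_gmodule G K H\<^esub> f' = (\<lambda>C \<in> lcosets\<^bsub>G\<^esub> H. f C \<oplus>\<^bsub>K\<^esub> f' C)"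
  "\<zero>\<^bsub>perm_gmodule G K H\<^esub> = (\<lambda>C \<in> lcosets\<^bsub>G\<^esub> H. \<zero>\<^bsub>K\<^esub>)"
  "a \<odot>\<^bsub>perm_gmodule G K H\<^esub> f = (\<lambda>C \<in> lcosets\<^bsub>G\<^esub> H. a \<otimes>\<^bsub>K\<^esub> f C)"
  "act (perm_gmodule G K H) g f = (\<lambda>C \<in> lcosets\<^bsub>G\<^esub> H. f (inv\<^bsub>G\<^esub> g <#\<^bsub>G\<^esub> C))"
  by (simp_all add: perm_gmodule_def)

lemma lcosetI: "a \<in> carrier G \<Longrightarrow> a <#\<^bsub>G\<^esub> H \<in> lcosets\<^bsub>G\<^esub> H"
  by (auto simp: LCOSETS_def)

lemma lcosetE:
  assumes "C \<in> lcosets\<^bsub>G\<^esub> H"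
  obtains a where "a \<in> carrier G" "C = a <#\<^bsub>G\<^esub> H"
  using assms by (auto simp: LCOSETS_def)

lemma lcoset_translate:
  "\<lbrakk>g \<in> carrier G; a \<in> carrier G\<rbrakk> \<Longrightarrow> g <#\<^bsub>G\<^esub> (a <#\<^bsub>G\<^esub> H) = (g \<otimes>\<^bsub>G\<^esub> a) <#\<^bsub>G\<^esub> H"
  by (rule G.lcos_m_assoc[OF H.subset])

lemma lcoset_H: "h \<in> H \<Longrightarrow> h <#\<^bsub>G\<^esub> H = H"
  using G.coset_join3[OF _ H] H.subset by auto

lemma H_in_lcosets: "H \<in> lcosets\<^bsub>G\<^esub> H"
  using lcosetI[of "\<one>\<^bsub>G\<^esub>"] lcoset_H[of "\<one>\<^bsub>G\<^esub>"] by simp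

lemma lcoset_act: "\<lbrakk>g \<in> carrier G; C \<in> lcosets\<^bsub>G\<^esub> H\<rbrakk> \<Longrightarrow> g <#\<^bsub>G\<^esub> C \<in> lcosets\<^bsub>G\<^esub> H"
  by (auto elim!: lcosetE simp: lcoset_translate lcosetI)

lemma kG_module_perm: "kG_module G K (perm_gmodule G K H)"
proof (intro kG_module.intro kG_module_axioms.intro G K)
  show "module K (perm_gmodule G K H)"
    unfolding perm_gmodule_def
    by (intro module_with_action module_pointwise_module module_regular_module K.is_cring) auto
next
  fix g f assume "g \<in> carrier G" "f \<in> carrier (perm_gmodule G K H)"
  then show "act (perm_gmodule G K H) g f \<in> carrier (perm_gmodule G K H)" by (auto simp: perm_gmodule_simps lcoset_act)
next
  fix f assume f: "f \<in> carrier (perm_gmodule G K H)"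
  have "\<one>\<^bsub>G\<^esub> <#\<^bsub>G\<^esub> C = C" if "C \<in> lcosets\<^bsub>G\<^esub> H" for C
    using that by (auto elim!: lcosetE simp: lcoset_translate)
  then show "act (perm_gmodule G K H) \<one>\<^bsub>G\<^esub> f = f"
    using f by (auto simp: perm_gmodule_simps PiE_def extensional_def fun_eq_iff)
next
  fix g h f assume gh: "g \<in> carrier G" "h \<in> carrier G"
  have "inv\<^bsub>G\<^esub> (g \<otimes>\<^bsub>G\<^esub> h) <#\<^bsub>G\<^esub> C = inv\<^bsub>G\<^esub> h <#\<^bsub>G\<^esub> (inv\<^bsub>G\<^esub> g <#\<^bsub>G\<^esub> C)" if "C \<in> lcosets\<^bsub>G\<^esub> H" for C
    using that gh by (auto elim!: lcosetE simp: lcoset_translate G.inv_mult_group G.m_assoc)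
  then show "act (perm_gmodule G K H) (g \<otimes>\<^bsub>G\<^esub> h) f = act (perm_gmodule G K H) g (act (perm_gmodule G K H) h f)"
    using gh by (auto simp: perm_gmodule_simps lcoset_act fun_eq_iff)
qed (auto simp: perm_gmodule_simps lcoset_act fun_eq_iff)

lemma perm_eval: "C \<in> lcosets\<^bsub>G\<^esub> H \<Longrightarrow> (\<lambda>f. f C) \<in> linear_hom K (perm_gmodule G K H) (regular_module K)"
  by (intro linear_homI) (auto simp: perm_gmodule_simps)

text \<open>\<open>G\<close> is transitive on the cosets, so a fixed function is constant. This is
  the copy of the trivial module inside \<open>L\<close>.\<close>

lemma perm_fixed_points:
  "fixed_points (perm_gmodule G K H) (carrier G) = {\<lambda>C \<in> lcosets\<^bsub>G\<^esub> H. c | c. c \<in> carrier K}"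
proof (intro equalityI subsetI)
  fix f assume f: "f \<in> fixed_points (perm_gmodule G K H) (carrier G)"
  then have fL: "f \<in> lcosets\<^bsub>G\<^esub> H \<rightarrow>\<^sub>E carrier K" and fx: "\<And>g. g \<in> carrier G \<Longrightarrow> act (perm_gmodule G K H) g f = f"
    by (auto simp: fixed_points_def perm_gmodule_simps)
  have "f C = f H" if C: "C \<in> lcosets\<^bsub>G\<^esub> H" for C
  proof -
    obtain a where a: "a \<in> carrier G" "C = a <#\<^bsub>G\<^esub> H" using C by (rule lcosetE)
    have "f C = act (perm_gmodule G K H) a f C" using fx[OF a(1)] by simp
    also have "\<dots> = f H" using a C lcoset_H[of "\<one>\<^bsub>G\<^esub>"] by (simp add: perm_gmodule_simps lcoset_translate)
    finally show ?thesis .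
  qed
  then have "f = (\<lambda>C \<in> lcosets\<^bsub>G\<^esub> H. f H)"
    using fL by (auto simp: PiE_def extensional_def fun_eq_iff)
  then show "f \<in> {\<lambda>C \<in> lcosets\<^bsub>G\<^esub> H. c | c. c \<in> carrier K}"
    using fL H_in_lcosets by blast
qed (auto simp: fixed_points_def perm_gmodule_simps lcoset_act fun_eq_iff)

text \<open>Frobenius reciprocity: reading off the coefficient at the coset \<open>H\<close> turns
  equivariant maps into \<open>L\<close> into \<open>H\<close>-invariant functionals, to which
  \<open>invariant_functionals_exact\<close> applies. The answer is carried back by F'(y)(aH) =
  f'(a^{-1} y).\<close>

lemma Hom_perm_exact:
  fixes V :: "('k, 'v, 'g) gmodule" and P :: "nat \<Rightarrow> ('k, 'p, 'g) gmodule"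
  assumes fin: "finite (carrier G)" and r: "ring_char K = r"
    and V: "kG_module G K V" and res: "projective_resolution G K P d \<epsilon> (dual_gmodule G K V)"
    and N: "N \<lhd> G\<lparr>carrier := H\<rparr>" "\<not> r dvd card N" and V0: "fixed_points V N = {\<zero>\<^bsub>V\<^esub>}"
    and F: "F \<in> kG_hom G K (P n) (perm_gmodule G K H)"
    and Fd: "\<And>x. x \<in> carrier (P (Suc n)) \<Longrightarrow> F (d n x) = \<zero>\<^bsub>perm_gmodule G K H\<^esub>"
  shows "n = 0 \<Longrightarrow> x \<in> carrier (P n) \<Longrightarrow> F x = \<zero>\<^bsub>perm_gmodule G K H\<^esub>"
    and "n = Suc m \<Longrightarrow> \<exists>F' \<in> kG_hom G K (P m) (perm_gmodule G K H). \<forall>x \<in> carrier (P n). F x = F' (d m x)"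
proof -
  note resD = resolutionD[OF res]
  interpret L: kG_module G K "perm_gmodule G K H" by (rule kG_module_perm)
  interpret P: kG_module G K "P n" by (rule resD(2))
  define f where "f x = F x H" for x
  have Fcl: "F x \<in> lcosets\<^bsub>G\<^esub> H \<rightarrow>\<^sub>E carrier K" if "x \<in> carrier (P n)" for x
    using linear_hom_closed[OF kG_homD(1)[OF F] that] by (simp add: perm_gmodule_simps)
  have f: "f \<in> linear_hom K (P n) (regular_module K)"
    unfolding f_def by (rule linear_hom_comp[OF kG_homD(1)[OF F] perm_eval[OF H_in_lcosets]])
  \<comment> \<open>By equivariance the coefficient at \<open>H\<close> determines all the others,
    so \<open>F\<close> can be recovered from \<open>f\<close>.\<close>
  have f_act: "f (act (P n) (inv\<^bsub>G\<^esub> a) x) = F x (a <#\<^bsub>G\<^esub> H)" if "a \<in> carrier G" "x \<in> carrier (P n)" for a x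
    using that H_in_lcosets kG_homD(2)[OF F, of "inv\<^bsub>G\<^esub> a" x] by (simp add: f_def perm_gmodule_simps)
  have inv: "f (act (P n) h x) = f x" if h: "h \<in> H" and x: "x \<in> carrier (P n)" for h x
    using f_act[of "inv\<^bsub>G\<^esub> h" x] h x lcoset_H[of "inv\<^bsub>G\<^esub> h"] by (simp add: f_def)
  have fd: "f (d n x) = \<zero>\<^bsub>K\<^esub>" if "x \<in> carrier (P (Suc n))" for x
    using Fd[OF that] H_in_lcosets by (simp add: f_def perm_gmodule_simps)
  note exact = invariant_functionals_exact[OF fin r H V res N V0 f inv fd]
  show "F x = \<zero>\<^bsub>perm_gmodule G K H\<^esub>" if n: "n = 0" and x: "x \<in> carrier (P n)"
  proof (rule extensionalityI[of _ "lcosets\<^bsub>G\<^esub> H"])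
    show "F x \<in> extensional (lcosets\<^bsub>G\<^esub> H)" using Fcl[OF x] by (simp add: PiE_def)
    fix C assume C: "C \<in> lcosets\<^bsub>G\<^esub> H"
    then obtain a where a: "a \<in> carrier G" "C = a <#\<^bsub>G\<^esub> H" by (rule lcosetE)
    have "f (act (P n) (inv\<^bsub>G\<^esub> a) x) = \<zero>\<^bsub>K\<^esub>"
      using exact(1)[OF _ _ _ n P.act_closed] a x by simp
    then show "F x C = \<zero>\<^bsub>perm_gmodule G K H\<^esub> C" using f_act[OF a(1) x] a C by (simp add: perm_gmodule_simps)
  qed (simp add: perm_gmodule_simps)
  assume n: "n = Suc m"
  obtain f' where f': "f' \<in> linear_hom K (P m) (regular_module K)"
    and inv': "\<And>h x. \<lbrakk>h \<in> H; x \<in> carrier (P m)\<rbrakk> \<Longrightarrow> f' (act (P m) h x) = f' x"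
    and ff': "\<And>x. x \<in> carrier (P n) \<Longrightarrow> f x = f' (d m x)"
    using exact(2)[OF _ _ _ n] by blast
  interpret Pm: kG_module G K "P m" by (rule resD(2))
  define rep where "rep C = (SOME a. a \<in> carrier G \<and> C = a <#\<^bsub>G\<^esub> H)" for C
  have rep: "rep C \<in> carrier G" "C = rep C <#\<^bsub>G\<^esub> H" if "C \<in> lcosets\<^bsub>G\<^esub> H" for C
    using that someI_ex[of "\<lambda>a. a \<in> carrier G \<and> C = a <#\<^bsub>G\<^esub> H"] by (auto simp: rep_def elim: lcosetE)
  define F' where "F' y = (\<lambda>C \<in> lcosets\<^bsub>G\<^esub> H. f' (act (P m) (inv\<^bsub>G\<^esub> (rep C)) y))" for y
  \<comment> \<open>Two representatives of a coset differ by an element of \<open>H\<close>, under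
    which \<open>f'\<close> is invariant, so the choice made by \<open>rep\<close> is
    immaterial.\<close>
  have F'_eq: "F' y (a <#\<^bsub>G\<^esub> H) = f' (act (P m) (inv\<^bsub>G\<^esub> a) y)" if a: "a \<in> carrier G" and y: "y \<in> carrier (P m)" for a y
  proof -
    define b where "b = rep (a <#\<^bsub>G\<^esub> H)"
    have b: "b \<in> carrier G" "a <#\<^bsub>G\<^esub> H = b <#\<^bsub>G\<^esub> H" using rep[OF lcosetI[OF a]] by (auto simp: b_def)
    have "b \<in> a <#\<^bsub>G\<^esub> H" using b G.lcos_self[OF b(1) H] by simp
    then obtain h where h: "h \<in> H" "b = a \<otimes>\<^bsub>G\<^esub> h" by (auto simp: l_coset_def)
    have "act (P m) (inv\<^bsub>G\<^esub> b) y = act (P m) (inv\<^bsub>G\<^esub> h) (act (P m) (inv\<^bsub>G\<^esub> a) y)"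
      using h a y by (simp add: G.inv_mult_group Pm.act_mult)
    then show ?thesis
      using h a y inv' lcosetI[OF a] by (simp add: F'_def b_def[symmetric] Pm.act_closed)
  qed
  have F'cl: "F' y \<in> carrier (perm_gmodule G K H)" if "y \<in> carrier (P m)" for y
  proof -
    have "f' (act (P m) (inv\<^bsub>G\<^esub> (rep C)) y) \<in> carrier K" if "C \<in> lcosets\<^bsub>G\<^esub> H" for C
      using linear_hom_closed[OF f' Pm.act_closed[OF _ \<open>y \<in> carrier (P m)\<close>]] rep(1)[OF that] by simp
    then show ?thesis by (auto simp: F'_def perm_gmodule_simps)
  qed
  have "F' \<in> kG_hom G K (P m) (perm_gmodule G K H)"
  proof (intro kG_homI linear_homI F'cl)
    fix x y assume "x \<in> carrier (P m)" "y \<in> carrier (P m)"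
    then show "F' (x \<oplus>\<^bsub>P m\<^esub> y) = F' x \<oplus>\<^bsub>perm_gmodule G K H\<^esub> F' y"
      using linear_hom_add[OF f'] rep(1) by (auto simp: F'_def perm_gmodule_simps Pm.act_add Pm.act_closed)
  next
    fix a x assume "a \<in> carrier K" "x \<in> carrier (P m)"
    then show "F' (a \<odot>\<^bsub>P m\<^esub> x) = a \<odot>\<^bsub>perm_gmodule G K H\<^esub> F' x"
      using linear_hom_smult[OF f'] rep(1) by (auto simp: F'_def perm_gmodule_simps Pm.act_smult Pm.act_closed)
  next
    fix g x assume g: "g \<in> carrier G" and x: "x \<in> carrier (P m)"
    show "F' (act (P m) g x) = act (perm_gmodule G K H) g (F' x)"
    proof (rule extensionalityI[of _ "lcosets\<^bsub>G\<^esub> H"])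
      fix C assume C: "C \<in> lcosets\<^bsub>G\<^esub> H"
      then obtain a where a: "a \<in> carrier G" "C = a <#\<^bsub>G\<^esub> H" by (rule lcosetE)
      show "F' (act (P m) g x) C = act (perm_gmodule G K H) g (F' x) C"
        using g x a C F'_eq[of a "act (P m) g x"] F'_eq[of "inv\<^bsub>G\<^esub> g \<otimes>\<^bsub>G\<^esub> a" x]
        by (simp add: perm_gmodule_simps lcoset_translate Pm.act_closed G.inv_mult_group Pm.act_mult)
    qed (simp_all add: F'_def perm_gmodule_simps)
  qed
  moreover have "F x = F' (d m x)" if x: "x \<in> carrier (P n)" for x
  proof (rule extensionalityI[of _ "lcosets\<^bsub>G\<^esub> H"])
    show "F x \<in> extensional (lcosets\<^bsub>G\<^esub> H)" using Fcl[OF x] by (simp add: PiE_def)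
    fix C assume C: "C \<in> lcosets\<^bsub>G\<^esub> H"
    then obtain a where a: "a \<in> carrier G" "C = a <#\<^bsub>G\<^esub> H" by (rule lcosetE)
    have dm: "d m \<in> kG_hom G K (P n) (P m)" using resD(3)[of m] n by simp
    have "F' (d m x) C = f' (act (P m) (inv\<^bsub>G\<^esub> a) (d m x))"
      using F'_eq[OF a(1) linear_hom_closed[OF kG_homD(1)[OF dm] x]] a by simp
    also have "\<dots> = f (act (P n) (inv\<^bsub>G\<^esub> a) x)"
      using a x by (simp add: ff' P.act_closed kG_homD(2)[OF dm])
    finally show "F x C = F' (d m x) C" using f_act[OF a(1) x] a by simp
  qed (simp add: F'_def)
  ultimately show "\<exists>F' \<in> kG_hom G K (P m) (perm_gmodule G K H). \<forall>x \<in> carrier (P n). F x = F' (d m x)" by blast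
qed

end


section \<open>Dimension shifting\<close>

lemma submodule_vimage:
  assumes M: "module K M" and N: "module K N" and f: "f \<in> linear_hom K M N" and T: "submodule T K N"
  shows "submodule {x \<in> carrier M. f x \<in> T} K M"
proof -
  interpret M: module K M by (rule M)
  interpret N: module K N by (rule N)
  have "\<zero>\<^bsub>N\<^esub> \<in> T" using submodule.axioms(1)[OF T] subgroup.one_closed by fastforce
  then show ?thesis
    using N.submoduleE[OF T]
    by (intro M.submoduleI')
      (auto simp: linear_hom_zero[OF M N f] linear_hom_add[OF f] linear_hom_smult[OF f])
qed

lemma submodule_zero: "module K N \<Longrightarrow> submodule {\<zero>\<^bsub>N\<^esub>} K N"
proof -
  assume "module K N"
  then interpret module K N .
  show ?thesis by (rule submoduleI') auto
qed

lemma submodule_image: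
  assumes M: "module K M" and N: "module K N" and f: "f \<in> linear_hom K M N"
  shows "submodule (f ` carrier M) K N"
proof -
  interpret M: module K M by (rule M)
  interpret N: module K N by (rule N)
  show ?thesis
  proof (rule N.submoduleI')
    show "f ` carrier M \<subseteq> carrier N" using linear_hom_closed[OF f] by auto
    show "\<zero>\<^bsub>N\<^esub> \<in> f ` carrier M" using linear_hom_zero[OF M N f] by force
    fix u w assume "u \<in> f ` carrier M" "w \<in> f ` carrier M"
    then obtain x y where xy: "x \<in> carrier M" "y \<in> carrier M" "u = f x" "w = f y" by auto
    then show "u \<oplus>\<^bsub>N\<^esub> w \<in> f ` carrier M" using linear_hom_add[OF f xy(1,2)] by (metis M.M.a_closed image_eqI)
  next
    fix a u assume a: "a \<in> carrier K" "u \<in> f ` carrier M"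
    then obtain x where x: "x \<in> carrier M" "u = f x" by auto
    then show "a \<odot>\<^bsub>N\<^esub> u \<in> f ` carrier M" using linear_hom_smult[OF f a(1) x(1)] a by (metis M.smult_closed image_eqI)
  qed
qed

lemma linear_rel_image:
  assumes U: "module K U" and "module K M" "module K N" and f: "f \<in> linear_hom K U M" and g: "g \<in> linear_hom K U N"
    and W: "submodule W K U"
  shows "linear_rel K M N ((\<lambda>e. (f e, g e)) ` W)"
proof -
  interpret U: module K U by (rule U)
  have WU: "e \<in> carrier U" if "e \<in> W" for e using U.submoduleE(1)[OF W] that by auto
  have W0: "\<zero>\<^bsub>U\<^esub> \<in> W" using submodule.axioms(1)[OF W] subgroup.one_closed by fastforce
  show ?thesis
  proof (rule linear_relI)
    show "(\<zero>\<^bsub>M\<^esub>, \<zero>\<^bsub>N\<^esub>) \<in> (\<lambda>e. (f e, g e)) ` W"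
      using linear_hom_zero[OF U assms(2) f] linear_hom_zero[OF U assms(3) g] by (intro image_eqI[OF _ W0]) simp
  next
    fix x y x' y' assume "(x, y) \<in> (\<lambda>e. (f e, g e)) ` W" "(x', y') \<in> (\<lambda>e. (f e, g e)) ` W"
    then obtain e e' where e: "e \<in> W" "e' \<in> W" "x = f e" "y = g e" "x' = f e'" "y' = g e'" by auto
    then show "(x \<oplus>\<^bsub>M\<^esub> x', y \<oplus>\<^bsub>N\<^esub> y') \<in> (\<lambda>e. (f e, g e)) ` W"
      using linear_hom_add[OF f WU WU, of e e'] linear_hom_add[OF g WU WU, of e e'] U.submoduleE(5)[OF W e(1,2)]
      by (intro image_eqI[of _ _ "e \<oplus>\<^bsub>U\<^esub> e'"]) simp_all
  next
    fix a x y assume a: "a \<in> carrier K" and "(x, y) \<in> (\<lambda>e. (f e, g e)) ` W"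
    then obtain e where e: "e \<in> W" "x = f e" "y = g e" by auto
    then show "(a \<odot>\<^bsub>M\<^esub> x, a \<odot>\<^bsub>N\<^esub> y) \<in> (\<lambda>e. (f e, g e)) ` W"
      using linear_hom_smult[OF f a WU] linear_hom_smult[OF g a WU] U.submoduleE(4)[OF W a e(1)]
      by (intro image_eqI[of _ _ "a \<odot>\<^bsub>U\<^esub> e"]) simp_all
  qed (use linear_hom_closed[OF f] linear_hom_closed[OF g] WU in auto)
qed

text \<open>Every correspondence below is the image of a space \<open>W\<close> of lifts under two
  maps, as in a connecting homomorphism: one map applies a differential to the lift, or merely
  includes it, and the other pushes it forward.\<close>

lemma quot_corr_imageI:
  assumes U: "module K U" and "module K M" "module K N" and f: "f \<in> linear_hom K U M" and g: "g \<in> linear_hom K U N"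
    and W: "submodule W K U"
    and "f ` W = Z" "g ` W = Z'"
    and "\<And>e. e \<in> W \<Longrightarrow> f e \<in> B \<Longrightarrow> g e \<in> B'" "\<And>e. e \<in> W \<Longrightarrow> g e \<in> B' \<Longrightarrow> f e \<in> B"
  shows "quot_corr K M Z B N Z' B'"
  by (rule quot_corrI[OF linear_rel_image[OF assms(1-6)]]) (use assms(7-) in auto)

lemma cohomology_submodules:
  assumes C: "\<And>n. module K (C n)" and \<delta>: "\<And>n. \<delta> n \<in> linear_hom K (C n) (C (Suc n))"
    and sq: "\<And>n x. x \<in> carrier (C n) \<Longrightarrow> \<delta> (Suc n) (\<delta> n x) = \<zero>\<^bsub>C (Suc (Suc n))\<^esub>"
  shows "submodule (cocycles C \<delta> n) K (C n)" "submodule (coboundaries C \<delta> n) K (C n)"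
    "coboundaries C \<delta> n \<subseteq> cocycles C \<delta> n"
proof -
  have zero: "\<zero>\<^bsub>C 0\<^esub> \<in> carrier (C 0)"
    using C[of 0] by (meson abelian_group.axioms(1) abelian_monoid.zero_closed module.axioms(2))
  show "submodule (cocycles C \<delta> n) K (C n)"
    using submodule_vimage[OF C C \<delta> submodule_zero[OF C], of n] by (simp add: cocycles_def)
  show "submodule (coboundaries C \<delta> n) K (C n)"
    by (cases n) (simp_all add: submodule_zero C submodule_image[OF C C \<delta>])
  show "coboundaries C \<delta> n \<subseteq> cocycles C \<delta> n"
    by (cases n) (auto simp: cocycles_def sq linear_hom_closed[OF \<delta>] linear_hom_zero[OF C C \<delta>] zero)
qed

text \<open>\<open>S\<close> plays the part of a submodule of \<open>E\<close>, but the zero and the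
  differential remain those of \<open>E\<close>, so kernels and images need no module structure of
  their own.\<close>

definition cocycles_in :: "('g, 'm) monoid_scheme \<Rightarrow> ('k, 'v, 'g) gmodule \<Rightarrow> 'v set \<Rightarrow> nat \<Rightarrow> ('g list \<Rightarrow> 'v) set" where
  "cocycles_in G E S i = {c \<in> tuples G i \<rightarrow>\<^sub>E S. \<forall>l \<in> tuples G (Suc i). cochain_diff G E i c l = \<zero>\<^bsub>E\<^esub>}"

text \<open>The index is the degree of the source: these are elements of degree
  \<open>Suc i\<close>, to be paired with \<open>cocycles_in\<close> at \<open>Suc i\<close>. The
  primitive, and not just the coboundary, must have values in \<open>S\<close>.\<close>

definition coboundaries_in :: "('g, 'm) monoid_scheme \<Rightarrow> ('k, 'v, 'g) gmodule \<Rightarrow> 'v set \<Rightarrow> nat \<Rightarrow> ('g list \<Rightarrow> 'v) set" where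
  "coboundaries_in G E S i = cochain_diff G E i ` (tuples G i \<rightarrow>\<^sub>E S)"

lemma cochains_simps:
  "carrier (cochains G V n) = (tuples G n \<rightarrow>\<^sub>E carrier V)"
  "\<zero>\<^bsub>cochains G V n\<^esub> = (\<lambda>l \<in> tuples G n. \<zero>\<^bsub>V\<^esub>)"
  "f \<oplus>\<^bsub>cochains G V n\<^esub> h = (\<lambda>l \<in> tuples G n. f l \<oplus>\<^bsub>V\<^esub> h l)"
  "a \<odot>\<^bsub>cochains G V n\<^esub> f = (\<lambda>l \<in> tuples G n. a \<odot>\<^bsub>V\<^esub> f l)"
  by (simp_all add: cochains_def)

context kG_module
begin

lemma cochain_diff_sq':
  assumes "e \<in> carrier (cochains G V n)"
  shows "cochain_diff G V (Suc n) (cochain_diff G V n e) = \<zero>\<^bsub>cochains G V (Suc (Suc n))\<^esub>"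
proof (rule extensionalityI[of _ "tuples G (Suc (Suc n))"])
  have "e \<in> tuples G n \<rightarrow> carrier V" using assms by (auto simp: cochains_simps)
  then show "cochain_diff G V (Suc n) (cochain_diff G V n e) l = \<zero>\<^bsub>cochains G V (Suc (Suc n))\<^esub> l"
    if "l \<in> tuples G (Suc (Suc n))" for l
    using cochain_diff_sq[OF _ that] that by (simp add: cochains_simps)
qed (simp_all add: cochain_diff_def cochains_simps)

lemma ex_cochain_diff:
  assumes "has_trace G K V" and c: "c \<in> tuples G (Suc n) \<rightarrow>\<^sub>E carrier V"
    and "\<And>l. l \<in> tuples G (Suc (Suc n)) \<Longrightarrow> cochain_diff G V (Suc n) c l = \<zero>\<^bsub>V\<^esub>"
  obtains e where "e \<in> tuples G n \<rightarrow>\<^sub>E carrier V" "cochain_diff G V n e = c"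
proof -
  obtain \<theta> where "\<theta> \<in> linear_hom K V V"
    "\<And>x. x \<in> carrier V \<Longrightarrow> (\<Oplus>\<^bsub>V\<^esub>g \<in> carrier G. act V (inv\<^bsub>G\<^esub> g) (\<theta> (act V g x))) = x"
    using assms(1) by (auto simp: has_trace_def)
  from cocycle_is_coboundary_of_trace[OF this c assms(3) that] show thesis .
qed

end

definition push_cochain :: "('g, 'm) monoid_scheme \<Rightarrow> ('v \<Rightarrow> 'w) \<Rightarrow> nat \<Rightarrow> ('g list \<Rightarrow> 'v) \<Rightarrow> 'g list \<Rightarrow> 'w" where
  "push_cochain G \<pi> i e = (\<lambda>l \<in> tuples G i. \<pi> (e l))"

context
  fixes G :: "('g, 'm) monoid_scheme" and K :: "('k, 'n) ring_scheme"
    and E :: "('k, 'v, 'g) gmodule" and E' :: "('k, 'w, 'g) gmodule" and \<pi>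
  assumes E: "kG_module G K E" and E': "kG_module G K E'" and \<pi>: "\<pi> \<in> kG_hom G K E E'"
begin

interpretation E: kG_module G K E by (rule E)
interpretation E': kG_module G K E' by (rule E')

lemmas \<pi>_lin = kG_homD(1)[OF \<pi>] and \<pi>_act = kG_homD(2)[OF \<pi>]

lemma push_cochain_linear: "push_cochain G \<pi> i \<in> linear_hom K (cochains G E i) (cochains G E' i)"
  by (intro linear_homI)
    (auto simp: cochains_simps push_cochain_def linear_hom_closed[OF \<pi>_lin] linear_hom_add[OF \<pi>_lin]
      linear_hom_smult[OF \<pi>_lin] PiE_iff fun_eq_iff)

lemma cochain_diff_push:
  assumes e: "e \<in> tuples G i \<rightarrow>\<^sub>E carrier E"
  shows "cochain_diff G E' i (push_cochain G \<pi> i e) = push_cochain G \<pi> (Suc i) (cochain_diff G E i e)"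
proof -
  have e1: "e \<in> tuples G i \<rightarrow> carrier E" using e by auto
  have "cochain_diff G E' i (\<lambda>m. \<pi> (e m)) = cochain_diff G E' i (push_cochain G \<pi> i e)"
    using e1 by (intro E'.cochain_diff_cong) (auto simp: push_cochain_def Pi_iff linear_hom_closed[OF \<pi>_lin])
  moreover have "cochain_diff G E' i (\<lambda>m. \<pi> (e m)) = push_cochain G \<pi> (Suc i) (cochain_diff G E i e)"
    using E.cochain_diff_kG_hom[OF E' \<pi> e1]
    by (intro extensionalityI[of _ "tuples G (Suc i)"]) (auto simp: cochain_diff_def push_cochain_def)
  ultimately show ?thesis by simp
qed

lemma lift_cochain:
  assumes b: "b \<in> tuples G i \<rightarrow>\<^sub>E \<pi> ` carrier E"
  obtains e where "e \<in> tuples G i \<rightarrow>\<^sub>E carrier E" "push_cochain G \<pi> i e = b"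
proof -
  define e where "e = (\<lambda>l \<in> tuples G i. SOME x. x \<in> carrier E \<and> \<pi> x = b l)"
  have "\<exists>x. x \<in> carrier E \<and> \<pi> x = b l" if "l \<in> tuples G i" for l using PiE_mem[OF b that] by auto
  from someI_ex[OF this] have e: "e l \<in> carrier E \<and> \<pi> (e l) = b l" if "l \<in> tuples G i" for l
    using that by (simp add: e_def)
  have "push_cochain G \<pi> i e = b"
    using b e by (intro extensionalityI[of _ "tuples G i"]) (auto simp: push_cochain_def PiE_def)
  moreover have "e \<in> tuples G i \<rightarrow>\<^sub>E carrier E" using e by (auto simp: e_def)
  ultimately show thesis using that by blast
qed

lemma push_cochain_eq_zero_iff:
  assumes e: "e \<in> tuples G i \<rightarrow>\<^sub>E carrier E"
  shows "push_cochain G \<pi> i e = \<zero>\<^bsub>cochains G E' i\<^esub> \<longleftrightarrow> e \<in> tuples G i \<rightarrow>\<^sub>E {x \<in> carrier E. \<pi> x = \<zero>\<^bsub>E'\<^esub>}"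
proof
  assume "push_cochain G \<pi> i e = \<zero>\<^bsub>cochains G E' i\<^esub>"
  then have "\<pi> (e l) = \<zero>\<^bsub>E'\<^esub>" if "l \<in> tuples G i" for l
    using that by (auto simp: push_cochain_def cochains_simps dest!: fun_cong[of _ _ l])
  then show "e \<in> tuples G i \<rightarrow>\<^sub>E {x \<in> carrier E. \<pi> x = \<zero>\<^bsub>E'\<^esub>}" using e by auto
next
  assume "e \<in> tuples G i \<rightarrow>\<^sub>E {x \<in> carrier E. \<pi> x = \<zero>\<^bsub>E'\<^esub>}"
  then have "\<pi> (e l) = \<zero>\<^bsub>E'\<^esub>" if "l \<in> tuples G i" for l using PiE_mem[OF _ that] by auto
  then show "push_cochain G \<pi> i e = \<zero>\<^bsub>cochains G E' i\<^esub>"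
    by (auto simp: push_cochain_def cochains_simps fun_eq_iff)
qed

text \<open>For 0 -> S -> E -> S' -> 0 with \<open>E\<close> acyclic, the connecting map gives
  H^{i+1}(G, S') = H^{i+2}(G, S). The lifts are the cochains e with values in \<open>E\<close> whose
  coboundary has values in \<open>S\<close>: \<pi> e is a cocycle in S' and \<delta> e a cocycle in
  S. Acyclicity makes every cocycle of S arise in this way.\<close>

lemma dimension_shift:
  assumes tr: "has_trace G K E"
  defines "S \<equiv> {x \<in> carrier E. \<pi> x = \<zero>\<^bsub>E'\<^esub>}" and "S' \<equiv> \<pi> ` carrier E"
  shows "quot_corr K (cochains G E (Suc (Suc i))) (cocycles_in G E S (Suc (Suc i))) (coboundaries_in G E S (Suc i))
    (cochains G E' (Suc i)) (cocycles_in G E' S' (Suc i)) (coboundaries_in G E' S' i)"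
proof -
  let ?\<delta> = "cochain_diff G E" and ?\<delta>' = "cochain_diff G E'" and ?p = "push_cochain G \<pi>"
  define W where "W = {e \<in> carrier (cochains G E (Suc i)). ?p (Suc (Suc i)) (?\<delta> (Suc i) e) \<in> {\<zero>\<^bsub>cochains G E' (Suc (Suc i))\<^esub>}}"
  interpret U: module K "cochains G E (Suc i)" by (rule E.module_cochains)
  note lins = E.cochain_diff_linear push_cochain_linear
  have \<delta>cl: "?\<delta> j e \<in> tuples G (Suc j) \<rightarrow>\<^sub>E carrier E" if "e \<in> tuples G j \<rightarrow>\<^sub>E carrier E" for e j
    using that by (intro E.cochain_diff_closed) auto
  have \<delta>\<delta>: "?\<delta> (Suc j) (?\<delta> j e) = \<zero>\<^bsub>cochains G E (Suc (Suc j))\<^esub>" if "e \<in> tuples G j \<rightarrow>\<^sub>E carrier E" for e j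
    by (rule E.cochain_diff_sq') (use that in \<open>simp add: cochains_simps\<close>)
  have pS': "?p j e \<in> tuples G j \<rightarrow>\<^sub>E S'" if "e \<in> tuples G j \<rightarrow>\<^sub>E carrier E" for e j
    using that by (auto simp: push_cochain_def S'_def)
  have W: "e \<in> W \<longleftrightarrow> e \<in> tuples G (Suc i) \<rightarrow>\<^sub>E carrier E \<and> ?\<delta> (Suc i) e \<in> tuples G (Suc (Suc i)) \<rightarrow>\<^sub>E S" for e
    using push_cochain_eq_zero_iff[OF \<delta>cl, of e "Suc i"] by (auto simp: W_def cochains_simps S_def)
  have SE: "c \<in> tuples G j \<rightarrow>\<^sub>E carrier E" if "c \<in> tuples G j \<rightarrow>\<^sub>E S" for c j
    using that by (auto simp: S_def)
  show ?thesis
  proof (rule quot_corr_imageI[where U = "cochains G E (Suc i)" and W = W and f = "?\<delta> (Suc i)" and g = "?p (Suc i)"])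
    show "submodule W K (cochains G E (Suc i))"
      unfolding W_def
      by (rule submodule_vimage[OF E.module_cochains E'.module_cochains linear_hom_comp[OF lins] submodule_zero[OF E'.module_cochains]])
    show "?\<delta> (Suc i) ` W = cocycles_in G E S (Suc (Suc i))"
    proof (intro equalityI subsetI)
      fix c assume "c \<in> ?\<delta> (Suc i) ` W"
      then obtain e where e: "e \<in> tuples G (Suc i) \<rightarrow>\<^sub>E carrier E" "c \<in> tuples G (Suc (Suc i)) \<rightarrow>\<^sub>E S" "c = ?\<delta> (Suc i) e"
        by (auto simp: W)
      then show "c \<in> cocycles_in G E S (Suc (Suc i))"
        using \<delta>\<delta>[OF e(1)] by (simp add: cocycles_in_def cochains_simps)
    next
      fix c assume c: "c \<in> cocycles_in G E S (Suc (Suc i))"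
      then obtain e where "e \<in> tuples G (Suc i) \<rightarrow>\<^sub>E carrier E" "?\<delta> (Suc i) e = c"
        using E.ex_cochain_diff[OF tr SE, of c "Suc i"] by (auto simp: cocycles_in_def)
      then show "c \<in> ?\<delta> (Suc i) ` W" using c by (auto simp: W cocycles_in_def)
    qed
    show "?p (Suc i) ` W = cocycles_in G E' S' (Suc i)"
    proof (intro equalityI subsetI)
      fix b assume "b \<in> ?p (Suc i) ` W"
      then obtain e where e: "e \<in> tuples G (Suc i) \<rightarrow>\<^sub>E carrier E"
          "?\<delta> (Suc i) e \<in> tuples G (Suc (Suc i)) \<rightarrow>\<^sub>E S" "b = ?p (Suc i) e"
        by (auto simp: W)
      then show "b \<in> cocycles_in G E' S' (Suc i)"
        using pS'[OF e(1)] push_cochain_eq_zero_iff[OF \<delta>cl[OF e(1)]]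
        by (simp add: cocycles_in_def cochain_diff_push cochains_simps S_def)
    next
      fix b assume b: "b \<in> cocycles_in G E' S' (Suc i)"
      then obtain e where e: "e \<in> tuples G (Suc i) \<rightarrow>\<^sub>E carrier E" "?p (Suc i) e = b"
        using lift_cochain[of b "Suc i"] by (auto simp: cocycles_in_def S'_def)
      have "?p (Suc (Suc i)) (?\<delta> (Suc i) e) = \<zero>\<^bsub>cochains G E' (Suc (Suc i))\<^esub>"
        using b e(2) cochain_diff_push[OF e(1)]
        by (intro extensionalityI[of _ "tuples G (Suc (Suc i))"]) (auto simp: cocycles_in_def cochains_simps push_cochain_def)
      then have "e \<in> W" using e by (simp add: W_def cochains_simps)
      then show "b \<in> ?p (Suc i) ` W" using e by auto
    qed
    fix e assume eW: "e \<in> W"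
    then have e: "e \<in> carrier (cochains G E (Suc i))" by (simp add: W_def)
    {
      assume "?\<delta> (Suc i) e \<in> coboundaries_in G E S (Suc i)"
      then obtain a where a: "a \<in> tuples G (Suc i) \<rightarrow>\<^sub>E S" "?\<delta> (Suc i) e = ?\<delta> (Suc i) a"
        by (auto simp: coboundaries_in_def)
      have aU: "a \<in> carrier (cochains G E (Suc i))" using SE[OF a(1)] by (simp add: cochains_simps)
      interpret U2: module K "cochains G E (Suc (Suc i))" by (rule E.module_cochains)
      interpret U': module K "cochains G E' (Suc i)" by (rule E'.module_cochains)
      \<comment> \<open>\<open>e\<close> and \<open>a\<close> have the same coboundary, so
        \<open>c\<close> is a cocycle of the acyclic \<open>E\<close>, say \<delta> e'. Since \<pi>
        kills \<open>a\<close>, \<pi> e = \<pi> c = \<delta> \<pi> e'.\<close>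
      define c where "c = e \<ominus>\<^bsub>cochains G E (Suc i)\<^esub> a"
      have c: "c \<in> tuples G (Suc i) \<rightarrow>\<^sub>E carrier E" using e aU U.M.minus_closed[OF e aU] by (simp add: c_def cochains_simps)
      have "?\<delta> (Suc i) c = \<zero>\<^bsub>cochains G E (Suc (Suc i))\<^esub>"
        using a(2) linear_hom_closed[OF lins(1) aU]
        unfolding c_def linear_hom_minus[OF E.module_cochains E.module_cochains lins(1) e aU]
        by (simp add: a_minus_def U2.M.r_neg)
      then obtain e' where e': "e' \<in> tuples G i \<rightarrow>\<^sub>E carrier E" "?\<delta> i e' = c"
        using E.ex_cochain_diff[OF tr c] by (auto simp: cochains_simps)
      have "?p (Suc i) a = \<zero>\<^bsub>cochains G E' (Suc i)\<^esub>"
        using push_cochain_eq_zero_iff[OF SE[OF a(1)]] a(1) by (simp add: S_def)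
      then have "?p (Suc i) c = ?p (Suc i) e"
        using linear_hom_closed[OF lins(2) e]
        unfolding c_def linear_hom_minus[OF E.module_cochains E'.module_cochains lins(2) e aU]
        by (simp add: a_minus_def)
      then have "?p (Suc i) e = ?\<delta>' i (?p i e')" using cochain_diff_push[OF e'(1)] e'(2) by simp
      then show "?p (Suc i) e \<in> coboundaries_in G E' S' i"
        using pS'[OF e'(1)] by (auto simp: coboundaries_in_def)
    }
    {
      assume "?p (Suc i) e \<in> coboundaries_in G E' S' i"
      then obtain b' where b': "b' \<in> tuples G i \<rightarrow>\<^sub>E S'" "?p (Suc i) e = ?\<delta>' i b'"
        by (auto simp: coboundaries_in_def)
      obtain e' where e': "e' \<in> tuples G i \<rightarrow>\<^sub>E carrier E" "?p i e' = b'"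
        using lift_cochain[of b' i] b'(1) by (auto simp: S'_def)
      have \<delta>e': "?\<delta> i e' \<in> carrier (cochains G E (Suc i))" using \<delta>cl[OF e'(1)] by (simp add: cochains_simps)
      interpret U2: module K "cochains G E (Suc (Suc i))" by (rule E.module_cochains)
      interpret U': module K "cochains G E' (Suc i)" by (rule E'.module_cochains)
      \<comment> \<open>Removing the coboundary of a lift of \<open>b'\<close> keeps \<delta> e
        unchanged and makes the image under \<pi> vanish, so the new primitive has values in
        \<open>S\<close>.\<close>
      define a where "a = e \<ominus>\<^bsub>cochains G E (Suc i)\<^esub> ?\<delta> i e'"
      have a: "a \<in> tuples G (Suc i) \<rightarrow>\<^sub>E carrier E" using U.M.minus_closed[OF e \<delta>e'] by (simp add: a_def cochains_simps)
      have "?p (Suc i) a = \<zero>\<^bsub>cochains G E' (Suc i)\<^esub>"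
        using b'(2) e'(2) cochain_diff_push[OF e'(1)] linear_hom_closed[OF lins(2) e]
        unfolding a_def linear_hom_minus[OF E.module_cochains E'.module_cochains lins(2) e \<delta>e']
        by (simp add: a_minus_def U'.M.r_neg)
      then have "a \<in> tuples G (Suc i) \<rightarrow>\<^sub>E S" using push_cochain_eq_zero_iff[OF a] by (simp add: S_def)
      moreover have "?\<delta> (Suc i) e = ?\<delta> (Suc i) a"
        using linear_hom_closed[OF lins(1) e] \<delta>\<delta>[OF e'(1)]
        unfolding a_def linear_hom_minus[OF E.module_cochains E.module_cochains lins(1) e \<delta>e']
        by (simp add: a_minus_def)
      ultimately show "?\<delta> (Suc i) e \<in> coboundaries_in G E S (Suc i)" by (auto simp: coboundaries_in_def)
    }
  qed (rule E.module_cochains E'.module_cochains lins)+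
qed

text \<open>The bottom of the long exact sequence, where H^0 does not vanish: H^1(G, S) is the
  cokernel of E^G -> S'^G. Cochains of degree 0 are identified with elements through
  \<open>\<kappa>\<close>, and (\<delta> x)(g) = g x - x.\<close>

lemma dimension_shift_0:
  assumes tr: "has_trace G K E"
  defines "S \<equiv> {x \<in> carrier E. \<pi> x = \<zero>\<^bsub>E'\<^esub>}" and "S' \<equiv> \<pi> ` carrier E"
  shows "quot_corr K (cochains G E (Suc 0)) (cocycles_in G E S (Suc 0)) (coboundaries_in G E S 0)
    E' (fixed_points E' (carrier G) \<inter> S') (\<pi> ` fixed_points E (carrier G))"
proof -
  define \<kappa> where "\<kappa> x = (\<lambda>l \<in> tuples G 0. x)" for x :: 'v
  define \<delta> where "\<delta> x = cochain_diff G E 0 (\<kappa> x)" for x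
  have \<kappa>: "\<kappa> \<in> linear_hom K E (cochains G E 0)"
    by (intro linear_homI) (auto simp: \<kappa>_def cochains_simps)
  have \<kappa>_surj: "c = \<kappa> (c [])" "c [] \<in> T" if "c \<in> tuples G 0 \<rightarrow>\<^sub>E T" for c T
    using that by (auto simp: \<kappa>_def PiE_def extensional_def fun_eq_iff)
  have \<delta>: "\<delta> \<in> linear_hom K E (cochains G E (Suc 0))"
    unfolding \<delta>_def by (rule linear_hom_comp[OF \<kappa> E.cochain_diff_linear])
  have \<delta>_eq: "\<delta> x [g] = act E g x \<ominus>\<^bsub>E\<^esub> x" if "x \<in> carrier E" "g \<in> carrier G" for x g
  proof -
    have "\<kappa> x \<in> tuples G 0 \<rightarrow> carrier E" using that by (simp add: \<kappa>_def)
    from E.cochain_diff_Cons[OF this that(2), of "[]"] show ?thesis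
      by (simp add: \<delta>_def) (simp add: \<kappa>_def a_minus_def)
  qed
  have \<delta>cl: "\<delta> x \<in> tuples G (Suc 0) \<rightarrow>\<^sub>E carrier E" if "x \<in> carrier E" for x
    using linear_hom_closed[OF \<delta> that] by (simp add: cochains_simps)
  have tup1: "l \<in> tuples G (Suc 0) \<longleftrightarrow> (\<exists>g \<in> carrier G. l = [g])" for l
    by (auto elim!: tuples_SucE)
  have tupB: "(\<forall>l \<in> tuples G (Suc 0). Q l) \<longleftrightarrow> (\<forall>g \<in> carrier G. Q [g])" for Q
    using tup1 by auto
  have minus_zero_iff: "x \<ominus>\<^bsub>M\<^esub> y = \<zero>\<^bsub>M\<^esub> \<longleftrightarrow> x = y" if "abelian_group M" "x \<in> carrier M" "y \<in> carrier M"
    for M :: "('k, 'u, 'g) gmodule" and x y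
  proof -
    interpret abelian_group M by (rule that)
    show ?thesis using that(2,3) by (metis a_minus_def add.inv_solve_right l_zero r_neg zero_closed)
  qed
  have abE: "abelian_group E" "abelian_group E'" by (rule E.V.abelian_group_axioms E'.V.abelian_group_axioms)+
  define W where "W = {x \<in> carrier E. \<pi> x \<in> fixed_points E' (carrier G)}"
  have W: "x \<in> W \<longleftrightarrow> x \<in> carrier E \<and> \<delta> x \<in> tuples G (Suc 0) \<rightarrow>\<^sub>E S" for x
  proof (cases "x \<in> carrier E")
    case True
    have "\<pi> (act E g x \<ominus>\<^bsub>E\<^esub> x) = \<zero>\<^bsub>E'\<^esub> \<longleftrightarrow> act E' g (\<pi> x) = \<pi> x" if g: "g \<in> carrier G" for g
      using True g E.act_closed[OF g True] E'.act_closed[OF g] linear_hom_closed[OF \<pi>_lin]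
      by (simp add: linear_hom_minus[OF E.module_V E'.module_V \<pi>_lin] \<pi>_act minus_zero_iff abE)
    then have "(\<forall>l \<in> tuples G (Suc 0). \<pi> (\<delta> x l) = \<zero>\<^bsub>E'\<^esub>) \<longleftrightarrow> \<pi> x \<in> fixed_points E' (carrier G)"
      using True linear_hom_closed[OF \<pi>_lin True] by (auto simp: tupB \<delta>_eq fixed_points_def)
    moreover have "(\<forall>l \<in> tuples G (Suc 0). \<pi> (\<delta> x l) = \<zero>\<^bsub>E'\<^esub>) \<longleftrightarrow> \<delta> x \<in> tuples G (Suc 0) \<rightarrow>\<^sub>E S"
      using \<delta>cl[OF True] by (auto simp: S_def PiE_iff)
    ultimately show ?thesis using True by (auto simp: W_def)
  qed (auto simp: W_def)
  have diff_fixed: "\<delta> x = \<delta> y \<longleftrightarrow> x \<ominus>\<^bsub>E\<^esub> y \<in> fixed_points E (carrier G)" if "x \<in> carrier E" "y \<in> carrier E" for x y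
  proof -
    have xy: "x \<ominus>\<^bsub>E\<^esub> y \<in> carrier E" using that by simp
    have "\<delta> x = \<delta> y \<longleftrightarrow> \<delta> x \<ominus>\<^bsub>cochains G E (Suc 0)\<^esub> \<delta> y = \<zero>\<^bsub>cochains G E (Suc 0)\<^esub>"
    proof -
      interpret C: module K "cochains G E (Suc 0)" by (rule E.module_cochains)
      show ?thesis using linear_hom_closed[OF \<delta>] that
        by (metis a_minus_def C.M.add.inv_solve_right C.M.l_zero C.M.r_neg C.M.zero_closed)
    qed
    also have "\<dots> \<longleftrightarrow> \<delta> (x \<ominus>\<^bsub>E\<^esub> y) = \<zero>\<^bsub>cochains G E (Suc 0)\<^esub>"
      using that by (simp add: linear_hom_minus[OF E.module_V E.module_cochains \<delta>])
    also have "\<dots> \<longleftrightarrow> (\<forall>l \<in> tuples G (Suc 0). \<delta> (x \<ominus>\<^bsub>E\<^esub> y) l = \<zero>\<^bsub>E\<^esub>)"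
      using \<delta>cl[OF xy] by (auto simp: cochains_simps PiE_def extensional_def fun_eq_iff)
    also have "\<dots> \<longleftrightarrow> x \<ominus>\<^bsub>E\<^esub> y \<in> fixed_points E (carrier G)"
      using xy E.act_closed[OF _ xy] by (auto simp: tupB \<delta>_eq minus_zero_iff abE fixed_points_def)
    finally show ?thesis .
  qed
  show ?thesis
  proof (rule quot_corr_imageI[where U = E and W = W and f = \<delta> and g = \<pi>])
    show "submodule W K E"
      unfolding W_def by (rule submodule_vimage[OF E.module_V E'.module_V \<pi>_lin E'.fixed_points_submodule])
    show "\<delta> ` W = cocycles_in G E S (Suc 0)"
    proof (intro equalityI subsetI)
      fix c assume "c \<in> \<delta> ` W"
      then obtain x where x: "x \<in> carrier E" "c = \<delta> x" "c \<in> tuples G (Suc 0) \<rightarrow>\<^sub>E S" by (auto simp: W)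
      then show "c \<in> cocycles_in G E S (Suc 0)"
        using E.cochain_diff_sq'[OF linear_hom_closed[OF \<kappa> x(1)]] by (simp add: cocycles_in_def \<delta>_def cochains_simps)
    next
      fix c assume c: "c \<in> cocycles_in G E S (Suc 0)"
      then have "c \<in> tuples G (Suc 0) \<rightarrow>\<^sub>E carrier E" by (auto simp: cocycles_in_def S_def)
      then obtain e where e: "e \<in> tuples G 0 \<rightarrow>\<^sub>E carrier E" "cochain_diff G E 0 e = c"
        using E.ex_cochain_diff[OF tr, of c 0] c by (auto simp: cocycles_in_def)
      have "c = \<delta> (e [])" using e \<kappa>_surj(1)[OF e(1)] by (simp add: \<delta>_def)
      moreover from this have "e [] \<in> W" using \<kappa>_surj(2)[OF e(1)] c by (auto simp: W cocycles_in_def)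
      ultimately show "c \<in> \<delta> ` W" by auto
    qed
    show "\<pi> ` W = fixed_points E' (carrier G) \<inter> S'" by (auto simp: W_def S'_def)
    fix x assume "x \<in> W"
    then have x: "x \<in> carrier E" by (simp add: W_def)
    {
      assume "\<delta> x \<in> coboundaries_in G E S 0"
      then obtain a where a: "a \<in> tuples G 0 \<rightarrow>\<^sub>E S" "\<delta> x = cochain_diff G E 0 a" by (auto simp: coboundaries_in_def)
      define s where "s = a []"
      have s: "s \<in> S" "\<delta> x = \<delta> s" using a \<kappa>_surj[OF a(1)] by (auto simp: s_def \<delta>_def)
      then have sE: "s \<in> carrier E" "\<pi> s = \<zero>\<^bsub>E'\<^esub>" by (auto simp: S_def)
      \<comment> \<open>\<open>x\<close> and \<open>s\<close> have the same coboundary, so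
        \<open>x - s\<close> is a fixed point, and \<pi> kills \<open>s\<close>.\<close>
      have "\<pi> x = \<pi> (x \<ominus>\<^bsub>E\<^esub> s)"
        using x sE linear_hom_closed[OF \<pi>_lin x]
        unfolding linear_hom_minus[OF E.module_V E'.module_V \<pi>_lin x sE(1)]
        by (simp add: a_minus_def)
      then show "\<pi> x \<in> \<pi> ` fixed_points E (carrier G)"
        using diff_fixed[OF x sE(1)] s(2) by blast
    }
    {
      assume "\<pi> x \<in> \<pi> ` fixed_points E (carrier G)"
      then obtain y where y: "y \<in> fixed_points E (carrier G)" "\<pi> x = \<pi> y" by auto
      then have yE: "y \<in> carrier E" by (simp add: fixed_points_def)
      \<comment> \<open>Subtracting the fixed point \<open>y\<close> leaves \<delta> x unchanged and
        moves \<open>x\<close> into the kernel of \<pi>.\<close>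
      have s: "x \<ominus>\<^bsub>E\<^esub> y \<in> S"
        using x yE y(2) linear_hom_closed[OF \<pi>_lin]
        by (simp add: S_def linear_hom_minus[OF E.module_V E'.module_V \<pi>_lin] minus_zero_iff abE)
      have sE: "x \<ominus>\<^bsub>E\<^esub> y \<in> carrier E" using x yE by simp
      have "x \<ominus>\<^bsub>E\<^esub> (x \<ominus>\<^bsub>E\<^esub> y) = y"
        using x yE by (simp add: a_minus_def E.V.minus_add E.V.r_neg2 E.V.a_assoc[symmetric] E.V.r_neg)
      then have "\<delta> x = \<delta> (x \<ominus>\<^bsub>E\<^esub> y)" using diff_fixed[OF x sE] y(1) by simp
      moreover have "\<kappa> (x \<ominus>\<^bsub>E\<^esub> y) \<in> tuples G 0 \<rightarrow>\<^sub>E S" using s by (auto simp: \<kappa>_def)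
      ultimately show "\<delta> x \<in> coboundaries_in G E S 0" by (auto simp: coboundaries_in_def \<delta>_def)
    }
  qed (rule E.module_V E'.module_V E.module_cochains \<delta> \<pi>_lin)+
qed

text \<open>The start of the shift: the module \<open>V\<close> and the duals P_j^* have different
  element types, so the cohomology of \<open>V\<close> is first rewritten as cohomology with values
  in its image. As \<open>\<pi>\<close> is injective, pushing cochains forward loses
  nothing.\<close>

lemma cohomology_embedding:
  assumes inj: "inj_on \<pi> (carrier E)"
  shows "quot_corr K (cochains G E (Suc i)) (cocycles (cochains G E) (cochain_diff G E) (Suc i))
      (coboundaries (cochains G E) (cochain_diff G E) (Suc i))
    (cochains G E' (Suc i)) (cocycles_in G E' (\<pi> ` carrier E) (Suc i)) (coboundaries_in G E' (\<pi> ` carrier E) i)"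
proof -
  let ?\<delta> = "cochain_diff G E" and ?\<delta>' = "cochain_diff G E'" and ?p = "push_cochain G \<pi>"
  let ?W = "cocycles (cochains G E) (cochain_diff G E) (Suc i)"
  note lins = E.cochain_diff_linear push_cochain_linear
  have pS': "?p j e \<in> tuples G j \<rightarrow>\<^sub>E \<pi> ` carrier E" if "e \<in> tuples G j \<rightarrow>\<^sub>E carrier E" for e j
    using that by (auto simp: push_cochain_def)
  have \<delta>cl: "?\<delta> j e \<in> tuples G (Suc j) \<rightarrow>\<^sub>E carrier E" if "e \<in> tuples G j \<rightarrow>\<^sub>E carrier E" for e j
    using that by (intro E.cochain_diff_closed) auto
  have p_inj: "a = b" if "?p j a = ?p j b" "a \<in> tuples G j \<rightarrow>\<^sub>E carrier E" "b \<in> tuples G j \<rightarrow>\<^sub>E carrier E" for a b j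
  proof (rule extensionalityI[of _ "tuples G j"])
    fix l assume l: "l \<in> tuples G j"
    then have "\<pi> (a l) = \<pi> (b l)" using fun_cong[OF that(1), of l] by (simp add: push_cochain_def)
    then show "a l = b l" using inj PiE_mem[OF that(2) l] PiE_mem[OF that(3) l] by (auto dest: inj_onD)
  qed (use that in \<open>auto simp: PiE_def\<close>)
  have WE: "e \<in> tuples G (Suc i) \<rightarrow>\<^sub>E carrier E" "?\<delta> (Suc i) e = \<zero>\<^bsub>cochains G E (Suc (Suc i))\<^esub>" if "e \<in> ?W" for e
    using that by (auto simp: cocycles_def cochains_simps)
  have zero: "?p j \<zero>\<^bsub>cochains G E j\<^esub> = \<zero>\<^bsub>cochains G E' j\<^esub>" for j
    by (rule linear_hom_zero[OF E.module_cochains E'.module_cochains lins(2)])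
  show ?thesis
  proof (rule quot_corr_imageI[where U = "cochains G E (Suc i)" and W = ?W and f = "\<lambda>c. c" and g = "?p (Suc i)"])
    show "submodule ?W K (cochains G E (Suc i))"
      by (rule cohomology_submodules(1)[where C = "cochains G E" and \<delta> = "cochain_diff G E", OF E.module_cochains lins(1) E.cochain_diff_sq'])
    show "?p (Suc i) ` ?W = cocycles_in G E' (\<pi> ` carrier E) (Suc i)"
    proof (intro equalityI subsetI)
      fix b assume "b \<in> ?p (Suc i) ` ?W"
      then obtain e where e: "e \<in> ?W" "b = ?p (Suc i) e" by auto
      then show "b \<in> cocycles_in G E' (\<pi> ` carrier E) (Suc i)"
        using pS'[OF WE(1)] cochain_diff_push[OF WE(1)[OF e(1)]] WE(2)[OF e(1)] zero
        by (simp add: cocycles_in_def cochains_simps)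
    next
      fix b assume b: "b \<in> cocycles_in G E' (\<pi> ` carrier E) (Suc i)"
      then obtain e where e: "e \<in> tuples G (Suc i) \<rightarrow>\<^sub>E carrier E" "?p (Suc i) e = b"
        using lift_cochain[of b "Suc i"] by (auto simp: cocycles_in_def)
      have z: "\<zero>\<^bsub>cochains G E (Suc (Suc i))\<^esub> \<in> tuples G (Suc (Suc i)) \<rightarrow>\<^sub>E carrier E"
        by (auto simp: cochains_simps)
      have "?p (Suc (Suc i)) (?\<delta> (Suc i) e) = \<zero>\<^bsub>cochains G E' (Suc (Suc i))\<^esub>"
        using b e(2) cochain_diff_push[OF e(1)]
        by (intro extensionalityI[of _ "tuples G (Suc (Suc i))"]) (auto simp: cocycles_in_def cochains_simps push_cochain_def)
      then have "?\<delta> (Suc i) e = \<zero>\<^bsub>cochains G E (Suc (Suc i))\<^esub>"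
        using zero by (intro p_inj[OF _ \<delta>cl[OF e(1)] z]) simp
      then show "b \<in> ?p (Suc i) ` ?W" using e by (auto simp: cocycles_def cochains_simps)
    qed
    fix e assume "e \<in> ?W"
    then have e: "e \<in> tuples G (Suc i) \<rightarrow>\<^sub>E carrier E" by (rule WE)
    {
      assume "e \<in> coboundaries (cochains G E) (cochain_diff G E) (Suc i)"
      then obtain a where a: "a \<in> tuples G i \<rightarrow>\<^sub>E carrier E" "e = ?\<delta> i a" by (auto simp: cochains_simps)
      then show "?p (Suc i) e \<in> coboundaries_in G E' (\<pi> ` carrier E) i"
        using pS'[OF a(1)] cochain_diff_push[OF a(1)] unfolding coboundaries_in_def by (metis image_eqI)
    }
    {
      assume "?p (Suc i) e \<in> coboundaries_in G E' (\<pi> ` carrier E) i"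
      then obtain b where b: "b \<in> tuples G i \<rightarrow>\<^sub>E \<pi> ` carrier E" "?p (Suc i) e = ?\<delta>' i b" by (auto simp: coboundaries_in_def)
      obtain a where a: "a \<in> tuples G i \<rightarrow>\<^sub>E carrier E" "?p i a = b" using lift_cochain[OF b(1)] .
      have "e = ?\<delta> i a"
        using b(2) a(2) cochain_diff_push[OF a(1)] by (intro p_inj[OF _ e \<delta>cl[OF a(1)]]) simp
      then show "e \<in> coboundaries (cochains G E) (cochain_diff G E) (Suc i)"
        using a by (auto simp: cochains_simps)
    }
  qed (rule E.module_cochains E'.module_cochains lins | simp add: linear_hom_def)+
qed

end


section \<open>Functionals\<close>

context kG_module
begin

lemma smult_eq_zeroD:
  assumes "a \<in> carrier K" "v \<in> carrier V" "a \<odot>\<^bsub>V\<^esub> v = \<zero>\<^bsub>V\<^esub>" "v \<noteq> \<zero>\<^bsub>V\<^esub>"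
  shows "a = \<zero>\<^bsub>K\<^esub>"
proof (rule ccontr)
  assume "a \<noteq> \<zero>\<^bsub>K\<^esub>"
  then have u: "a \<in> Units K" using assms K.field_Units by auto
  then have "v = (inv\<^bsub>K\<^esub> a \<otimes>\<^bsub>K\<^esub> a) \<odot>\<^bsub>V\<^esub> v" using assms by simp
  also have "\<dots> = \<zero>\<^bsub>V\<^esub>" using assms u by (simp add: V.smult_assoc1 del: K.Units_l_inv)
  finally show False using assms by simp
qed

text \<open>\<open>f\<close> is constant on the fibres of \<open>d\<close>, so it defines a
  functional on the image of \<open>d\<close>. \<open>linear_selection\<close> extends it to
  \<open>V\<close>, with no restriction on the values elsewhere.\<close>

lemma functional_extension:
  fixes W :: "('k, 'w, 'z) module_scheme"
  assumes W: "module K W" and d: "d \<in> linear_hom K W V" and f: "f \<in> linear_hom K W (regular_module K)"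
    and ker: "\<And>y. \<lbrakk>y \<in> carrier W; d y = \<zero>\<^bsub>V\<^esub>\<rbrakk> \<Longrightarrow> f y = \<zero>\<^bsub>K\<^esub>"
  obtains \<phi> where "\<phi> \<in> carrier (dual_gmodule G K V)" "\<And>y. y \<in> carrier W \<Longrightarrow> \<phi> (d y) = f y"
proof -
  interpret W: module K W by (rule W)
  define S where "S = (\<lambda>y. (d y, f y)) ` carrier W"
  have carW: "submodule (carrier W) K W" by (rule W.carrier_is_submodule)
  obtain \<phi> where \<phi>: "\<phi> \<in> linear_hom K V (regular_module K)" "\<And>x y. (x, y) \<in> S \<Longrightarrow> \<phi> x = y"
  proof (rule linear_selection[OF K.field_axioms module_V module_regular, of "carrier V \<times> carrier K" S])
    show "linear_rel K V (regular_module K) (carrier V \<times> carrier K)"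
      by (rule linear_relI) auto
    show "linear_rel K V (regular_module K) S"
      unfolding S_def by (rule linear_rel_image[OF W module_V module_regular d f carW])
    show "S \<subseteq> carrier V \<times> carrier K"
      using linear_hom_closed[OF d] linear_hom_closed[OF f] by (auto simp: S_def)
  qed (use ker in \<open>auto simp: S_def\<close>)
  have "restrict \<phi> (carrier V) (d y) = f y" if "y \<in> carrier W" for y
    using that \<phi>(2) linear_hom_closed[OF d that] by (auto simp: S_def)
  then show thesis using that[OF restrict_in_dual[OF \<phi>(1)]] by blast
qed

text \<open>The coordinate on the line spanned by \<open>v\<close>, extended to all of
  \<open>V\<close>.\<close>

lemma separating_functional:
  assumes v: "v \<in> carrier V" "v \<noteq> \<zero>\<^bsub>V\<^esub>"
  obtains \<phi> where "\<phi> \<in> carrier (dual_gmodule G K V)" "\<phi> v \<noteq> \<zero>\<^bsub>K\<^esub>"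
proof -
  have "(\<lambda>a. a \<odot>\<^bsub>V\<^esub> v) \<in> linear_hom K (regular_module K) V"
    using v by (intro linear_homI) (auto simp: V.smult_l_distr V.smult_assoc1)
  moreover have "(\<lambda>a. a) \<in> linear_hom K (regular_module K) (regular_module K)"
    by (auto simp: linear_hom_def)
  ultimately obtain \<phi> where "\<phi> \<in> carrier (dual_gmodule G K V)" "\<And>a. a \<in> carrier K \<Longrightarrow> \<phi> (a \<odot>\<^bsub>V\<^esub> v) = a"
    using functional_extension[OF module_regular, of "\<lambda>a. a \<odot>\<^bsub>V\<^esub> v" "\<lambda>a. a"] smult_eq_zeroD[OF _ v(1) _ v(2)]
    by auto
  then show thesis using that[of \<phi>] v by (metis K.one_closed K.zero_not_one V.smult_one)
qed

text \<open>Induction on \<open>B\<close>: a functional on the dual that vanishes on the annihilator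
  of a finite set is evaluation at some vector. Adding \<open>b\<close> to the set costs one
  correction by a multiple of evaluation at \<open>b\<close>.\<close>

lemma double_dual_aux:
  assumes "finite B" "B \<subseteq> carrier V" "\<Phi> \<in> linear_hom K (dual_gmodule G K V) (regular_module K)"
    and "\<And>\<xi>. \<lbrakk>\<xi> \<in> carrier (dual_gmodule G K V); \<And>b. b \<in> B \<Longrightarrow> \<xi> b = \<zero>\<^bsub>K\<^esub>\<rbrakk> \<Longrightarrow> \<Phi> \<xi> = \<zero>\<^bsub>K\<^esub>"
  shows "\<exists>v \<in> carrier V. \<forall>\<xi> \<in> carrier (dual_gmodule G K V). \<Phi> \<xi> = \<xi> v"
  using assms
proof (induction B arbitrary: \<Phi>)
  case empty
  have "\<xi> \<zero>\<^bsub>V\<^esub> = \<zero>\<^bsub>K\<^esub>" if "\<xi> \<in> carrier (dual_gmodule G K V)" for \<xi>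
    using that linear_hom_zero[OF module_V module_regular] by (simp add: dual_gmodule_simps)
  then show ?case using empty by (intro bexI[of _ "\<zero>\<^bsub>V\<^esub>"]) auto
next
  case (insert b B)
  let ?D = "dual_gmodule G K V"
  interpret D: kG_module G K ?D by (rule kG_module_dual)
  note \<Phi> = insert.prems(2)
  have b: "b \<in> carrier V" and B: "B \<subseteq> carrier V" using insert.prems(1) by auto
  show ?case
  proof (cases "\<forall>\<xi> \<in> carrier ?D. (\<forall>x \<in> B. \<xi> x = \<zero>\<^bsub>K\<^esub>) \<longrightarrow> \<xi> b = \<zero>\<^bsub>K\<^esub>")
    \<comment> \<open>Here \<open>b\<close> imposes no condition beyond those of \<open>B\<close>,
      so both annihilators agree.\<close>
    case True
    then show ?thesis by (intro insert.IH[OF B \<Phi>] insert.prems(3)) auto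
  next
    case False
    then obtain \<mu> where \<mu>: "\<mu> \<in> carrier ?D" "\<And>x. x \<in> B \<Longrightarrow> \<mu> x = \<zero>\<^bsub>K\<^esub>" "\<mu> b \<noteq> \<zero>\<^bsub>K\<^esub>" by auto
    have \<mu>b: "\<mu> b \<in> Units K" using dual_closed[OF \<mu>(1) b] \<mu>(3) by (simp add: K.field_Units)
    define \<nu> where "\<nu> = inv\<^bsub>K\<^esub> (\<mu> b) \<odot>\<^bsub>?D\<^esub> \<mu>"
    have \<nu>: "\<nu> \<in> carrier ?D" using \<mu>(1) \<mu>b by (simp add: \<nu>_def)
    have \<nu>b: "\<nu> b = \<one>\<^bsub>K\<^esub>" using \<mu>b b by (simp add: \<nu>_def dual_gmodule_simps)
    have \<nu>B: "\<nu> x = \<zero>\<^bsub>K\<^esub>" if "x \<in> B" for x using that B \<mu>(2) \<mu>b by (auto simp: \<nu>_def dual_gmodule_simps)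
    have \<Phi>\<nu>: "\<Phi> \<nu> \<in> carrier K" using linear_hom_closed[OF \<Phi> \<nu>] by simp
    \<comment> \<open>\<open>\<nu>\<close> is dual to \<open>b\<close> modulo \<open>B\<close>: it
      is one at \<open>b\<close> and zero on \<open>B\<close>. Subtracting the value at
      \<open>\<nu>\<close> times evaluation at \<open>b\<close> makes the functional vanish on the
      annihilator of \<open>B\<close> alone.\<close>
    define \<Psi> where "\<Psi> \<xi> = \<Phi> \<xi> \<ominus>\<^bsub>regular_module K\<^esub> \<Phi> \<nu> \<odot>\<^bsub>regular_module K\<^esub> \<xi> b" for \<xi>
    have \<Psi>: "\<Psi> \<in> linear_hom K ?D (regular_module K)"
      unfolding \<Psi>_def using \<Phi>\<nu>
      by (intro linear_hom_minus_fun[OF D.module_V module_regular \<Phi>]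
          linear_hom_smult_fun[OF D.module_V module_regular dual_eval[OF b]])
    have "\<Psi> \<xi> = \<zero>\<^bsub>K\<^esub>" if l: "\<xi> \<in> carrier ?D" "\<And>x. x \<in> B \<Longrightarrow> \<xi> x = \<zero>\<^bsub>K\<^esub>" for \<xi>
    proof -
      have lb: "\<xi> b \<in> carrier K" using dual_closed[OF l(1) b] .
      \<comment> \<open>The part of \<open>\<xi>\<close> that also vanishes at \<open>b\<close>; the
        hypothesis on \<open>\<Phi>\<close> applies to it.\<close>
      define \<kappa> where "\<kappa> = \<xi> \<ominus>\<^bsub>?D\<^esub> \<xi> b \<odot>\<^bsub>?D\<^esub> \<nu>"
      have s: "\<xi> b \<odot>\<^bsub>?D\<^esub> \<nu> \<in> carrier ?D" using lb \<nu> by simp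
      have \<kappa>: "\<kappa> \<in> carrier ?D" unfolding \<kappa>_def using l(1) s by simp
      have \<kappa>x: "\<kappa> x = \<xi> x \<ominus>\<^bsub>K\<^esub> \<xi> b \<otimes>\<^bsub>K\<^esub> \<nu> x" if x: "x \<in> carrier V" for x
        using linear_hom_minus[OF D.module_V module_regular dual_eval[OF x] l(1) s] x
        by (simp add: \<kappa>_def dual_gmodule_simps(4))
      have "\<kappa> x = \<zero>\<^bsub>K\<^esub>" if "x \<in> insert b B" for x
        using that l(2) B b lb \<nu>b \<nu>B by (auto simp: \<kappa>x a_minus_def K.r_neg)
      then have "\<Phi> \<kappa> = \<zero>\<^bsub>K\<^esub>" by (intro insert.prems(3) \<kappa>) auto
      then show ?thesis
        using linear_hom_minus[OF D.module_V module_regular \<Phi> l(1) s] linear_hom_smult[OF \<Phi> lb \<nu>] lb \<Phi>\<nu>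
        by (simp add: \<kappa>_def \<Psi>_def K.m_comm)
    qed
    then obtain w where w: "w \<in> carrier V" "\<And>\<xi>. \<xi> \<in> carrier ?D \<Longrightarrow> \<Psi> \<xi> = \<xi> w"
      using insert.IH[OF B \<Psi>] by blast
    show ?thesis
    proof (intro bexI[of _ "w \<oplus>\<^bsub>V\<^esub> \<Phi> \<nu> \<odot>\<^bsub>V\<^esub> b"] ballI)
      show "w \<oplus>\<^bsub>V\<^esub> \<Phi> \<nu> \<odot>\<^bsub>V\<^esub> b \<in> carrier V" using w b \<Phi>\<nu> by simp
      fix \<xi> assume l: "\<xi> \<in> carrier ?D"
      then have ll: "\<xi> \<in> linear_hom K V (regular_module K)" by (simp add: dual_gmodule_simps)
      have c: "\<Phi> \<xi> \<in> carrier K" "\<xi> b \<in> carrier K" "\<xi> w \<in> carrier K"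
        using linear_hom_closed[OF \<Phi> l] dual_closed[OF l] b w by auto
      have "\<xi> (w \<oplus>\<^bsub>V\<^esub> \<Phi> \<nu> \<odot>\<^bsub>V\<^esub> b) = \<xi> w \<oplus>\<^bsub>K\<^esub> \<Phi> \<nu> \<otimes>\<^bsub>K\<^esub> \<xi> b"
        using w b \<Phi>\<nu> by (simp add: linear_hom_add[OF ll] linear_hom_smult[OF ll])
      also have "\<xi> w = \<Phi> \<xi> \<ominus>\<^bsub>K\<^esub> \<Phi> \<nu> \<otimes>\<^bsub>K\<^esub> \<xi> b" using w(2)[OF l] by (simp add: \<Psi>_def)
      finally show "\<Phi> \<xi> = \<xi> (w \<oplus>\<^bsub>V\<^esub> \<Phi> \<nu> \<odot>\<^bsub>V\<^esub> b)"
        using c \<Phi>\<nu> by (simp add: a_minus_def K.a_assoc K.l_neg)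
    qed
  qed
qed

text \<open>A finite spanning set has zero annihilator, so \<open>double_dual_aux\<close> applies to
  every functional on the dual.\<close>

lemma double_dual:
  assumes "finite_dimensional K V" and \<Phi>: "\<Phi> \<in> linear_hom K (dual_gmodule G K V) (regular_module K)"
  obtains v where "v \<in> carrier V" "\<And>\<xi>. \<xi> \<in> carrier (dual_gmodule G K V) \<Longrightarrow> \<Phi> \<xi> = \<xi> v"
proof -
  let ?D = "dual_gmodule G K V"
  interpret D: kG_module G K ?D by (rule kG_module_dual)
  obtain B where B: "finite B" "B \<subseteq> carrier V"
    "\<forall>v \<in> carrier V. \<exists>c \<in> B \<rightarrow> carrier K. v = (\<Oplus>\<^bsub>V\<^esub>b \<in> B. c b \<odot>\<^bsub>V\<^esub> b)"
    using assms(1) unfolding finite_dimensional_def by (elim exE conjE) (rule that)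
  have "\<Phi> \<xi> = \<zero>\<^bsub>K\<^esub>" if l: "\<xi> \<in> carrier ?D" "\<And>b. b \<in> B \<Longrightarrow> \<xi> b = \<zero>\<^bsub>K\<^esub>" for \<xi>
  proof -
    have ll: "\<xi> \<in> linear_hom K V (regular_module K)" using l by (simp add: dual_gmodule_simps)
    have "\<xi> v = \<zero>\<^bsub>K\<^esub>" if v: "v \<in> carrier V" for v
    proof -
      obtain c where c: "c \<in> B \<rightarrow> carrier K" "v = (\<Oplus>\<^bsub>V\<^esub>b \<in> B. c b \<odot>\<^bsub>V\<^esub> b)" using bspec[OF B(3) v] by (elim bexE) (rule that)
      have cb: "c b \<in> carrier K" "b \<in> carrier V" if "b \<in> B" for b using that c B(2) by auto
      have "\<xi> v = (\<Oplus>\<^bsub>regular_module K\<^esub>b \<in> B. \<xi> (c b \<odot>\<^bsub>V\<^esub> b))"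
        unfolding c(2) using cb by (intro linear_hom_finsum[OF module_V module_regular ll]) auto
      also have "\<dots> = (\<Oplus>\<^bsub>K\<^esub>b \<in> B. \<zero>\<^bsub>K\<^esub>)"
        unfolding finsum_regular_module
        using cb l(2) by (intro K.finsum_cong') (auto simp: linear_hom_smult[OF ll])
      finally show ?thesis by simp
    qed
    then have "\<xi> = \<zero>\<^bsub>?D\<^esub>"
      using l by (intro extensionalityI[of _ "carrier V"]) (auto simp: dual_gmodule_simps)
    then show ?thesis using linear_hom_zero[OF D.module_V module_regular \<Phi>] by simp
  qed
  then show thesis using double_dual_aux[OF B(1,2) \<Phi>] that by blast
qed

text \<open>This is Hom_G(V, k): the inverse in the dual action is absorbed because the condition
  ranges over all of \<open>G\<close>.\<close>

lemma dual_fixed_points: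
  "fixed_points (dual_gmodule G K V) (carrier G) =
    {f \<in> carrier (dual_gmodule G K V). \<forall>g \<in> carrier G. \<forall>x \<in> carrier V. f (act V g x) = f x}"
proof -
  have "(\<forall>g \<in> carrier G. act (dual_gmodule G K V) g f = f) \<longleftrightarrow>
      (\<forall>g \<in> carrier G. \<forall>x \<in> carrier V. f (act V g x) = f x)"
    if f: "f \<in> carrier (dual_gmodule G K V)" for f
  proof (intro iffI ballI)
    fix g x assume *: "\<forall>g \<in> carrier G. act (dual_gmodule G K V) g f = f" and g: "g \<in> carrier G" and x: "x \<in> carrier V"
    have "act (dual_gmodule G K V) (inv\<^bsub>G\<^esub> g) f x = f x" using * g by simp
    then show "f (act V g x) = f x" using g x by (simp add: dual_gmodule_simps)
  next
    fix g assume *: "\<forall>g \<in> carrier G. \<forall>x \<in> carrier V. f (act V g x) = f x" and g: "g \<in> carrier G"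
    show "act (dual_gmodule G K V) g f = f"
      using f * g by (intro extensionalityI[of _ "carrier V"]) (auto simp: dual_gmodule_simps)
  qed
  then show ?thesis by (auto simp: fixed_points_def)
qed

end

section \<open>Transposes, and the embedding of \<open>V\<close> into the dual of
  \<open>P 0\<close>\<close>

definition dual_map :: "('k, 'v, 'g) gmodule \<Rightarrow> ('v \<Rightarrow> 'w) \<Rightarrow> ('w \<Rightarrow> 'k) \<Rightarrow> 'v \<Rightarrow> 'k" where
  "dual_map M d f = (\<lambda>x \<in> carrier M. f (d x))"

lemma dual_map_kG_hom:
  assumes M: "kG_module G K M" and N: "kG_module G K N" and d: "d \<in> kG_hom G K M N"
  shows "dual_map M d \<in> kG_hom G K (dual_gmodule G K N) (dual_gmodule G K M)"
proof -
  interpret M: kG_module G K M by (rule M)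
  interpret N: kG_module G K N by (rule N)
  note lin = kG_homD(1)[OF d]
  show ?thesis
  proof (intro kG_homI linear_homI)
    fix f assume "f \<in> carrier (dual_gmodule G K N)"
    then show "dual_map M d f \<in> carrier (dual_gmodule G K M)"
      unfolding dual_map_def by (intro M.restrict_in_dual linear_hom_comp[OF lin]) (simp add: N.dual_gmodule_simps)
  next
    fix g f assume "g \<in> carrier G" "f \<in> carrier (dual_gmodule G K N)"
    then show "dual_map M d (act (dual_gmodule G K N) g f) = act (dual_gmodule G K M) g (dual_map M d f)"
      using linear_hom_closed[OF lin]
      by (auto simp: dual_map_def M.dual_gmodule_simps N.dual_gmodule_simps M.act_closed kG_homD(2)[OF d])
  qed (use linear_hom_closed[OF lin] in \<open>auto simp: dual_map_def M.dual_gmodule_simps N.dual_gmodule_simps\<close>)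
qed

text \<open>Dualising preserves exactness over a field: a functional that kills the image of
  \<open>d\<close> kills the kernel of \<open>d'\<close>, so it extends along
  \<open>d'\<close>.\<close>

lemma dual_map_kernel:
  assumes M: "kG_module G K M" and N: "kG_module G K N" and Q: "kG_module G K Q"
    and d: "d \<in> kG_hom G K M N" and d': "d' \<in> kG_hom G K N Q"
    and dd: "\<And>x. x \<in> carrier M \<Longrightarrow> d' (d x) = \<zero>\<^bsub>Q\<^esub>"
    and ex: "\<And>y. \<lbrakk>y \<in> carrier N; d' y = \<zero>\<^bsub>Q\<^esub>\<rbrakk> \<Longrightarrow> \<exists>x \<in> carrier M. d x = y"
  shows "dual_map N d' ` carrier (dual_gmodule G K Q) =
    {f \<in> carrier (dual_gmodule G K N). dual_map M d f = \<zero>\<^bsub>dual_gmodule G K M\<^esub>}"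
proof -
  interpret M: kG_module G K M by (rule M)
  interpret N: kG_module G K N by (rule N)
  interpret Q: kG_module G K Q by (rule Q)
  note lin = kG_homD(1)[OF d] and lin' = kG_homD(1)[OF d']
  show ?thesis
  proof (intro equalityI subsetI)
    fix f assume "f \<in> dual_map N d' ` carrier (dual_gmodule G K Q)"
    then obtain h where h: "h \<in> carrier (dual_gmodule G K Q)" "f = dual_map N d' h" by auto
    have "h \<zero>\<^bsub>Q\<^esub> = \<zero>\<^bsub>K\<^esub>"
      using h linear_hom_zero[OF Q.module_V Q.module_regular] by (simp add: Q.dual_gmodule_simps)
    then have "dual_map M d f = \<zero>\<^bsub>dual_gmodule G K M\<^esub>"
      using linear_hom_closed[OF lin] dd by (auto simp: h(2) dual_map_def M.dual_gmodule_simps)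
    then show "f \<in> {f \<in> carrier (dual_gmodule G K N). dual_map M d f = \<zero>\<^bsub>dual_gmodule G K M\<^esub>}"
      using linear_hom_closed[OF kG_homD(1)[OF dual_map_kG_hom[OF N Q d']] h(1)] h(2) by simp
  next
    fix f assume "f \<in> {f \<in> carrier (dual_gmodule G K N). dual_map M d f = \<zero>\<^bsub>dual_gmodule G K M\<^esub>}"
    then have f: "f \<in> carrier (dual_gmodule G K N)" "dual_map M d f = \<zero>\<^bsub>dual_gmodule G K M\<^esub>" by auto
    have fd: "f (d x) = \<zero>\<^bsub>K\<^esub>" if "x \<in> carrier M" for x
      using fun_cong[OF f(2), of x] that by (simp add: dual_map_def M.dual_gmodule_simps)
    have fl: "f \<in> linear_hom K N (regular_module K)" using f(1) by (simp add: N.dual_gmodule_simps)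
    obtain h where h: "h \<in> carrier (dual_gmodule G K Q)" "\<And>y. y \<in> carrier N \<Longrightarrow> h (d' y) = f y"
      using Q.functional_extension[OF N.module_V lin' fl] ex fd by metis
    have "f = dual_map N d' h"
      using f(1) h(2) by (intro extensionalityI[of _ "carrier N"]) (auto simp: dual_map_def N.dual_gmodule_simps)
    then show "f \<in> dual_map N d' ` carrier (dual_gmodule G K Q)" using h(1) by auto
  qed
qed

text \<open>The map is V = V^** followed by the transpose of \<epsilon>. It is injective because
  functionals separate points and \<epsilon> reaches all of them; its image consists of the
  functionals that factor through \<epsilon>, since by finite dimension each functional on V^* is an
  evaluation.\<close>

lemma double_dual_embedding:
  fixes V :: "('k, 'v, 'g) gmodule" and M :: "('k, 'p, 'g) gmodule"
  assumes V: "kG_module G K V" and fd: "finite_dimensional K V" and M: "kG_module G K M"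
    and \<epsilon>: "\<epsilon> \<in> kG_hom G K M (dual_gmodule G K V)"
    and surj: "\<And>y. y \<in> carrier (dual_gmodule G K V) \<Longrightarrow> \<exists>x \<in> carrier M. \<epsilon> x = y"
  defines "\<iota> \<equiv> \<lambda>v. \<lambda>x \<in> carrier M. \<epsilon> x v"
  shows "\<iota> \<in> kG_hom G K V (dual_gmodule G K M)" "inj_on \<iota> (carrier V)"
    and "\<iota> ` carrier V = {f \<in> carrier (dual_gmodule G K M).
      \<forall>x \<in> carrier M. \<epsilon> x = \<zero>\<^bsub>dual_gmodule G K V\<^esub> \<longrightarrow> f x = \<zero>\<^bsub>K\<^esub>}"
proof -
  let ?D = "dual_gmodule G K V"
  interpret V: kG_module G K V by (rule V)
  interpret D: kG_module G K ?D by (rule V.kG_module_dual)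
  interpret M: kG_module G K M by (rule M)
  note lin = kG_homD(1)[OF \<epsilon>]
  have \<epsilon>cl: "\<epsilon> x \<in> carrier ?D" if "x \<in> carrier M" for x using linear_hom_closed[OF lin that] .
  have \<epsilon>l: "\<epsilon> x \<in> linear_hom K V (regular_module K)" if "x \<in> carrier M" for x
    using \<epsilon>cl[OF that] by (simp add: V.dual_gmodule_simps)
  have \<iota>cl: "\<iota> v \<in> carrier (dual_gmodule G K M)" if "v \<in> carrier V" for v
    unfolding \<iota>_def by (intro M.restrict_in_dual linear_hom_comp[OF lin V.dual_eval[OF that]])
  show "\<iota> \<in> kG_hom G K V (dual_gmodule G K M)"
  proof (intro kG_homI linear_homI \<iota>cl)
    fix g v assume gv: "g \<in> carrier G" "v \<in> carrier V"
    have "\<epsilon> x (act V g v) = \<epsilon> (act M (inv\<^bsub>G\<^esub> g) x) v" if "x \<in> carrier M" for x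
      using gv that kG_homD(2)[OF \<epsilon>, of "inv\<^bsub>G\<^esub> g" x] by (simp add: V.dual_gmodule_simps)
    then show "\<iota> (act V g v) = act (dual_gmodule G K M) g (\<iota> v)"
      using gv by (auto simp: \<iota>_def M.dual_gmodule_simps M.act_closed)
  qed (auto simp: \<iota>_def M.dual_gmodule_simps linear_hom_add[OF \<epsilon>l] linear_hom_smult[OF \<epsilon>l])
  have eq: "\<xi> v = \<xi> w" if "\<iota> v = \<iota> w" "\<xi> \<in> carrier ?D" for v w \<xi>
  proof -
    obtain x where x: "x \<in> carrier M" "\<epsilon> x = \<xi>" using surj \<open>\<xi> \<in> carrier ?D\<close> by auto
    show ?thesis using fun_cong[OF \<open>\<iota> v = \<iota> w\<close>, of x] x by (simp add: \<iota>_def)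
  qed
  show "inj_on \<iota> (carrier V)"
  proof (rule inj_onI, rule ccontr)
    fix v w assume vw: "v \<in> carrier V" "w \<in> carrier V" "\<iota> v = \<iota> w" "v \<noteq> w"
    have "v \<ominus>\<^bsub>V\<^esub> w \<noteq> \<zero>\<^bsub>V\<^esub>"
      using vw by (metis a_minus_def V.V.add.inv_solve_right V.V.l_zero V.V.zero_closed)
    then obtain \<phi> where \<phi>: "\<phi> \<in> carrier ?D" "\<phi> (v \<ominus>\<^bsub>V\<^esub> w) \<noteq> \<zero>\<^bsub>K\<^esub>"
      using V.separating_functional[of "v \<ominus>\<^bsub>V\<^esub> w"] vw by auto
    have \<phi>l: "\<phi> \<in> linear_hom K V (regular_module K)" using \<phi> by (simp add: V.dual_gmodule_simps)
    have "\<phi> (v \<ominus>\<^bsub>V\<^esub> w) = \<phi> v \<ominus>\<^bsub>K\<^esub> \<phi> w"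
      using linear_hom_minus[OF V.module_V V.module_regular \<phi>l vw(1,2)] by simp
    then show False using \<phi>(2) eq[OF vw(3) \<phi>(1)] V.dual_closed[OF \<phi>(1) vw(2)] by (simp add: a_minus_def V.K.r_neg)
  qed
  show "\<iota> ` carrier V = {f \<in> carrier (dual_gmodule G K M).
      \<forall>x \<in> carrier M. \<epsilon> x = \<zero>\<^bsub>?D\<^esub> \<longrightarrow> f x = \<zero>\<^bsub>K\<^esub>}"
  proof (intro equalityI subsetI)
    fix f assume "f \<in> {f \<in> carrier (dual_gmodule G K M). \<forall>x \<in> carrier M. \<epsilon> x = \<zero>\<^bsub>?D\<^esub> \<longrightarrow> f x = \<zero>\<^bsub>K\<^esub>}"
    then have f: "f \<in> carrier (dual_gmodule G K M)" "\<And>x. \<lbrakk>x \<in> carrier M; \<epsilon> x = \<zero>\<^bsub>?D\<^esub>\<rbrakk> \<Longrightarrow> f x = \<zero>\<^bsub>K\<^esub>" by auto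
    have fl: "f \<in> linear_hom K M (regular_module K)" using f(1) by (simp add: M.dual_gmodule_simps)
    \<comment> \<open>\<open>f\<close> vanishes on the kernel of \<epsilon>, so it comes from a
      functional on the dual of \<open>V\<close>, which is then evaluation at some
      \<open>v\<close>.\<close>
    obtain \<Phi> where \<Phi>: "\<Phi> \<in> carrier (dual_gmodule G K ?D)" "\<And>x. x \<in> carrier M \<Longrightarrow> \<Phi> (\<epsilon> x) = f x"
      using D.functional_extension[OF M.module_V lin fl f(2)] by blast
    have "\<Phi> \<in> linear_hom K ?D (regular_module K)" using \<Phi>(1) by (simp add: D.dual_gmodule_simps)
    then obtain v where v: "v \<in> carrier V" "\<And>\<xi>. \<xi> \<in> carrier ?D \<Longrightarrow> \<Phi> \<xi> = \<xi> v"
      using V.double_dual[OF fd] by blast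
    have "f = \<iota> v"
      using f(1) \<Phi>(2) v(2)[OF \<epsilon>cl]
      by (intro extensionalityI[of _ "carrier M"]) (auto simp: \<iota>_def M.dual_gmodule_simps)
    then show "f \<in> \<iota> ` carrier V" using v(1) by auto
  qed (use \<iota>cl in \<open>auto simp: \<iota>_def V.dual_gmodule_simps\<close>)
qed


section \<open>The connecting isomorphism\<close>

lemma Hom_module_simps:
  "carrier (Hom_module G K M N) = kG_hom G K M N \<inter> extensional (carrier M)"
  "f \<oplus>\<^bsub>Hom_module G K M N\<^esub> h = (\<lambda>x \<in> carrier M. f x \<oplus>\<^bsub>N\<^esub> h x)"
  "\<zero>\<^bsub>Hom_module G K M N\<^esub> = (\<lambda>x \<in> carrier M. \<zero>\<^bsub>N\<^esub>)"
  "a \<odot>\<^bsub>Hom_module G K M N\<^esub> f = (\<lambda>x \<in> carrier M. a \<odot>\<^bsub>N\<^esub> f x)"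
  by (simp_all add: Hom_module_def)

lemma restrict_in_Hom:
  assumes M: "kG_module G K M" and f: "f \<in> kG_hom G K M N"
  shows "restrict f (carrier M) \<in> carrier (Hom_module G K M N)"
proof -
  interpret M: kG_module G K M by (rule M)
  have "restrict f (carrier M) \<in> linear_hom K M N"
    using kG_homD(1)[OF f] by (subst linear_hom_cong[OF _ M.module_V]) auto
  then show ?thesis using kG_homD(2)[OF f] M.act_closed by (auto simp: Hom_module_simps intro!: kG_homI)
qed

lemma module_Hom:
  assumes M: "kG_module G K M" and N: "kG_module G K N"
  shows "module K (Hom_module G K M N)"
proof -
  interpret M: kG_module G K M by (rule M)
  interpret N: kG_module G K N by (rule N)
  note in_Hom = restrict_in_Hom[OF M, of _ N, unfolded Hom_module_simps]
  note cl = linear_hom_closed[OF kG_homD(1)]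
  show ?thesis
    unfolding Hom_module_def
  proof (rule module_pointwise_module[OF N.module_V])
    show "kG_hom G K M N \<inter> extensional (carrier M) \<subseteq> carrier M \<rightarrow>\<^sub>E carrier N"
      by (auto simp: PiE_def dest: cl)
    show "(\<lambda>x\<in>carrier M. \<zero>\<^bsub>N\<^esub>) \<in> kG_hom G K M N \<inter> extensional (carrier M)"
      by (rule in_Hom)
        (auto intro!: kG_homI linear_hom_zero_fun M.module_V N.module_V
          simp: linear_hom_zero[OF N.module_V N.module_V N.act_linear_hom])
  next
    fix f h assume "f \<in> kG_hom G K M N \<inter> extensional (carrier M)" "h \<in> kG_hom G K M N \<inter> extensional (carrier M)"
    then have fh: "f \<in> kG_hom G K M N" "h \<in> kG_hom G K M N" by auto
    show "(\<lambda>x\<in>carrier M. f x \<oplus>\<^bsub>N\<^esub> h x) \<in> kG_hom G K M N \<inter> extensional (carrier M)"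
      using kG_homD[OF fh(1)] kG_homD[OF fh(2)] cl[OF fh(1)] cl[OF fh(2)]
      by (intro in_Hom kG_homI linear_hom_add_fun M.module_V N.module_V) (simp_all add: N.act_add)
  next
    fix a f assume "a \<in> carrier K" "f \<in> kG_hom G K M N \<inter> extensional (carrier M)"
    then have f: "f \<in> kG_hom G K M N" and a: "a \<in> carrier K" by auto
    show "(\<lambda>x\<in>carrier M. a \<odot>\<^bsub>N\<^esub> f x) \<in> kG_hom G K M N \<inter> extensional (carrier M)"
      using kG_homD[OF f] cl[OF f] a
      by (intro in_Hom kG_homI linear_hom_smult_fun M.module_V N.module_V) (simp_all add: N.act_smult)
  qed
qed

lemma compose_linear:
  assumes M: "kG_module G K M" and N: "kG_module G K N" and Q: "kG_module G K Q" and d: "d \<in> kG_hom G K M N"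
  shows "(\<lambda>f. compose (carrier M) f d) \<in> linear_hom K (Hom_module G K N Q) (Hom_module G K M Q)"
proof (rule linear_homI)
  fix f assume "f \<in> carrier (Hom_module G K N Q)"
  then show "compose (carrier M) f d \<in> carrier (Hom_module G K M Q)"
    unfolding compose_def by (intro restrict_in_Hom[OF M] kG_hom_comp[OF d]) (simp add: Hom_module_simps)
qed (use linear_hom_closed[OF kG_homD(1)[OF d]] in \<open>auto simp: Hom_module_simps compose_def\<close>)

text \<open>The connecting map of Hom_G(P, -) on 0 -> k -> L -> Q -> 0. \<open>W\<close> consists of
  the maps F from \<open>P m\<close> to L for which F d has values in the constants: F d is a
  cocycle of Hom_G(P, k) in degree m + 1, and F modulo constants is a cocycle of Hom_G(P, Q) in
  degree m. Hom_G(P, k) appears as the fixed points of the duals.\<close>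

lemma Ext_corr:
  fixes G :: "('g, 'm) monoid_scheme" and H :: "'g set" and K :: "('k, 'n) ring_scheme"
    and V :: "('k, 'v, 'g) gmodule" and P :: "nat \<Rightarrow> ('k, 'p, 'g) gmodule"
  assumes fin: "finite (carrier G)" and r: "ring_char K = r" and H: "subgroup H G"
    and V: "kG_module G K V" and res: "projective_resolution G K P d \<epsilon> (dual_gmodule G K V)"
    and N: "N \<lhd> G\<lparr>carrier := H\<rparr>" "\<not> r dvd card N" and V0: "fixed_points V N = {\<zero>\<^bsub>V\<^esub>}"
  defines "L \<equiv> perm_gmodule G K H"
  defines "S \<equiv> fixed_points L (carrier G)"
  defines "Q \<equiv> quot_gmodule L S"
  defines "C \<equiv> \<lambda>i. Hom_module G K (P i) Q" and "\<delta> \<equiv> \<lambda>i f. compose (carrier (P (Suc i))) f (d i)"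
    and "D \<equiv> \<lambda>i. dual_gmodule G K (P i)"
  shows "quot_corr K (D (Suc m))
    (fixed_points (D (Suc m)) (carrier G) \<inter> {f \<in> carrier (D (Suc m)). dual_map (P (Suc (Suc m))) (d (Suc m)) f = \<zero>\<^bsub>D (Suc (Suc m))\<^esub>})
    (dual_map (P (Suc m)) (d m) ` fixed_points (D m) (carrier G))
    (C m) (cocycles C \<delta> m) (coboundaries C \<delta> m)"
proof -
  interpret V: kG_module G K V by (rule V)
  interpret H: subgroup H G by (rule H)
  note resD = resolutionD[OF res]
  note GK = V.G.group_axioms V.K.field_axioms H
  have L: "kG_module G K L" unfolding L_def by (rule kG_module_perm[OF GK])
  interpret L: kG_module G K L by (rule L)
  have S: "submodule S K L" unfolding S_def by (rule L.fixed_points_submodule)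
  have S_act: "act L g s \<in> S" if "g \<in> carrier G" "s \<in> S" for g s
    using that by (simp add: S_def fixed_points_def)
  have S_iff: "f \<in> S \<longleftrightarrow> (\<exists>c \<in> carrier K. f = (\<lambda>A \<in> lcosets\<^bsub>G\<^esub> H. c))" for f
    unfolding S_def L_def perm_fixed_points[OF GK] by auto
  have Q: "kG_module G K Q" unfolding Q_def by (rule L.kG_module_quot[OF S S_act])
  interpret Q: kG_module G K Q by (rule Q)
  define \<pi> where "\<pi> x = S +>\<^bsub>L\<^esub> x" for x
  have \<pi>: "\<pi> \<in> kG_hom G K L Q" unfolding \<pi>_def[abs_def] Q_def by (rule L.quot_proj[OF S S_act])
  have \<pi>0: "\<pi> x = \<zero>\<^bsub>Q\<^esub> \<longleftrightarrow> x \<in> S" if "x \<in> carrier L" for x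
    unfolding \<pi>_def Q_def by (rule L.quot_proj_eq_zero_iff[OF S S_act that])
  have \<pi>surj: "\<exists>x \<in> carrier L. \<pi> x = u" if u: "u \<in> carrier Q" for u
  proof -
    have "u \<in> carrier (quot_module L S)" using u by (simp add: Q_def quot_gmodule_def del: quot_module_simps)
    then obtain x where "x \<in> carrier L" "u = S +>\<^bsub>L\<^esub> x" by (rule quot_module_carrierE[OF L.module_V S])
    then show ?thesis unfolding \<pi>_def by blast
  qed
  have HL: "H \<in> lcosets\<^bsub>G\<^esub> H" by (rule H_in_lcosets[OF GK])
  have ev: "(\<lambda>f. f H) \<in> linear_hom K L (regular_module K)" unfolding L_def by (rule perm_eval[OF GK HL])
  interpret Pm: kG_module G K "P m" by (rule resD(2))
  interpret PSm: kG_module G K "P (Suc m)" by (rule resD(2))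
  interpret PSSm: kG_module G K "P (Suc (Suc m))" by (rule resD(2))
  note mod = kG_module.module_V[OF resD(2)] and dlin = kG_homD(1)[OF resD(3)]
  have dcl: "d j x \<in> carrier (P j)" if "x \<in> carrier (P (Suc j))" for j x by (rule linear_hom_closed[OF dlin that])
  \<comment> \<open>Hom_G(P, k) -> Hom_G(P, L), induced by the embedding of scalars as constant
    functions.\<close>
  have const: "(\<lambda>x. \<lambda>A \<in> lcosets\<^bsub>G\<^esub> H. f x) \<in> kG_hom G K (P j) L"
    if f: "f \<in> fixed_points (D j) (carrier G)" for j f
  proof -
    interpret Pj: kG_module G K "P j" by (rule resD(2))
    have f1: "f \<in> linear_hom K (P j) (regular_module K)" and f2: "\<And>g x. \<lbrakk>g \<in> carrier G; x \<in> carrier (P j)\<rbrakk> \<Longrightarrow> f (act (P j) g x) = f x"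
      using f unfolding D_def Pj.dual_fixed_points by (auto simp: Pj.dual_gmodule_simps)
    have fcl: "f x \<in> carrier K" if "x \<in> carrier (P j)" for x using linear_hom_closed[OF f1 that] by simp
    show ?thesis
      by (intro kG_homI linear_homI)
        (auto simp: L_def perm_gmodule_simps[OF GK] fcl f2 linear_hom_add[OF f1] linear_hom_smult[OF f1] lcoset_act[OF GK])
  qed
  have C: "module K (C i)" for i unfolding C_def by (rule module_Hom[OF resD(2) Q])
  have U: "module K (Hom_module G K (P m) L)" by (rule module_Hom[OF resD(2) L])
  interpret U: module K "Hom_module G K (P m) L" by (rule U)
  have DSm: "module K (D (Suc m))" unfolding D_def by (rule kG_module.module_V[OF PSm.kG_module_dual])
  define W where "W = {F \<in> carrier (Hom_module G K (P m) L). \<forall>x \<in> carrier (P (Suc m)). F (d m x) \<in> S}"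
  \<comment> \<open>On constant functions the coefficient at the coset \<open>H\<close> is the
    scalar itself.\<close>
  define \<alpha> where "\<alpha> F = (\<lambda>x \<in> carrier (P (Suc m)). F (d m x) H)" for F :: "'p \<Rightarrow> 'g set \<Rightarrow> 'k"
  define \<beta> where "\<beta> F = (\<lambda>x \<in> carrier (P m). \<pi> (F x))" for F
  have UD: "F \<in> kG_hom G K (P m) L" if "F \<in> carrier (Hom_module G K (P m) L)" for F
    using that by (simp add: Hom_module_simps)
  have Fcl: "F x \<in> carrier L" if "F \<in> carrier (Hom_module G K (P m) L)" "x \<in> carrier (P m)" for F x
    using linear_hom_closed[OF kG_homD(1)[OF UD[OF that(1)]] that(2)] .
  have WU: "F \<in> carrier (Hom_module G K (P m) L)" and WS: "\<And>x. x \<in> carrier (P (Suc m)) \<Longrightarrow> F (d m x) \<in> S" if "F \<in> W" for F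
    using that by (auto simp: W_def)
  have S_const: "u = (\<lambda>A \<in> lcosets\<^bsub>G\<^esub> H. u H)" if "u \<in> S" for u
    using that HL by (auto simp: S_iff)
  have \<beta>cl: "\<beta> F \<in> carrier (C m)" if "F \<in> carrier (Hom_module G K (P m) L)" for F
    unfolding \<beta>_def C_def by (intro restrict_in_Hom[OF resD(2)] kG_hom_comp[OF UD[OF that] \<pi>])
  have \<alpha>: "\<alpha> \<in> linear_hom K (Hom_module G K (P m) L) (D (Suc m))"
  proof (rule linear_homI)
    fix F assume "F \<in> carrier (Hom_module G K (P m) L)"
    then show "\<alpha> F \<in> carrier (D (Suc m))"
      unfolding \<alpha>_def D_def
      by (intro PSm.restrict_in_dual linear_hom_comp[OF linear_hom_comp[OF dlin kG_homD(1)[OF UD]] ev])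
  next
    fix F F' assume "F \<in> carrier (Hom_module G K (P m) L)" "F' \<in> carrier (Hom_module G K (P m) L)"
    then show "\<alpha> (F \<oplus>\<^bsub>Hom_module G K (P m) L\<^esub> F') = \<alpha> F \<oplus>\<^bsub>D (Suc m)\<^esub> \<alpha> F'"
      using linear_hom_add[OF ev Fcl Fcl] dcl
      by (auto simp: \<alpha>_def D_def PSm.dual_gmodule_simps Hom_module_simps intro!: restrict_ext)
  next
    fix a F assume "a \<in> carrier K" "F \<in> carrier (Hom_module G K (P m) L)"
    then show "\<alpha> (a \<odot>\<^bsub>Hom_module G K (P m) L\<^esub> F) = a \<odot>\<^bsub>D (Suc m)\<^esub> \<alpha> F"
      using linear_hom_smult[OF ev _ Fcl] dcl
      by (auto simp: \<alpha>_def D_def PSm.dual_gmodule_simps Hom_module_simps intro!: restrict_ext)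
  qed
  have \<beta>: "\<beta> \<in> linear_hom K (Hom_module G K (P m) L) (C m)"
    using linear_hom_add[OF kG_homD(1)[OF \<pi>] Fcl Fcl] linear_hom_smult[OF kG_homD(1)[OF \<pi>] _ Fcl]
    by (intro linear_homI \<beta>cl) (auto simp: \<beta>_def C_def Hom_module_simps intro!: restrict_ext)
  have W: "submodule W K (Hom_module G K (P m) L)"
  proof (rule U.submoduleI')
    show "\<zero>\<^bsub>Hom_module G K (P m) L\<^esub> \<in> W"
      using L.V.submoduleE[OF S] submodule.axioms(1)[OF S] subgroup.one_closed[of S "add_monoid L"] dcl
      by (auto simp: W_def Hom_module_simps(2-4) U.M.zero_closed[unfolded Hom_module_simps(3)])
  next
    fix F F' assume "F \<in> W" "F' \<in> W"
    then show "F \<oplus>\<^bsub>Hom_module G K (P m) L\<^esub> F' \<in> W"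
      using L.V.submoduleE(5)[OF S] dcl U.M.a_closed[of F F'] by (auto simp: W_def Hom_module_simps(2-4))
  next
    fix a F assume "a \<in> carrier K" "F \<in> W"
    then show "a \<odot>\<^bsub>Hom_module G K (P m) L\<^esub> F \<in> W"
      using L.V.submoduleE(4)[OF S] dcl U.smult_closed[of a F] by (auto simp: W_def Hom_module_simps(2-4))
  qed (auto simp: W_def)
  note exact = Hom_perm_exact[OF GK fin r V res N V0, folded L_def]
  have trace: "has_trace G K (P j)" for j
    using projective_has_trace[OF V.G.group_axioms fin V.K.field_axioms V.G.subgroup_self resD(1)] by simp
  \<comment> \<open>Projectivity of the resolution, used through the trace: maps into the quotient
    lift to \<open>L\<close>.\<close>
  have lift: "\<exists>F \<in> kG_hom G K (P j) L. \<forall>x \<in> carrier (P j). \<pi> (F x) = u x" if u: "u \<in> carrier (C j)" for j u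
  proof -
    have u': "u \<in> kG_hom G K (P j) Q" using u by (simp add: C_def Hom_module_simps)
    obtain F where "F \<in> kG_hom G K (P j) L" "\<And>x. x \<in> carrier (P j) \<Longrightarrow> \<pi> (F x) = u x"
    proof (rule kG_hom_lift[OF resD(2) L Q trace u' \<pi>])
      show "\<exists>y \<in> carrier L. \<pi> y = u x" if "x \<in> carrier (P j)" for x
        by (rule \<pi>surj[OF linear_hom_closed[OF kG_homD(1)[OF u'] that]])
    qed (rule that)
    then show ?thesis by blast
  qed
  have \<pi>_diff: "\<pi> x = \<pi> y \<longleftrightarrow> x \<ominus>\<^bsub>L\<^esub> y \<in> S" if "x \<in> carrier L" "y \<in> carrier L" for x y
    unfolding \<pi>_def by (rule coset_eq_iff[OF L.module_V S that])
  \<comment> \<open>The image of F is a coboundary exactly when F differs by constants from a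
    cocycle F'' of Hom_G(P, L). That complex is exact, so cocycle and coboundary mean the same
    there; in degree 0, where the only coboundary is zero, F'' vanishes.\<close>
  have cob: "\<beta> F \<in> coboundaries C \<delta> m \<longleftrightarrow> (\<exists>F'' \<in> kG_hom G K (P m) L.
      (\<forall>x \<in> carrier (P (Suc m)). F'' (d m x) = \<zero>\<^bsub>L\<^esub>) \<and> (\<forall>x \<in> carrier (P m). F x \<ominus>\<^bsub>L\<^esub> F'' x \<in> S))"
    (is "?l \<longleftrightarrow> ?r") if FU: "F \<in> carrier (Hom_module G K (P m) L)" for F
  proof (cases m)
    case 0
    show ?thesis
    proof
      assume ?l
      then have "\<pi> (F x) = \<zero>\<^bsub>Q\<^esub>" if "x \<in> carrier (P m)" for x
        using that 0 by (auto simp: C_def Hom_module_simps \<beta>_def dest!: fun_cong[of _ _ x])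
      then have "F x \<in> S" if "x \<in> carrier (P m)" for x using \<pi>0[OF Fcl[OF FU that]] that by simp
      moreover have "F x \<ominus>\<^bsub>L\<^esub> \<zero>\<^bsub>L\<^esub> = F x" if "x \<in> carrier (P m)" for x
        using Fcl[OF FU that] by simp
      moreover have "(\<lambda>x. \<zero>\<^bsub>L\<^esub>) \<in> kG_hom G K (P m) L"
        by (auto intro!: kG_homI linear_hom_zero_fun mod L.module_V
            simp: linear_hom_zero[OF L.module_V L.module_V L.act_linear_hom])
      ultimately show ?r by (intro bexI[of _ "\<lambda>x. \<zero>\<^bsub>L\<^esub>"]) auto
    next
      assume ?r
      then obtain F'' where F'': "F'' \<in> kG_hom G K (P m) L" "\<And>x. x \<in> carrier (P (Suc m)) \<Longrightarrow> F'' (d m x) = \<zero>\<^bsub>L\<^esub>"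
        "\<And>x. x \<in> carrier (P m) \<Longrightarrow> F x \<ominus>\<^bsub>L\<^esub> F'' x \<in> S" by blast
      have "\<pi> (F x) = \<zero>\<^bsub>Q\<^esub>" if x: "x \<in> carrier (P m)" for x
      proof -
        have "F'' x = \<zero>\<^bsub>L\<^esub>" using exact(1)[OF F''(1,2) 0 x] .
        then show ?thesis
          using F''(3)[OF x] Fcl[OF FU x] \<pi>0[OF Fcl[OF FU x]] by simp
      qed
      then show ?l using 0 by (auto simp: C_def Hom_module_simps \<beta>_def intro!: restrict_ext)
    qed
  next
    case (Suc k)
    have dk: "d k \<in> kG_hom G K (P m) (P k)" using resD(3)[of k] Suc by simp
    have dd: "d k (d m x) = \<zero>\<^bsub>P k\<^esub>" if "x \<in> carrier (P (Suc m))" for x using resD(8)[of x k] that Suc by simp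
    have \<delta>k: "\<delta> k u = (\<lambda>x \<in> carrier (P m). u (d k x))" for u by (simp add: \<delta>_def compose_def Suc)
    show ?thesis
    proof
      assume ?l
      then obtain u where u: "u \<in> carrier (C k)" "\<beta> F = \<delta> k u" using Suc by auto
      obtain F' where F': "F' \<in> kG_hom G K (P k) L" "\<And>x. x \<in> carrier (P k) \<Longrightarrow> \<pi> (F' x) = u x"
        using lift[OF u(1)] by blast
      have "F x \<ominus>\<^bsub>L\<^esub> F' (d k x) \<in> S" if x: "x \<in> carrier (P m)" for x
      proof -
        have dx: "d k x \<in> carrier (P k)" by (rule linear_hom_closed[OF kG_homD(1)[OF dk] x])
        have "\<pi> (F x) = \<pi> (F' (d k x))"
          using fun_cong[OF u(2), of x] x F'(2)[OF dx] by (simp add: \<beta>_def \<delta>k)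
        then show ?thesis using \<pi>_diff[OF Fcl[OF FU x] linear_hom_closed[OF kG_homD(1)[OF F'(1)] dx]] by simp
      qed
      moreover have "F' (d k (d m x)) = \<zero>\<^bsub>L\<^esub>" if "x \<in> carrier (P (Suc m))" for x
        using dd[OF that] linear_hom_zero[OF mod L.module_V kG_homD(1)[OF F'(1)]] by simp
      ultimately show ?r by (intro bexI[OF _ kG_hom_comp[OF dk F'(1)]] conjI ballI)
    next
      assume ?r
      then obtain F'' where F'': "F'' \<in> kG_hom G K (P m) L" "\<And>x. x \<in> carrier (P (Suc m)) \<Longrightarrow> F'' (d m x) = \<zero>\<^bsub>L\<^esub>"
        "\<And>x. x \<in> carrier (P m) \<Longrightarrow> F x \<ominus>\<^bsub>L\<^esub> F'' x \<in> S" by blast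
      obtain F' where F': "F' \<in> kG_hom G K (P k) L" "\<And>x. x \<in> carrier (P m) \<Longrightarrow> F'' x = F' (d k x)"
        using exact(2)[OF F''(1,2) Suc] by blast
      define u where "u = (\<lambda>x \<in> carrier (P k). \<pi> (F' x))"
      have u: "u \<in> carrier (C k)"
        unfolding u_def C_def by (intro restrict_in_Hom[OF resD(2)] kG_hom_comp[OF F'(1) \<pi>])
      have "\<pi> (F x) = \<pi> (F' (d k x))" if x: "x \<in> carrier (P m)" for x
      proof -
        have dx: "d k x \<in> carrier (P k)" by (rule linear_hom_closed[OF kG_homD(1)[OF dk] x])
        show ?thesis using \<pi>_diff[OF Fcl[OF FU x] linear_hom_closed[OF kG_homD(1)[OF F'(1)] dx]] F''(3)[OF x] F'(2)[OF x] by simp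
      qed
      then have "\<beta> F = \<delta> k u"
        using linear_hom_closed[OF kG_homD(1)[OF dk]] by (auto simp: \<beta>_def \<delta>k u_def intro!: restrict_ext)
      then show ?l using u Suc by auto
    qed
  qed
  show ?thesis
  proof (rule quot_corr_imageI[OF U DSm C \<alpha> \<beta> W])
    show "\<alpha> ` W = fixed_points (D (Suc m)) (carrier G) \<inter>
      {f \<in> carrier (D (Suc m)). dual_map (P (Suc (Suc m))) (d (Suc m)) f = \<zero>\<^bsub>D (Suc (Suc m))\<^esub>}"
    proof (intro equalityI subsetI)
      fix f assume "f \<in> \<alpha> ` W"
      then obtain F where F: "F \<in> W" "f = \<alpha> F" by auto
      note FU = WU[OF F(1)] and FS = WS[OF F(1)]
      have fD: "f \<in> carrier (D (Suc m))" using linear_hom_closed[OF \<alpha> FU] F(2) by simp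
      have "f (act (P (Suc m)) g x) = f x" if gx: "g \<in> carrier G" "x \<in> carrier (P (Suc m))" for g x
      proof -
        have "F (d m (act (P (Suc m)) g x)) = act L g (F (d m x))"
          using gx dcl by (simp add: kG_homD(2)[OF resD(3)] kG_homD(2)[OF UD[OF FU]])
        also have "\<dots> = F (d m x)" using FS[OF gx(2)] gx(1) by (simp add: S_def fixed_points_def)
        finally show ?thesis using gx PSm.act_closed by (simp add: F(2) \<alpha>_def)
      qed
      moreover have "f (d (Suc m) y) = \<zero>\<^bsub>K\<^esub>" if y: "y \<in> carrier (P (Suc (Suc m)))" for y
      proof -
        have "F (d m (d (Suc m) y)) = \<zero>\<^bsub>L\<^esub>"
          using resD(8)[OF y] linear_hom_zero[OF mod L.module_V kG_homD(1)[OF UD[OF FU]]] by simp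
        then show ?thesis using dcl[OF y] HL by (simp add: F(2) \<alpha>_def L_def perm_gmodule_simps[OF GK])
      qed
      ultimately show "f \<in> fixed_points (D (Suc m)) (carrier G) \<inter>
        {f \<in> carrier (D (Suc m)). dual_map (P (Suc (Suc m))) (d (Suc m)) f = \<zero>\<^bsub>D (Suc (Suc m))\<^esub>}"
        using fD by (auto simp: D_def PSm.dual_fixed_points dual_map_def PSSm.dual_gmodule_simps)
    next
      fix f assume "f \<in> fixed_points (D (Suc m)) (carrier G) \<inter>
        {f \<in> carrier (D (Suc m)). dual_map (P (Suc (Suc m))) (d (Suc m)) f = \<zero>\<^bsub>D (Suc (Suc m))\<^esub>}"
      then have f: "f \<in> fixed_points (D (Suc m)) (carrier G)" "f \<in> carrier (D (Suc m))"
        and fd: "dual_map (P (Suc (Suc m))) (d (Suc m)) f = \<zero>\<^bsub>D (Suc (Suc m))\<^esub>" by auto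
      have "f (d (Suc m) y) = \<zero>\<^bsub>K\<^esub>" if "y \<in> carrier (P (Suc (Suc m)))" for y
        using fun_cong[OF fd, of y] that by (simp add: dual_map_def D_def PSSm.dual_gmodule_simps)
      then have "(\<lambda>A \<in> lcosets\<^bsub>G\<^esub> H. f (d (Suc m) y)) = \<zero>\<^bsub>L\<^esub>" if "y \<in> carrier (P (Suc (Suc m)))" for y
        using that by (simp add: L_def perm_gmodule_simps[OF GK])
      then obtain F' where F': "F' \<in> kG_hom G K (P m) L"
        "\<And>x. x \<in> carrier (P (Suc m)) \<Longrightarrow> (\<lambda>A \<in> lcosets\<^bsub>G\<^esub> H. f x) = F' (d m x)"
        \<comment> \<open>\<open>f\<close> as a constant-valued map is a cocycle of Hom_G(P, L) in
          degree m + 1, and exactness supplies the primitive.\<close>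
        using exact(2)[OF const[OF f(1)] _ refl] by blast
      define F where "F = restrict F' (carrier (P m))"
      have Fd: "F (d m x) = (\<lambda>A \<in> lcosets\<^bsub>G\<^esub> H. f x)" if "x \<in> carrier (P (Suc m))" for x
        using F'(2)[OF that] dcl[OF that] by (simp add: F_def)
      have fK: "f x \<in> carrier K" if "x \<in> carrier (P (Suc m))" for x
        using PSm.dual_closed f(2) that by (simp add: D_def)
      have "F \<in> W"
        using restrict_in_Hom[OF resD(2) F'(1)] Fd fK unfolding W_def F_def[symmetric] S_iff by auto
      moreover have "f = \<alpha> F"
        using f(2) Fd HL
        by (intro extensionalityI[of _ "carrier (P (Suc m))"]) (auto simp: \<alpha>_def D_def PSm.dual_gmodule_simps)
      ultimately show "f \<in> \<alpha> ` W" by auto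
    qed
    show "\<beta> ` W = cocycles C \<delta> m"
    proof (intro equalityI subsetI)
      fix u assume "u \<in> \<beta> ` W"
      then obtain F where F: "F \<in> W" "u = \<beta> F" by auto
      have "\<pi> (F (d m x)) = \<zero>\<^bsub>Q\<^esub>" if "x \<in> carrier (P (Suc m))" for x
        using \<pi>0[OF Fcl[OF WU[OF F(1)] dcl[OF that]]] WS[OF F(1) that] by simp
      then have "\<delta> m u = \<zero>\<^bsub>C (Suc m)\<^esub>"
        using dcl by (auto simp: \<delta>_def compose_def F(2) \<beta>_def C_def Hom_module_simps intro!: restrict_ext)
      then show "u \<in> cocycles C \<delta> m" using \<beta>cl[OF WU[OF F(1)]] F(2) by (simp add: cocycles_def)
    next
      fix u assume "u \<in> cocycles C \<delta> m"
      then have u: "u \<in> carrier (C m)" "\<delta> m u = \<zero>\<^bsub>C (Suc m)\<^esub>" by (auto simp: cocycles_def)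
      obtain F' where F': "F' \<in> kG_hom G K (P m) L" "\<And>x. x \<in> carrier (P m) \<Longrightarrow> \<pi> (F' x) = u x"
        using lift[OF u(1)] by blast
      define F where "F = restrict F' (carrier (P m))"
      have FU: "F \<in> carrier (Hom_module G K (P m) L)" unfolding F_def by (rule restrict_in_Hom[OF resD(2) F'(1)])
      have "F (d m x) \<in> S" if x: "x \<in> carrier (P (Suc m))" for x
      proof -
        have "u (d m x) = \<zero>\<^bsub>Q\<^esub>"
          using fun_cong[OF u(2), of x] x by (simp add: \<delta>_def compose_def C_def Hom_module_simps)
        then show ?thesis using \<pi>0[OF Fcl[OF FU dcl[OF x]]] F'(2)[OF dcl[OF x]] dcl[OF x] by (simp add: F_def)
      qed
      then have "F \<in> W" using FU by (simp add: W_def)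
      moreover have "u = \<beta> F"
        using u(1) F'(2) by (intro extensionalityI[of _ "carrier (P m)"]) (auto simp: \<beta>_def F_def C_def Hom_module_simps)
      ultimately show "u \<in> \<beta> ` W" by auto
    qed
    fix F assume FW: "F \<in> W"
    note FU = WU[OF FW] and FS = WS[OF FW]
    have Flin: "F \<in> linear_hom K (P m) L" using kG_homD(1)[OF UD[OF FU]] .
    {
      assume "\<alpha> F \<in> dual_map (P (Suc m)) (d m) ` fixed_points (D m) (carrier G)"
      then obtain f where f: "f \<in> fixed_points (D m) (carrier G)" "\<alpha> F = dual_map (P (Suc m)) (d m) f" by auto
      \<comment> \<open>F and c agree on the image of \<open>d m\<close>, since both values are
        constants with the same scalar. So F - c is a cocycle of Hom_G(P, L), and it differs from F
        by the constant-valued c.\<close>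
      define c where "c x = (\<lambda>A \<in> lcosets\<^bsub>G\<^esub> H. f x)" for x
      have c: "c \<in> kG_hom G K (P m) L" unfolding c_def by (rule const[OF f(1)])
      have c_cl: "c x \<in> carrier L" if "x \<in> carrier (P m)" for x by (rule linear_hom_closed[OF kG_homD(1)[OF c] that])
      have cS: "c x \<in> S" if "x \<in> carrier (P m)" for x
        using f(1) that Pm.dual_closed[of f x] by (auto simp: S_iff c_def fixed_points_def D_def)
      have Fc: "F (d m x) = c (d m x)" if x: "x \<in> carrier (P (Suc m))" for x
        using S_const[OF FS[OF x]] fun_cong[OF f(2), of x] x by (simp add: \<alpha>_def dual_map_def c_def)
      show "\<beta> F \<in> coboundaries C \<delta> m"
        unfolding cob[OF FU]
      proof (intro bexI[of _ "\<lambda>x. F x \<ominus>\<^bsub>L\<^esub> c x"] conjI ballI)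
        show "(\<lambda>x. F x \<ominus>\<^bsub>L\<^esub> c x) \<in> kG_hom G K (P m) L" by (rule kG_hom_minus_fun[OF resD(2) L UD[OF FU] c])
        show "F (d m x) \<ominus>\<^bsub>L\<^esub> c (d m x) = \<zero>\<^bsub>L\<^esub>" if "x \<in> carrier (P (Suc m))" for x
          using Fc[OF that] c_cl[OF dcl[OF that]] by (simp add: a_minus_def L.V.r_neg)
        fix x assume x: "x \<in> carrier (P m)"
        have "F x \<ominus>\<^bsub>L\<^esub> (F x \<ominus>\<^bsub>L\<^esub> c x) = c x"
          using Fcl[OF FU x] c_cl[OF x] by (simp add: a_minus_def L.V.minus_add L.V.a_assoc[symmetric] L.V.r_neg)
        then show "F x \<ominus>\<^bsub>L\<^esub> (F x \<ominus>\<^bsub>L\<^esub> c x) \<in> S" using cS[OF x] by simp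
      qed
    }
    {
      assume "\<beta> F \<in> coboundaries C \<delta> m"
      then obtain F'' where F'': "F'' \<in> kG_hom G K (P m) L" "\<And>x. x \<in> carrier (P (Suc m)) \<Longrightarrow> F'' (d m x) = \<zero>\<^bsub>L\<^esub>"
        "\<And>x. x \<in> carrier (P m) \<Longrightarrow> F x \<ominus>\<^bsub>L\<^esub> F'' x \<in> S" unfolding cob[OF FU] by blast
      \<comment> \<open>The constant-valued part of F. As F'' vanishes on the image of
        \<open>d m\<close>, F and E have the same coboundary, and the scalar of E is the required
        invariant functional.\<close>
      define E where "E x = F x \<ominus>\<^bsub>L\<^esub> F'' x" for x
      have E: "E \<in> kG_hom G K (P m) L" unfolding E_def by (rule kG_hom_minus_fun[OF resD(2) L UD[OF FU] F''(1)])
      have ES: "E x \<in> S" if "x \<in> carrier (P m)" for x using F''(3)[OF that] by (simp add: E_def)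
      define f where "f = (\<lambda>x \<in> carrier (P m). E x H)"
      have fD: "f \<in> carrier (D m)"
        unfolding f_def D_def by (intro Pm.restrict_in_dual linear_hom_comp[OF kG_homD(1)[OF E] ev])
      have "E (act (P m) g x) = E x" if "g \<in> carrier G" "x \<in> carrier (P m)" for g x
        using that ES[of x] by (simp add: kG_homD(2)[OF E] S_def fixed_points_def)
      then have "f \<in> fixed_points (D m) (carrier G)"
        using fD unfolding D_def Pm.dual_fixed_points by (simp add: f_def Pm.act_closed)
      moreover have "\<alpha> F = dual_map (P (Suc m)) (d m) f"
      proof -
        have "F (d m x) = E (d m x)" if x: "x \<in> carrier (P (Suc m))" for x
          using F''(2)[OF x] Fcl[OF FU dcl[OF x]] by (simp add: E_def)
        then show ?thesis using dcl by (auto simp: \<alpha>_def dual_map_def f_def intro!: restrict_ext)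
      qed
      ultimately show "\<alpha> F \<in> dual_map (P (Suc m)) (d m) ` fixed_points (D m) (carrier G)" by auto
    }
  qed
qed


theorem theorem1:
  fixes G :: "('g, 'm) monoid_scheme" and H :: "'g set"
    and K :: "('k, 'n) ring_scheme" and r :: nat
    and V :: "('k, 'v, 'g) gmodule"
    and L :: "('k, 'g set \<Rightarrow> 'k, 'g) gmodule"
    and P :: "nat \<Rightarrow> ('k, 'p, 'g) gmodule" and d :: "nat \<Rightarrow> 'p \<Rightarrow> 'p"
    and \<epsilon> :: "'p \<Rightarrow> 'v \<Rightarrow> 'k"
    and n :: nat
  assumes "group G" and "finite (carrier G)"
    and "algebraically_closed K" and "ring_char K = r" and "r > 0"
    and "subgroup H G"
    and "O_prime_core r (G\<lparr>carrier := H\<rparr>) = O_residual r (G\<lparr>carrier := H\<rparr>)"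
    and "L = perm_gmodule G K H"
    and "kG_module G K V" and "finite_dimensional K V"
    and "fixed_points V H = {\<zero>\<^bsub>V\<^esub>}"
    and "projective_resolution G K P d \<epsilon> (dual_gmodule G K V)"
    and "n \<ge> 1"
  shows "linear_iso K (group_cohomology G V n)
           (Ext_module G K P d (quot_gmodule L (fixed_points L (carrier G))) (n - 1))"
proof -
  note fin = assms(2) and r = assms(4) and H = assms(6) and V = assms(9) and res = assms(12)
  interpret V: kG_module G K V by (rule V)
  interpret H: subgroup H G by (rule H)
  note resD = resolutionD[OF res]
  have prime: "Factorial_Ring.prime r" using V.K.ring_char_prime assms(4,5) by simp
  define N where "N = O_prime_core r (G\<lparr>carrier := H\<rparr>)"
  have GH: "group (G\<lparr>carrier := H\<rparr>)" by (rule V.G.subgroup_imp_group[OF H])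
  have finH: "finite (carrier (G\<lparr>carrier := H\<rparr>))" using fin H.subset finite_subset by auto
  have N: "N \<lhd> G\<lparr>carrier := H\<rparr>" "\<not> r dvd card N"
    using group.O_prime_core_normal[OF GH finH prime] by (auto simp: N_def)
  obtain k where k: "order (G\<lparr>carrier := H\<rparr> Mod N) = r ^ k"
    using group.O_residual_normal[OF GH finH prime] assms(7) by (auto simp: N_def)
  have VH: "kG_module (G\<lparr>carrier := H\<rparr>) K V" by (rule kG_module_subgroup[OF V H])
  have V0: "fixed_points V N = {\<zero>\<^bsub>V\<^esub>}"
  proof (rule ccontr)
    assume ne: "fixed_points V N \<noteq> {\<zero>\<^bsub>V\<^esub>}"
    have "N \<subseteq> H" using subgroup.subset[OF normal_imp_subgroup[OF N(1)]] by simp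
    then have "\<zero>\<^bsub>V\<^esub> \<in> fixed_points V N" using assms(11) by (auto simp: fixed_points_def)
    then obtain v where "v \<in> fixed_points V N" "v \<noteq> \<zero>\<^bsub>V\<^esub>" using ne by auto
    from kG_module.ex_fixed_point[OF VH finH r assms(5) N(1) k this] show False using assms(11) by simp
  qed
  obtain m where n: "n = Suc m" using assms(13) by (cases n) auto
  define D where "D i = dual_gmodule G K (P i)" for i
  define \<pi> where "\<pi> i = dual_map (P (Suc i)) (d i)" for i
  \<comment> \<open>The cosyzygies of \<open>V\<close>: \<open>S 0\<close> is a copy of
    \<open>V\<close>, and \<open>S (Suc i)\<close> is also the image of P_i^*, so that 0 -> S i ->
    P_i^* -> S (i + 1) -> 0 is exact with acyclic middle term.\<close>
  define S where "S i = {f \<in> carrier (D i). \<pi> i f = \<zero>\<^bsub>D (Suc i)\<^esub>}" for i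
  define Q where "Q = quot_gmodule L (fixed_points L (carrier G))"
  define C where "C i = Hom_module G K (P i) Q" for i
  define \<delta> where "\<delta> i f = compose (carrier (P (Suc i))) f (d i)" for i and f :: "'p \<Rightarrow> ('g set \<Rightarrow> 'k) set"
  have D: "kG_module G K (D i)" for i unfolding D_def by (rule kG_module.kG_module_dual[OF resD(2)])
  have \<pi>: "\<pi> i \<in> kG_hom G K (D i) (D (Suc i))" for i
    unfolding \<pi>_def D_def by (rule dual_map_kG_hom[OF resD(2) resD(2) resD(3)])
  have S_Suc: "\<pi> i ` carrier (D i) = S (Suc i)" for i
    unfolding \<pi>_def D_def S_def by (rule dual_map_kernel[OF resD(2) resD(2) resD(2) resD(3) resD(3) resD(8,9)])
  have tr: "has_trace G K (D i)" for i
    unfolding D_def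
    by (rule kG_module.has_trace_dual[OF resD(2)])
      (use projective_has_trace[OF assms(1) fin V.K.field_axioms V.G.subgroup_self resD(1)] in simp)
  define \<iota> where "\<iota> v = (\<lambda>x \<in> carrier (P 0). \<epsilon> x v)" for v
  have \<iota>: "\<iota> \<in> kG_hom G K V (D 0)" "inj_on \<iota> (carrier V)" "\<iota> ` carrier V = S 0"
  proof -
    note dde = double_dual_embedding[OF V assms(10) resD(2,4,5), folded D_def]
    show "\<iota> \<in> kG_hom G K V (D 0)" "inj_on \<iota> (carrier V)"
      unfolding \<iota>_def by (rule dde(1), simp, rule dde(2), simp)
    interpret P1: kG_module G K "P (Suc 0)" by (rule resD(2))
    have "(\<forall>x \<in> carrier (P 0). \<epsilon> x = \<zero>\<^bsub>dual_gmodule G K V\<^esub> \<longrightarrow> f x = \<zero>\<^bsub>K\<^esub>) \<longleftrightarrow> \<pi> 0 f = \<zero>\<^bsub>D (Suc 0)\<^esub>" for f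
    proof -
      have "\<pi> 0 f = \<zero>\<^bsub>D (Suc 0)\<^esub> \<longleftrightarrow> (\<forall>y \<in> carrier (P (Suc 0)). f (d 0 y) = \<zero>\<^bsub>K\<^esub>)"
        by (auto simp: \<pi>_def D_def dual_map_def P1.dual_gmodule_simps fun_eq_iff)
      also have "\<dots> \<longleftrightarrow> (\<forall>x \<in> carrier (P 0). \<epsilon> x = \<zero>\<^bsub>dual_gmodule G K V\<^esub> \<longrightarrow> f x = \<zero>\<^bsub>K\<^esub>)"
        using resD(6,7) linear_hom_closed[OF kG_homD(1)[OF resD(3)]] by metis
      finally show ?thesis by simp
    qed
    then show "\<iota> ` carrier V = S 0"
      unfolding \<iota>_def S_def by (subst dde(3)) auto
  qed
  \<comment> \<open>Each shift lowers the degree by one. It stops at j = m, that is in degree 1,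
    where \<open>dimension_shift_0\<close> takes over.\<close>
  have shift: "quot_corr K (cochains G V n) (cocycles (cochains G V) (cochain_diff G V) n)
      (coboundaries (cochains G V) (cochain_diff G V) n)
      (cochains G (D j) (Suc (m - j))) (cocycles_in G (D j) (S j) (Suc (m - j))) (coboundaries_in G (D j) (S j) (m - j))"
    if "j \<le> m" for j
    using that
  proof (induction j)
    case 0
    show ?case using cohomology_embedding[OF V D \<iota>(1,2), of m] by (simp add: n \<iota>(3))
  next
    case (Suc j)
    then have mj: "m - j = Suc (m - Suc j)" by simp
    have "quot_corr K (cochains G (D j) (Suc (m - j))) (cocycles_in G (D j) (S j) (Suc (m - j))) (coboundaries_in G (D j) (S j) (m - j))
      (cochains G (D (Suc j)) (Suc (m - Suc j))) (cocycles_in G (D (Suc j)) (S (Suc j)) (Suc (m - Suc j)))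
      (coboundaries_in G (D (Suc j)) (S (Suc j)) (m - Suc j))"
      using dimension_shift[OF D D \<pi> tr, of j "m - Suc j"] unfolding mj S_Suc S_def[symmetric] .
    with Suc show ?case by (auto intro: quot_corr_trans)
  qed
  \<comment> \<open>The right-hand side is now the cohomology of Hom_G(P, k) in degree m + 1,
    written exactly as on the left of \<open>Ext_corr\<close>, so the two correspondences
    compose.\<close>
  note corr1 = quot_corr_trans[OF shift[OF order.refl, simplified] dimension_shift_0[OF D D \<pi> tr, of m, folded S_def, unfolded S_Suc]]
  note corr2 = Ext_corr[OF fin r H V res N V0, folded assms(8), folded Q_def, folded C_def \<delta>_def D_def \<pi>_def, of m, folded \<pi>_def D_def S_def]
  have L: "kG_module G K L" unfolding assms(8) by (rule kG_module_perm[OF assms(1) V.K.field_axioms H])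
  interpret L: kG_module G K L by (rule L)
  have Q: "kG_module G K Q" unfolding Q_def
    by (rule L.kG_module_quot[OF L.fixed_points_submodule]) (simp add: fixed_points_def)
  have C: "module K (C i)" for i unfolding C_def by (rule module_Hom[OF resD(2) Q])
  have \<delta>: "\<delta> i \<in> linear_hom K (C i) (C (Suc i))" for i
    unfolding \<delta>_def C_def by (rule compose_linear[OF resD(2) resD(2) Q resD(3)])
  have \<delta>\<delta>: "\<delta> (Suc i) (\<delta> i f) = \<zero>\<^bsub>C (Suc (Suc i))\<^esub>" if f: "f \<in> carrier (C i)" for i f
  proof -
    have "f \<zero>\<^bsub>P i\<^esub> = \<zero>\<^bsub>Q\<^esub>"
      using f linear_hom_zero[OF kG_module.module_V[OF resD(2)] kG_module.module_V[OF Q]]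
      by (auto simp: C_def Hom_module_simps kG_hom_def)
    then show ?thesis
      using resD(8) linear_hom_closed[OF kG_homD(1)[OF resD(3)]]
      by (auto simp: \<delta>_def C_def Hom_module_simps compose_def intro!: restrict_ext)
  qed
  note sub1 = cohomology_submodules[where C = "cochains G V" and \<delta> = "cochain_diff G V",
      OF V.module_cochains V.cochain_diff_linear V.cochain_diff_sq']
  note sub2 = cohomology_submodules[where C = C and \<delta> = \<delta>, OF C \<delta> \<delta>\<delta>]
  have "linear_iso K (quot_module (cochains G V n\<lparr>carrier := cocycles (cochains G V) (cochain_diff G V) n\<rparr>)
        (coboundaries (cochains G V) (cochain_diff G V) n))
      (quot_module (C m\<lparr>carrier := cocycles C \<delta> m\<rparr>) (coboundaries C \<delta> m))"
    by (rule linear_iso_quot_module[OF V.module_cochains C sub1(1) sub2(1) sub1(2,3) sub2(2,3)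
          quot_corr_trans[OF corr1 corr2]])
  then show ?thesis
    unfolding group_cohomology_def Ext_module_def cohomology_def Q_def[symmetric] C_def[symmetric]
      \<delta>_def[symmetric] n by (simp add: C_def[abs_def] \<delta>_def[abs_def])
qed

end
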